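(* Let $G$ be a locally compact group, $\varepsilon_G(f)=\int_G f(t)\,dt$ for $f\in C_c(G)$, and $C_c^0(G)=\{f\in C_c(G):\int_G f(t)\,dt=0\}$. Consider the following statements. (1) $G$ is compact. (2) There exist a compact subset $K\subseteq G$ and a $\|\cdot\|_{L^1(G)}$-bounded $\|\cdot\|_{L^1(G)}$-approximate identity $\{h_i\}_{i\in I}$ in $C_c^0(G)$ with $\operatorname{supp}h_i\subseteq K$ for all $i\in I$. (3) $C_c^0(G)$ has a $\mathfrak T$-bounded $\mathfrak T$-approximate identity. (4) $C_c^0(G)_{\mathfrak T}$ has property $(CB)$. (5) $C_c(G)_{\mathfrak T}$ is $\varepsilon_G$-amenable. (a) One has $(1)\Rightarrow(2)\Rightarrow(3)\Rightarrow(4)\Rightarrow(5)$. (b) If $G$ is $\sigma$-compact, then $(5)\Rightarrow(1)$.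
   Context: All vector spaces are complex, topologies Hausdorff, Banach spaces acted on non-zero. $dt$ is a fixed left Haar measure. $C_c(G)$ carries convolution $(f*g)(t)=\int_G f(s)g(s^{-1}t)\,ds$. For non-empty compact $K\subseteq G$, $C_K(G)=\{f\in C_c(G):\operatorname{supp}f\subseteq K\}$; $\mathfrak T$ is the locally convex inductive limit topology on $C_c(G)=\bigcup_K C_K(G)$ when each $C_K(G)$ carries $\|\cdot\|_{L^1(G)}$. $C_c^0(G)$ carries the topology induced by $\mathfrak T$ (denoted $C^0_c(G)_{\mathfrak T}$). A locally convex algebra $B_\sigma$ is an algebra $B$ with a locally convex topology $\sigma$ making multiplication separately continuous. $S\subseteq B$ is $\sigma$-bounded if for each $\sigma$-neighbourhood $V$ of $0$ there is $\kappa>0$ with $S\subseteq\kappa V$. A $\sigma$-approximate identity is a net $\{a_i\}$ in $B$ with $a_ib\to b$ and $ba_i\to b$ in $\sigma$ for all $b\in B$. Maps from $B$ to a Banach space (including $\mathcal L(E)$, the bounded operators with operator norm) are $\sigma$-continuous if continuous into the norm topology. An anti-representation $\Phi:B\to\mathcal L(E)$ is a linear anti-multiplicative map; $\check\Phi(a):=\Phi(a)^*\in\mathcal L(E^* )$. $B_\sigma$ has property $(CB)$ if for each $\sigma$-continuous anti-representation $\Phi:B\to\mathcal L(E)$ on a Banach space and each $\sigma$-continuous linear $\Xi:B\to E^*$ with $\Xi(ab)=\check\Phi(a)\Xi(b)$, there is $\varphi_0\in E^*$ with $\Xi(a)=\check\Phi(a)\varphi_0$ for all $a\in B$. For a $\sigma$-continuous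 character $\omega$ on $B$, $B_\sigma$ is $\omega$-amenable if for each $\sigma$-continuous anti-representation $\Phi:B\to\mathcal L(E)$ on a Banach space, every $\sigma$-continuous linear $\theta:B\to E^*$ with $\theta(ab)=\check\Phi(a)\theta(b)+\omega(b)\theta(a)$ is of the form $\theta(a)=\omega(a)\varphi-\check\Phi(a)\varphi$ for some $\varphi\in E^*$. *)

theory Defs
  imports "HOL-Analysis.Analysis" "HOL-Algebra.Module"
begin

section \<open>Complex vector spaces, normed spaces, bounded operators\<close>

text \<open>
  Amenability and property (CB) quantify over all Banach spaces, so Banach spaces have to be
  values rather than types. They are modules over the field of complex numbers, with a norm;
  the ring fields \<open>mult\<close> and \<open>one\<close> play no role for them, just as in \<^locale>\<open>module\<close>.
\<close>

definition complex_field :: "complex ring" where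
  "complex_field = \<lparr>carrier = UNIV, mult = (*), one = 1, zero = 0, add = (+)\<rparr>"

definition linear_map ::
  "(complex, 'v, 'm) module_scheme \<Rightarrow> (complex, 'w, 'n) module_scheme \<Rightarrow> ('v \<Rightarrow> 'w) \<Rightarrow> bool" where
  "linear_map V W f \<longleftrightarrow>
     f \<in> carrier V \<rightarrow> carrier W \<and>
     (\<forall>x\<in>carrier V. \<forall>y\<in>carrier V. f (x \<oplus>\<^bsub>V\<^esub> y) = f x \<oplus>\<^bsub>W\<^esub> f y) \<and>
     (\<forall>c. \<forall>x\<in>carrier V. f (c \<odot>\<^bsub>V\<^esub> x) = c \<odot>\<^bsub>W\<^esub> f x)"

record 'e normed_module = "(complex, 'e) module" +
  nrm :: "'e \<Rightarrow> real"

locale complex_normed_space = module complex_field E for E :: "'e normed_module" (structure) +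
  assumes nrm_nonneg: "x \<in> carrier E \<Longrightarrow> 0 \<le> nrm E x"
    and nrm_eq_0: "x \<in> carrier E \<Longrightarrow> nrm E x = 0 \<longleftrightarrow> x = \<zero>"
    and nrm_triangle:
      "x \<in> carrier E \<Longrightarrow> y \<in> carrier E \<Longrightarrow> nrm E (x \<oplus> y) \<le> nrm E x + nrm E y"
    and nrm_smult: "x \<in> carrier E \<Longrightarrow> nrm E (c \<odot> x) = cmod c * nrm E x"

text \<open>
  The locale \<^locale>\<open>Metric_space\<close> wants a nonnegative symmetric function on the whole type,
  whence the default value outside the carrier.
\<close>

definition norm_dist :: "'e normed_module \<Rightarrow> 'e \<Rightarrow> 'e \<Rightarrow> real" where
  "norm_dist E x y = (if x \<in> carrier E \<and> y \<in> carrier E then nrm E (x \<ominus>\<^bsub>E\<^esub> y) else 0)"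

definition norm_topology :: "'e normed_module \<Rightarrow> 'e topology" where
  "norm_topology E = Metric_space.mtopology (carrier E) (norm_dist E)"

locale nonzero_banach_space = complex_normed_space +
  assumes complete: "Metric_space.mcomplete (carrier E) (norm_dist E)"
    and nonzero: "carrier E \<noteq> {\<zero>}"

text \<open>
  The normed space of bounded operators. Operators are extensional functions, so that equality
  of operators is equality of functions.
\<close>

definition bounded_ops :: "'e normed_module \<Rightarrow> 'f normed_module \<Rightarrow> ('e \<Rightarrow> 'f) normed_module" where
  "bounded_ops E F =
     \<lparr>carrier = {T \<in> extensional (carrier E). linear_map E F T \<and>
                   (\<exists>C. \<forall>x\<in>carrier E. nrm F (T x) \<le> C * nrm E x)},
      mult = undefined, one = undefined,
      zero = (\<lambda>x\<in>carrier E. \<zero>\<^bsub>F\<^esub>),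
      add = (\<lambda>S T. \<lambda>x\<in>carrier E. S x \<oplus>\<^bsub>F\<^esub> T x),
      smult = (\<lambda>c T. \<lambda>x\<in>carrier E. c \<odot>\<^bsub>F\<^esub> T x),
      nrm = (\<lambda>T. SUP x\<in>{x \<in> carrier E. nrm E x \<le> 1}. nrm F (T x))\<rparr>"

definition complex_space :: "complex normed_module" where
  "complex_space =
     \<lparr>carrier = UNIV, mult = (*), one = 1, zero = 0, add = (+), smult = (*), nrm = cmod\<rparr>"

definition dual :: "'e normed_module \<Rightarrow> ('e \<Rightarrow> complex) normed_module" where
  "dual E = bounded_ops E complex_space"

definition adjoint :: "'e normed_module \<Rightarrow> ('e \<Rightarrow> 'e) \<Rightarrow> ('e \<Rightarrow> complex) \<Rightarrow> ('e \<Rightarrow> complex)" where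
  "adjoint E T \<phi> = compose (carrier E) \<phi> T"


section \<open>Locally convex algebras\<close>

definition convex_in :: "(complex, 'v, 'm) module_scheme \<Rightarrow> 'v set \<Rightarrow> bool" where
  "convex_in V W \<longleftrightarrow> (\<forall>x\<in>W. \<forall>y\<in>W. \<forall>t::real. 0 \<le> t \<and> t \<le> 1 \<longrightarrow>
     (complex_of_real (1 - t) \<odot>\<^bsub>V\<^esub> x) \<oplus>\<^bsub>V\<^esub> (complex_of_real t \<odot>\<^bsub>V\<^esub> y) \<in> W)"

definition locally_convex_topology ::
  "(complex, 'v, 'm) module_scheme \<Rightarrow> 'v topology \<Rightarrow> bool" where
  "locally_convex_topology V \<tau> \<longleftrightarrow>
     topspace \<tau> = carrier V \<and>
     continuous_map (prod_topology \<tau> \<tau>) \<tau> (\<lambda>(x, y). x \<oplus>\<^bsub>V\<^esub> y) \<and>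
     continuous_map (prod_topology euclidean \<tau>) \<tau> (\<lambda>(c, x). c \<odot>\<^bsub>V\<^esub> x) \<and>
     (\<forall>U. openin \<tau> U \<and> \<zero>\<^bsub>V\<^esub> \<in> U \<longrightarrow>
        (\<exists>W. openin \<tau> W \<and> \<zero>\<^bsub>V\<^esub> \<in> W \<and> W \<subseteq> U \<and> convex_in V W))"

text \<open>
  The finest locally convex topology on \<open>V\<close> for which the inclusions of the given
  topologized subspaces are continuous: the supremum of all locally convex topologies with
  this property (which has the property itself).
\<close>

definition lc_inductive_limit ::
  "(complex, 'v, 'm) module_scheme \<Rightarrow> 'v topology set \<Rightarrow> 'v topology" where
  "lc_inductive_limit V \<X> =
     topology_generated_by (\<Union>{{U. openin \<tau> U} | \<tau>.
       locally_convex_topology V \<tau> \<and> (\<forall>X\<in>\<X>. continuous_map X \<tau> (\<lambda>x. x))})"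

text \<open>The field \<open>one\<close> is ignored: algebras need not be unital.\<close>

record 'b lc_algebra = "(complex, 'b) module" +
  lctop :: "'b topology"

text \<open>
  A net is a family indexed by a directed preordered set \<open>(I, D)\<close>; its convergence is
  convergence along the filter generated by the tails of \<open>I\<close>.
\<close>

definition directed_set :: "'i set \<Rightarrow> ('i \<times> 'i) set \<Rightarrow> bool" where
  "directed_set I D \<longleftrightarrow> I \<noteq> {} \<and> (\<forall>i\<in>I. (i, i) \<in> D) \<and>
     (\<forall>i\<in>I. \<forall>j\<in>I. \<forall>k\<in>I. (i, j) \<in> D \<longrightarrow> (j, k) \<in> D \<longrightarrow> (i, k) \<in> D) \<and>
     (\<forall>i\<in>I. \<forall>j\<in>I. \<exists>k\<in>I. (i, k) \<in> D \<and> (j, k) \<in> D)"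

definition tails :: "'i set \<Rightarrow> ('i \<times> 'i) set \<Rightarrow> 'i filter" where
  "tails I D = (INF i\<in>I. principal {j \<in> I. (i, j) \<in> D})"

locale locally_convex_algebra = module complex_field B for B :: "'b lc_algebra" (structure) +
  assumes mult_closed: "a \<in> carrier B \<Longrightarrow> b \<in> carrier B \<Longrightarrow> a \<otimes> b \<in> carrier B"
    and mult_assoc: "a \<in> carrier B \<Longrightarrow> b \<in> carrier B \<Longrightarrow> c \<in> carrier B \<Longrightarrow>
      (a \<otimes> b) \<otimes> c = a \<otimes> (b \<otimes> c)"
    and mult_linear_right: "a \<in> carrier B \<Longrightarrow> linear_map B B (\<lambda>b. a \<otimes> b)"
    and mult_linear_left: "b \<in> carrier B \<Longrightarrow> linear_map B B (\<lambda>a. a \<otimes> b)"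
    and locally_convex: "locally_convex_topology B (lctop B)"
    and hausdorff: "Hausdorff_space (lctop B)"
    and mult_continuous_right:
      "a \<in> carrier B \<Longrightarrow> continuous_map (lctop B) (lctop B) (\<lambda>b. a \<otimes> b)"
    and mult_continuous_left:
      "b \<in> carrier B \<Longrightarrow> continuous_map (lctop B) (lctop B) (\<lambda>a. a \<otimes> b)"
begin

definition bounded_subset :: "'b set \<Rightarrow> bool" where
  "bounded_subset S \<longleftrightarrow> S \<subseteq> carrier B \<and>
     (\<forall>U V. openin (lctop B) U \<and> \<zero> \<in> U \<and> U \<subseteq> V \<and> V \<subseteq> carrier B \<longrightarrow>
        (\<exists>\<kappa>::real. \<kappa> > 0 \<and> S \<subseteq> (\<lambda>v. complex_of_real \<kappa> \<odot> v) ` V))"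

definition approximate_identity :: "'i set \<Rightarrow> ('i \<times> 'i) set \<Rightarrow> ('i \<Rightarrow> 'b) \<Rightarrow> bool" where
  "approximate_identity I D h \<longleftrightarrow> directed_set I D \<and> h \<in> I \<rightarrow> carrier B \<and>
     (\<forall>b\<in>carrier B. limitin (lctop B) (\<lambda>i. h i \<otimes> b) b (tails I D) \<and>
                    limitin (lctop B) (\<lambda>i. b \<otimes> h i) b (tails I D))"

definition has_bounded_approximate_identity :: "'i itself \<Rightarrow> bool" where
  "has_bounded_approximate_identity _ \<longleftrightarrow>
     (\<exists>(I::'i set) D h. approximate_identity I D h \<and> bounded_subset (h ` I))"

definition continuous_linear :: "'e normed_module \<Rightarrow> ('b \<Rightarrow> 'e) \<Rightarrow> bool" where
  "continuous_linear E f \<longleftrightarrow> linear_map B E f \<and> continuous_map (lctop B) (norm_topology E) f"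

definition continuous_anti_representation :: "'e normed_module \<Rightarrow> ('b \<Rightarrow> 'e \<Rightarrow> 'e) \<Rightarrow> bool" where
  "continuous_anti_representation E \<Phi> \<longleftrightarrow> continuous_linear (bounded_ops E E) \<Phi> \<and>
     (\<forall>a\<in>carrier B. \<forall>b\<in>carrier B. \<Phi> (a \<otimes> b) = compose (carrier E) (\<Phi> b) (\<Phi> a))"

text \<open>
  The Banach spaces considered are those whose carrier is a subset of a given type \<open>'e\<close>.
\<close>

definition property_CB :: "'e itself \<Rightarrow> bool" where
  "property_CB _ \<longleftrightarrow>
     (\<forall>(E::'e normed_module) \<Phi> \<Xi>.
        nonzero_banach_space E \<longrightarrow>
        continuous_anti_representation E \<Phi> \<longrightarrow>
        continuous_linear (dual E) \<Xi> \<longrightarrow>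
        (\<forall>a\<in>carrier B. \<forall>b\<in>carrier B. \<Xi> (a \<otimes> b) = adjoint E (\<Phi> a) (\<Xi> b)) \<longrightarrow>
        (\<exists>\<phi>\<in>carrier (dual E). \<forall>a\<in>carrier B. \<Xi> a = adjoint E (\<Phi> a) \<phi>))"

end

locale continuous_character = locally_convex_algebra +
  fixes \<omega> :: "'a \<Rightarrow> complex"
  assumes character_continuous_linear: "continuous_linear complex_space \<omega>"
    and character_mult: "a \<in> carrier B \<Longrightarrow> b \<in> carrier B \<Longrightarrow> \<omega> (a \<otimes> b) = \<omega> a * \<omega> b"
    and character_nonzero: "\<exists>a\<in>carrier B. \<omega> a \<noteq> 0"
begin

definition amenable :: "'e itself \<Rightarrow> bool" where
  "amenable _ \<longleftrightarrow>
     (\<forall>(E::'e normed_module) \<Phi> \<theta>.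
        nonzero_banach_space E \<longrightarrow>
        continuous_anti_representation E \<Phi> \<longrightarrow>
        continuous_linear (dual E) \<theta> \<longrightarrow>
        (\<forall>a\<in>carrier B. \<forall>b\<in>carrier B.
           \<theta> (a \<otimes> b) = adjoint E (\<Phi> a) (\<theta> b) \<oplus>\<^bsub>dual E\<^esub> (\<omega> b \<odot>\<^bsub>dual E\<^esub> \<theta> a)) \<longrightarrow>
        (\<exists>\<phi>\<in>carrier (dual E). \<forall>a\<in>carrier B.
           \<theta> a = (\<omega> a \<odot>\<^bsub>dual E\<^esub> \<phi>) \<ominus>\<^bsub>dual E\<^esub> adjoint E (\<Phi> a) \<phi>))"

end


section \<open>Compactly supported functions on a topological group\<close>

text \<open>
  The group is a type of class \<^class>\<open>topological_group_add\<close>: it is written additively but is not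
  assumed to be commutative.
\<close>

definition radon_measure :: "'a::topological_space measure \<Rightarrow> bool" where
  "radon_measure \<mu> \<longleftrightarrow>
     sets \<mu> = sets borel \<and>
     (\<forall>K. compact K \<longrightarrow> emeasure \<mu> K < \<infinity>) \<and>
     (\<forall>A\<in>sets borel. emeasure \<mu> A = (INF U\<in>{U. open U \<and> A \<subseteq> U}. emeasure \<mu> U)) \<and>
     (\<forall>U. open U \<longrightarrow> emeasure \<mu> U = (SUP K\<in>{K. compact K \<and> K \<subseteq> U}. emeasure \<mu> K))"

definition left_haar_measure :: "'a::{topological_group_add, t2_space} measure \<Rightarrow> bool" where
  "left_haar_measure \<mu> \<longleftrightarrow>
     radon_measure \<mu> \<and> emeasure \<mu> UNIV \<noteq> 0 \<and>
     (\<forall>g. \<forall>A\<in>sets borel. emeasure \<mu> ((\<lambda>t. g + t) ` A) = emeasure \<mu> A)"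

definition supp :: "('a::topological_space \<Rightarrow> complex) \<Rightarrow> 'a set" where
  "supp f = closure {t. f t \<noteq> 0}"

definition Cc :: "('a::topological_space \<Rightarrow> complex) set" where
  "Cc = {f. continuous_on UNIV f \<and> compact (supp f)}"

definition CK :: "'a::topological_space set \<Rightarrow> ('a \<Rightarrow> complex) set" where
  "CK K = {f \<in> Cc. supp f \<subseteq> K}"

definition haar_integral :: "'a measure \<Rightarrow> ('a \<Rightarrow> complex) \<Rightarrow> complex" where
  "haar_integral \<mu> f = (LINT t|\<mu>. f t)"

definition Cc0 :: "'a::topological_space measure \<Rightarrow> ('a \<Rightarrow> complex) set" where
  "Cc0 \<mu> = {f \<in> Cc. haar_integral \<mu> f = 0}"

definition convolution ::
  "'a::topological_group_add measure \<Rightarrow> ('a \<Rightarrow> complex) \<Rightarrow> ('a \<Rightarrow> complex) \<Rightarrow> 'a \<Rightarrow> complex" where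
  "convolution \<mu> f g t = (LINT s|\<mu>. f s * g (- s + t))"

definition L1_norm :: "'a measure \<Rightarrow> ('a \<Rightarrow> complex) \<Rightarrow> real" where
  "L1_norm \<mu> f = (LINT t|\<mu>. cmod (f t))"

definition L1_space ::
  "'a::topological_group_add measure \<Rightarrow> ('a \<Rightarrow> complex) set \<Rightarrow> ('a \<Rightarrow> complex) normed_module" where
  "L1_space \<mu> S =
     \<lparr>carrier = S, mult = convolution \<mu>, one = undefined, zero = (\<lambda>t. 0),
      add = (\<lambda>f g t. f t + g t), smult = (\<lambda>c f t. c * f t), nrm = L1_norm \<mu>\<rparr>"

definition convolution_algebra ::
  "'a::topological_group_add measure \<Rightarrow> ('a \<Rightarrow> complex) set \<Rightarrow> ('a \<Rightarrow> complex) topology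
     \<Rightarrow> ('a \<Rightarrow> complex) lc_algebra" where
  "convolution_algebra \<mu> S \<tau> =
     \<lparr>carrier = S, mult = convolution \<mu>, one = undefined, zero = (\<lambda>t. 0),
      add = (\<lambda>f g t. f t + g t), smult = (\<lambda>c f t. c * f t), lctop = \<tau>\<rparr>"

definition Cc_topology ::
  "'a::topological_group_add measure \<Rightarrow> ('a \<Rightarrow> complex) topology" where
  "Cc_topology \<mu> = lc_inductive_limit (L1_space \<mu> Cc)
     {norm_topology (L1_space \<mu> (CK K)) | K. compact K \<and> K \<noteq> {}}"

definition Cc_algebra :: "'a::topological_group_add measure \<Rightarrow> ('a \<Rightarrow> complex) lc_algebra" where
  "Cc_algebra \<mu> = convolution_algebra \<mu> Cc (Cc_topology \<mu>)"

definition Cc0_algebra :: "'a::topological_group_add measure \<Rightarrow> ('a \<Rightarrow> complex) lc_algebra" where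
  "Cc0_algebra \<mu> =
     convolution_algebra \<mu> (Cc0 \<mu>) (subtopology (Cc_topology \<mu>) (Cc0 \<mu>))"

definition Cc0_L1_algebra :: "'a::topological_group_add measure \<Rightarrow> ('a \<Rightarrow> complex) lc_algebra" where
  "Cc0_L1_algebra \<mu> =
     convolution_algebra \<mu> (Cc0 \<mu>) (norm_topology (L1_space \<mu> (Cc0 \<mu>)))"

definition has_bounded_L1_approximate_identity_in_compact ::
  "'a::topological_group_add measure \<Rightarrow> 'i itself \<Rightarrow> bool" where
  "has_bounded_L1_approximate_identity_in_compact \<mu> _ \<longleftrightarrow>
     (\<exists>K. compact K \<and>
       (\<exists>(I::'i set) D h.
          locally_convex_algebra.approximate_identity (Cc0_L1_algebra \<mu>) I D h \<and>
          (\<exists>M. \<forall>i\<in>I. L1_norm \<mu> (h i) \<le> M) \<and>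
          (\<forall>i\<in>I. supp (h i) \<subseteq> K)))"

text \<open>
  HOL cannot quantify over types inside a formula, so the index sets of nets and the carriers
  of Banach spaces are subsets of one of the following types. The parameters \<open>'i\<close> and \<open>'u\<close> are
  arbitrary, so that every directed set and every Banach space is covered. The other summands
  make the types large enough for the notions not to depend on the parameters:

  \<^item> A net in a set of functions on \<open>'a\<close> is, as far as convergence and range are concerned,
    the same as the net of pairs \<open>(f, A)\<close> with \<open>f \<in> A\<close> and \<open>A\<close> in the filter of eventual sets
    of the net.
  \<^item> In (CB) and in amenability one may replace \<open>E\<close> by its closed invariant subspaces of
    cardinality at most that of \<open>'a \<Rightarrow> complex\<close>. The functionals obtained on these can be chosen
    with a common norm bound, since otherwise there would be a countable family of such subspaces
    without a bound, contradicting the property for the closed span of the family;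
    weak-* compactness then gives a functional on \<open>E\<close>.
\<close>

type_synonym ('a, 'i) net_index =
  "'i + (('a \<Rightarrow> complex) \<times> ('a \<Rightarrow> complex) set)"

type_synonym ('a, 'u) banach_carrier = "'u + ('a \<Rightarrow> complex)"

end

theory Submission
  imports Defs
begin

text \<open>
  On a compact group, functions of integral one supported in small neighbourhoods of the unit,
  minus the constant \<open>1 / \<mu>(G)\<close>, form the approximate identity of (2). It is one for \<open>\<TT>\<close>
  because products with a fixed function stay in a single \<open>C\<^sub>K(G)\<close>, on which \<open>\<TT>\<close> is coarser than
  the \<open>L\<^sup>1\<close> topology. If \<open>h\<^sub>i\<close> is a bounded approximate identity, a weak-* cluster point of
  \<open>\<Xi>(h\<^sub>i)\<close> is the functional that (CB) asks for. A derivation \<open>\<theta>\<close> restricts to a map on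
  \<open>C\<^sub>c\<^sup>0(G) = ker \<omega>\<close> to which (CB) applies; if \<open>\<phi>\<^sub>0\<close> represents this restriction and \<open>\<omega>(e) = 1\<close>,
  then \<open>\<theta>\<close> is implemented by \<open>\<theta>(e) - \<Phi>(e)\<^sup>* \<phi>\<^sub>0\<close>.

  For the converse, exhaust a \<open>\<sigma>\<close>-compact group by relatively compact open sets \<open>U n\<close> with
  \<open>U n + U n \<subseteq> U (n + 1)\<close>, let \<open>w\<close> be one plus the least \<open>n\<close> with \<open>t \<in> U n\<close>, and let \<open>E\<close> be the
  Banach space of continuous \<open>f\<close> with \<open>f 0 = 0\<close> and \<open>\<bar>f\<bar> \<le> C w\<close>. On it,
  \<open>(\<Phi>(a) f)(t) = \<integral> a(s) (f(s + t) - f(s)) ds\<close> is an anti-representation and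
  \<open>\<theta>(a) f = \<integral> a(s) f(s) ds\<close> a derivation, which is inner only if the group is compact.
\<close>


section \<open>Complex modules and normed spaces\<close>

text \<open>The space \<open>E\<close> of the converse is the space of continuous functions of
  growth \<open>w\<close> modulo constants, realised by \<open>f 0 = 0\<close>. Let T(a)f(t) be the
  integral of a(s) f(s + t). T(a) multiplies constants by \<omega>(a), \<Phi>(a) is the induced
  action on the quotient, and \<theta>(a)f = T(a)f(0) is the cocycle of this extension. A functional
  \<phi> that implements \<theta> yields m(f) = f(0) + \<phi>(f - f(0)) with m(1) = 1 and m(T(a)f) =
  \<omega>(a) m(f): an invariant mean. Such means exist on the bounded functions of every amenable
  group, so the weight has to be unbounded. It makes functions that vanish on \<open>U n\<close> and
  are bounded by one small, which ties m to a compact set; invariance forbids this on a noncompact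
  group. The rule for sums of elements of \<open>U n\<close> keeps w(s + t) / w(t) bounded for s in
  a compact set. The bound depends on that set, so \<Phi> and \<theta> are shown to be continuous on
  each \<open>CK K\<close> separately, which is exactly what \<TT> asks for.\<close>

lemma complex_field_simps [simp]:
  "carrier complex_field = UNIV" "add complex_field = (+)" "mult complex_field = (*)"
  "zero complex_field = 0" "one complex_field = 1"
  by (simp_all add: complex_field_def)

lemma cring_complex_field: "cring complex_field"
proof (rule cringI)
  show "abelian_group complex_field"
    by (rule abelian_groupI) (auto intro: exI[of _ "- x" for x])
  show "comm_monoid complex_field"
    by (rule comm_monoidI) auto
qed (auto simp: distrib_right)

interpretation complex_field: cring complex_field
  by (rule cring_complex_field)

lemma complex_field_minus [simp]: "a_inv complex_field c = - c"
  by (rule complex_field.minus_equality) auto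

text \<open>Scalar multiplication by -1 supplies the additive inverses: \<open>ldistr\<close>,
  \<open>one\<close> and \<open>null\<close> together give (-1) x + x = 0. For a concrete space only
  pointwise identities remain to be checked.\<close>

lemma module_complex_fieldI:
  fixes V :: "(complex, 'v, 'm) module_scheme" (structure)
  assumes "\<And>x y. x \<in> carrier V \<Longrightarrow> y \<in> carrier V \<Longrightarrow> x \<oplus> y \<in> carrier V"
    and "\<zero> \<in> carrier V"
    and "\<And>x y z. x \<in> carrier V \<Longrightarrow> y \<in> carrier V \<Longrightarrow> z \<in> carrier V \<Longrightarrow> (x \<oplus> y) \<oplus> z = x \<oplus> (y \<oplus> z)"
    and "\<And>x y. x \<in> carrier V \<Longrightarrow> y \<in> carrier V \<Longrightarrow> x \<oplus> y = y \<oplus> x"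
    and "\<And>x. x \<in> carrier V \<Longrightarrow> \<zero> \<oplus> x = x"
    and smult: "\<And>c x. x \<in> carrier V \<Longrightarrow> c \<odot>\<^bsub>V\<^esub> x \<in> carrier V"
    and ldistr: "\<And>c d x. x \<in> carrier V \<Longrightarrow> (c + d) \<odot>\<^bsub>V\<^esub> x = c \<odot>\<^bsub>V\<^esub> x \<oplus> d \<odot>\<^bsub>V\<^esub> x"
    and "\<And>c x y. x \<in> carrier V \<Longrightarrow> y \<in> carrier V \<Longrightarrow> c \<odot>\<^bsub>V\<^esub> (x \<oplus> y) = c \<odot>\<^bsub>V\<^esub> x \<oplus> c \<odot>\<^bsub>V\<^esub> y"
    and "\<And>c d x. x \<in> carrier V \<Longrightarrow> (c * d) \<odot>\<^bsub>V\<^esub> x = c \<odot>\<^bsub>V\<^esub> (d \<odot>\<^bsub>V\<^esub> x)"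
    and one: "\<And>x. x \<in> carrier V \<Longrightarrow> 1 \<odot>\<^bsub>V\<^esub> x = x"
    and null: "\<And>x. x \<in> carrier V \<Longrightarrow> 0 \<odot>\<^bsub>V\<^esub> x = \<zero>"
  shows "module complex_field V"
proof (rule moduleI[OF cring_complex_field])
  show "abelian_group V"
  proof (rule abelian_groupI)
    fix x assume x: "x \<in> carrier V"
    then have "(-1) \<odot>\<^bsub>V\<^esub> x \<oplus> x = \<zero>"
      using ldistr[of x "-1" 1] one[OF x] null[OF x] by simp
    then show "\<exists>y\<in>carrier V. y \<oplus> x = \<zero>" using smult[OF x] by blast
  qed (use assms in auto)
qed (use assms in auto)

text \<open>
  The map \<open>j\<close> allows the elements of \<open>V\<close> to be functions in disguise, such as injections of
  functions into a sum type.
\<close>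

lemma function_module:
  fixes V :: "(complex, 'v, 'm) module_scheme" and j :: "('a \<Rightarrow> complex) \<Rightarrow> 'v"
  assumes carrier: "carrier V = j ` S"
    and S: "(\<lambda>t. 0) \<in> S" "\<And>f g. f \<in> S \<Longrightarrow> g \<in> S \<Longrightarrow> (\<lambda>t. f t + g t) \<in> S"
      "\<And>c f. f \<in> S \<Longrightarrow> (\<lambda>t. c * f t) \<in> S"
    and zero: "\<zero>\<^bsub>V\<^esub> = j (\<lambda>t. 0)"
    and add: "\<And>f g. f \<in> S \<Longrightarrow> g \<in> S \<Longrightarrow> j f \<oplus>\<^bsub>V\<^esub> j g = j (\<lambda>t. f t + g t)"
    and smult: "\<And>c f. f \<in> S \<Longrightarrow> c \<odot>\<^bsub>V\<^esub> j f = j (\<lambda>t. c * f t)"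
  shows "module complex_field V"
  by (rule module_complex_fieldI) (auto simp: carrier zero add smult S algebra_simps)

context module
begin

lemma minus_eq_smult:
  assumes "x \<in> carrier M"
  shows "\<ominus>\<^bsub>M\<^esub> x = (\<ominus> \<one>) \<odot>\<^bsub>M\<^esub> x"
  using assms by (simp add: smult_l_minus)

end

lemma linear_mapD:
  assumes "linear_map V W f"
  shows "x \<in> carrier V \<Longrightarrow> f x \<in> carrier W"
    and "x \<in> carrier V \<Longrightarrow> y \<in> carrier V \<Longrightarrow> f (x \<oplus>\<^bsub>V\<^esub> y) = f x \<oplus>\<^bsub>W\<^esub> f y"
    and "x \<in> carrier V \<Longrightarrow> f (c \<odot>\<^bsub>V\<^esub> x) = c \<odot>\<^bsub>W\<^esub> f x"
  using assms by (auto simp: linear_map_def)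

lemma linear_mapI:
  assumes "\<And>x. x \<in> carrier V \<Longrightarrow> f x \<in> carrier W"
    and "\<And>x y. x \<in> carrier V \<Longrightarrow> y \<in> carrier V \<Longrightarrow> f (x \<oplus>\<^bsub>V\<^esub> y) = f x \<oplus>\<^bsub>W\<^esub> f y"
    and "\<And>c x. x \<in> carrier V \<Longrightarrow> f (c \<odot>\<^bsub>V\<^esub> x) = c \<odot>\<^bsub>W\<^esub> f x"
  shows "linear_map V W f"
  using assms by (auto simp: linear_map_def)

lemma linear_map_zero:
  assumes "module complex_field V" "module complex_field W" "linear_map V W f"
  shows "f \<zero>\<^bsub>V\<^esub> = \<zero>\<^bsub>W\<^esub>"
proof -
  interpret V: module complex_field V by fact
  interpret W: module complex_field W by fact
  have "f (0 \<odot>\<^bsub>V\<^esub> \<zero>\<^bsub>V\<^esub>) = 0 \<odot>\<^bsub>W\<^esub> f \<zero>\<^bsub>V\<^esub>"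
    by (rule linear_mapD(3)[OF assms(3) V.zero_closed])
  then show ?thesis
    using V.smult_l_null[of "\<zero>\<^bsub>V\<^esub>"] W.smult_l_null[of "f \<zero>\<^bsub>V\<^esub>"] linear_mapD(1)[OF assms(3), of "\<zero>\<^bsub>V\<^esub>"]
    by simp
qed

lemma linear_map_diff:
  assumes "module complex_field V" "module complex_field W" "linear_map V W f"
    "x \<in> carrier V" "y \<in> carrier V"
  shows "f (x \<ominus>\<^bsub>V\<^esub> y) = f x \<ominus>\<^bsub>W\<^esub> f y"
proof -
  interpret V: module complex_field V by fact
  interpret W: module complex_field W by fact
  have "x \<ominus>\<^bsub>V\<^esub> y = x \<oplus>\<^bsub>V\<^esub> (-1) \<odot>\<^bsub>V\<^esub> y"
    using V.minus_eq_smult[of y] assms by (simp add: a_minus_def)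
  moreover have "f x \<ominus>\<^bsub>W\<^esub> f y = f x \<oplus>\<^bsub>W\<^esub> (-1) \<odot>\<^bsub>W\<^esub> f y"
    using W.minus_eq_smult[of "f y"] assms linear_mapD(1)[OF assms(3)] by (simp add: a_minus_def)
  moreover have "(-1) \<odot>\<^bsub>V\<^esub> y \<in> carrier V"
    using assms V.smult_closed by simp
  ultimately show ?thesis
    using assms linear_mapD(2,3)[OF assms(3)] by simp
qed

section \<open>The norm topology as a locally convex topology\<close>

context complex_normed_space
begin

lemma nrm_zero [simp]: "nrm E \<zero> = 0"
  using nrm_eq_0[of \<zero>] by simp

lemma smult_mem [simp, intro]: "x \<in> carrier E \<Longrightarrow> c \<odot> x \<in> carrier E"
  using smult_closed by simp

lemma smult_commute: "x \<in> carrier E \<Longrightarrow> c \<odot> (d \<odot> x) = d \<odot> (c \<odot> x)"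
  using smult_assoc1[of c d x] smult_assoc1[of d c x] by (simp add: mult.commute)

lemma smult_inverse: "x \<in> carrier E \<Longrightarrow> c \<noteq> 0 \<Longrightarrow> inverse c \<odot> (c \<odot> x) = x"
  using smult_assoc1[of "inverse c" c x] smult_one[of x] by simp

lemma diff_eq_smult: "x \<in> carrier E \<Longrightarrow> y \<in> carrier E \<Longrightarrow> x \<ominus> y = x \<oplus> (-1) \<odot> y"
  using minus_eq_smult[of y] by (simp add: a_minus_def)

lemma nrm_minus [simp]: "x \<in> carrier E \<Longrightarrow> nrm E (\<ominus> x) = nrm E x"
  using minus_eq_smult[of x] nrm_smult[of x "-1"] by simp

lemma nrm_diff_commute: "x \<in> carrier E \<Longrightarrow> y \<in> carrier E \<Longrightarrow> nrm E (x \<ominus> y) = nrm E (y \<ominus> x)"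
  using nrm_minus[of "x \<ominus> y"] by (simp add: a_minus_def minus_add a_comm)

lemma diff_add_diff:
  "x \<in> carrier E \<Longrightarrow> y \<in> carrier E \<Longrightarrow> z \<in> carrier E \<Longrightarrow> (x \<ominus> y) \<oplus> (y \<ominus> z) = x \<ominus> z"
  by (simp add: a_minus_def a_assoc[symmetric]) (simp add: a_assoc l_neg)

lemma nrm_diff_triangle:
  assumes "x \<in> carrier E" "y \<in> carrier E" "z \<in> carrier E"
  shows "nrm E (x \<ominus> z) \<le> nrm E (x \<ominus> y) + nrm E (y \<ominus> z)"
  using nrm_triangle[of "x \<ominus> y" "y \<ominus> z"] diff_add_diff[of x y z] assms by simp

lemma nrm_diff_eq_0:
  assumes "x \<in> carrier E" "y \<in> carrier E"
  shows "nrm E (x \<ominus> y) = 0 \<longleftrightarrow> x = y"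
proof -
  have "(x \<ominus> y) \<oplus> y = x"
    using assms by (simp add: a_minus_def a_assoc l_neg)
  then show ?thesis
    using assms nrm_eq_0[of "x \<ominus> y"] by (auto simp: a_minus_def r_neg)
qed

lemma nrm_diff_self [simp]: "x \<in> carrier E \<Longrightarrow> nrm E (x \<ominus> x) = 0"
  by (simp add: nrm_diff_eq_0)

lemma diff_zero [simp]: "x \<in> carrier E \<Longrightarrow> x \<ominus> \<zero> = x"
  by (simp add: a_minus_def)

lemma metric: "Metric_space (carrier E) (norm_dist E)"
proof
  show "0 \<le> norm_dist E x y" for x y
    by (auto simp: norm_dist_def intro: nrm_nonneg)
  show "norm_dist E x y = norm_dist E y x" for x y
    by (auto simp: norm_dist_def nrm_diff_commute)
  show "x \<in> carrier E \<Longrightarrow> y \<in> carrier E \<Longrightarrow> (norm_dist E x y = 0) = (x = y)" for x y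
    by (auto simp: norm_dist_def nrm_diff_eq_0)
  show "x \<in> carrier E \<Longrightarrow> y \<in> carrier E \<Longrightarrow> z \<in> carrier E \<Longrightarrow>
      norm_dist E x z \<le> norm_dist E x y + norm_dist E y z" for x y z
    by (auto simp: norm_dist_def nrm_diff_triangle)
qed

lemma topspace_norm_topology [simp]: "topspace (norm_topology E) = carrier E"
  unfolding norm_topology_def by (rule Metric_space.topspace_mtopology[OF metric])

lemma Hausdorff_norm_topology: "Hausdorff_space (norm_topology E)"
  unfolding norm_topology_def by (rule Metric_space.Hausdorff_space_mtopology[OF metric])

lemma openin_norm_topology:
  "openin (norm_topology E) U \<longleftrightarrow> U \<subseteq> carrier E \<and>
     (\<forall>x\<in>U. \<exists>r>0. \<forall>y\<in>carrier E. nrm E (y \<ominus> x) < r \<longrightarrow> y \<in> U)"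
proof -
  have ball: "Metric_space.mball (carrier E) (norm_dist E) x r \<subseteq> U \<longleftrightarrow>
      (\<forall>y\<in>carrier E. nrm E (y \<ominus> x) < r \<longrightarrow> y \<in> U)" if "x \<in> carrier E" for x r
    using that nrm_diff_commute[OF _ that]
    by (auto simp: Metric_space.mball_def[OF metric] norm_dist_def subset_eq)
  show ?thesis
    unfolding norm_topology_def Metric_space.openin_mtopology[OF metric]
  proof (intro conj_cong refl iffI allI impI ballI)
    fix x assume U: "U \<subseteq> carrier E" and x: "x \<in> U"
    have "x \<in> carrier E" using U x by blast
    note ball = ball[OF this]
    show "\<exists>r>0. \<forall>y\<in>carrier E. nrm E (y \<ominus> x) < r \<longrightarrow> y \<in> U"
      if "\<forall>x. x \<in> U \<longrightarrow> (\<exists>r>0. Metric_space.mball (carrier E) (norm_dist E) x r \<subseteq> U)"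
      using that[rule_format, OF x] unfolding ball .
    show "\<exists>r>0. Metric_space.mball (carrier E) (norm_dist E) x r \<subseteq> U"
      if "\<forall>x\<in>U. \<exists>r>0. \<forall>y\<in>carrier E. nrm E (y \<ominus> x) < r \<longrightarrow> y \<in> U"
      using that[rule_format, OF x] unfolding ball by simp
  qed
qed

lemma limitin_norm_topology:
  "limitin (norm_topology E) f l F \<longleftrightarrow>
     l \<in> carrier E \<and> (\<forall>e>0. eventually (\<lambda>x. f x \<in> carrier E \<and> nrm E (f x \<ominus> l) < e) F)"
  unfolding norm_topology_def Metric_space.limitin_metric[OF metric]
  by (auto simp: norm_dist_def elim!: eventually_mono)

lemma openin_ball:
  assumes "x \<in> carrier E"
  shows "openin (norm_topology E) {y \<in> carrier E. nrm E (y \<ominus> x) < r}"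
  unfolding openin_norm_topology
proof (intro conjI ballI)
  fix y assume "y \<in> {y \<in> carrier E. nrm E (y \<ominus> x) < r}"
  then have y: "y \<in> carrier E" "nrm E (y \<ominus> x) < r" by auto
  have "nrm E (z \<ominus> x) < r" if "z \<in> carrier E" "nrm E (z \<ominus> y) < r - nrm E (y \<ominus> x)" for z
    using nrm_diff_triangle[of z y x] that y assms by simp
  then show "\<exists>s>0. \<forall>z\<in>carrier E. nrm E (z \<ominus> y) < s \<longrightarrow> z \<in> {y \<in> carrier E. nrm E (y \<ominus> x) < r}"
    using y by (intro exI[of _ "r - nrm E (y \<ominus> x)"]) auto
qed auto

lemma openin_zero_ball: "openin (norm_topology E) {y \<in> carrier E. nrm E y < r}"
proof -
  have "{y \<in> carrier E. nrm E y < r} = {y \<in> carrier E. nrm E (y \<ominus> \<zero>) < r}" by auto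
  then show ?thesis using openin_ball[of \<zero> r] by simp
qed

lemma locally_convex_norm_topology: "locally_convex_topology E (norm_topology E)"
  unfolding locally_convex_topology_def
proof (intro conjI allI impI)
  show "topspace (norm_topology E) = carrier E" by simp
next
  show "continuous_map (prod_topology (norm_topology E) (norm_topology E)) (norm_topology E)
          (\<lambda>(x, y). x \<oplus> y)"
    unfolding continuous_map_def
  proof (intro conjI allI impI)
    fix U assume U: "openin (norm_topology E) U"
    show "openin (prod_topology (norm_topology E) (norm_topology E))
        {p \<in> topspace (prod_topology (norm_topology E) (norm_topology E)).
          (case p of (x, y) \<Rightarrow> x \<oplus> y) \<in> U}"
      unfolding openin_prod_topology_alt
    proof clarsimp
      fix x y assume x: "x \<in> carrier E" and y: "y \<in> carrier E" and xy: "x \<oplus> y \<in> U"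
      obtain r where r: "r > 0" "\<And>z. z \<in> carrier E \<Longrightarrow> nrm E (z \<ominus> (x \<oplus> y)) < r \<Longrightarrow> z \<in> U"
        using U xy unfolding openin_norm_topology by blast
      have eq: "(x' \<oplus> y') \<ominus> (x \<oplus> y) = (x' \<ominus> x) \<oplus> (y' \<ominus> y)"
        if "x' \<in> carrier E" "y' \<in> carrier E" for x' y'
        using x y that by (simp add: a_minus_def minus_add a_ac)
      have "x' \<oplus> y' \<in> U" if "x' \<in> carrier E" "nrm E (x' \<ominus> x) < r/2"
        "y' \<in> carrier E" "nrm E (y' \<ominus> y) < r/2" for x' y'
        using r(2)[of "x' \<oplus> y'"] nrm_triangle[of "x' \<ominus> x" "y' \<ominus> y"] eq[of x' y'] that x y by simp
      then show "\<exists>V. openin (norm_topology E) V \<and> (\<exists>W. openin (norm_topology E) W \<and> x \<in> V \<and> y \<in> W \<and>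
          V \<times> W \<subseteq> {p. p \<in> carrier E \<times> carrier E \<and> (case p of (x, y) \<Rightarrow> x \<oplus> y) \<in> U})"
        using x y r(1) openin_ball[OF x, of "r/2"] openin_ball[OF y, of "r/2"]
        by (intro exI[of _ "{z \<in> carrier E. nrm E (z \<ominus> x) < r/2}"] conjI
          exI[of _ "{z \<in> carrier E. nrm E (z \<ominus> y) < r/2}"]) (auto simp: nrm_diff_eq_0)
    qed
  qed (auto simp: Pi_iff)
next
  show "continuous_map (prod_topology euclidean (norm_topology E)) (norm_topology E)
          (\<lambda>(c, x). c \<odot> x)"
    unfolding continuous_map_def
  proof (intro conjI allI impI)
    fix U assume U: "openin (norm_topology E) U"
    show "openin (prod_topology euclidean (norm_topology E))
        {p \<in> topspace (prod_topology euclidean (norm_topology E)).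
          (case p of (c, x) \<Rightarrow> c \<odot> x) \<in> U}"
      unfolding openin_prod_topology_alt
    proof clarsimp
      fix c x assume x: "x \<in> carrier E" and cx: "c \<odot> x \<in> U"
      obtain r where r: "r > 0" "\<And>z. z \<in> carrier E \<Longrightarrow> nrm E (z \<ominus> (c \<odot> x)) < r \<Longrightarrow> z \<in> U"
        using U cx unfolding openin_norm_topology by blast
      define N where "N = nrm E x"
      have N: "N \<ge> 0" using nrm_nonneg[OF x] N_def by simp
      \<comment> \<open>The constants come from c'x' - cx = c'(x' - x) + (c' - c)x. The cap 1 bounds
        the modulus of c' by \<open>cmod c + 1\<close>, and each summand is then at most r/2;
        \<open>N + 1\<close> and \<open>cmod c + 1\<close> keep the denominators positive.\<close>
      define e1 where "e1 = min 1 (r / (2 * (N + 1)))"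
      define e2 where "e2 = r / (2 * (cmod c + 1))"
      have e1: "e1 > 0" "e1 \<le> 1" using N r(1) by (auto simp: e1_def)
      have "e1 * (N + 1) \<le> r / (2 * (N + 1)) * (N + 1)"
        using N by (intro mult_right_mono) (auto simp: e1_def)
      also have "r / (2 * (N + 1)) * (N + 1) = r / 2" using N by (simp add: divide_simps)
      finally have e1N: "e1 * (N + 1) \<le> r/2" .
      have e2: "e2 > 0" "(cmod c + 1) * e2 = r/2"
        using r(1) add_nonneg_pos[OF norm_ge_zero[of c] zero_less_one] by (simp_all add: e2_def divide_simps)
      have eq: "c' \<odot> x' \<ominus> c \<odot> x = c' \<odot> (x' \<ominus> x) \<oplus> (c' - c) \<odot> x"
        if x': "x' \<in> carrier E" for c' x'
      proof -
        have "(c' - c) \<odot> x = c' \<odot> x \<ominus> c \<odot> x"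
          using smult_l_distr[of c' "-c" x] smult_l_minus[of c x] x by (simp add: a_minus_def)
        moreover have "c' \<odot> (x' \<ominus> x) = c' \<odot> x' \<ominus> c' \<odot> x"
          using smult_r_distr[of c' x' "\<ominus> x"] smult_r_minus[of c' x] x x' by (simp add: a_minus_def)
        ultimately show ?thesis using x x' diff_add_diff by simp
      qed
      have "c' \<odot> x' \<in> U" if c': "cmod (c' - c) < e1" and x': "x' \<in> carrier E" "nrm E (x' \<ominus> x) < e2" for c' x'
      proof -
        have "cmod c' \<le> cmod c + 1"
          using norm_triangle_ineq2[of c' c] c' e1 by simp
        then have "cmod c' * nrm E (x' \<ominus> x) \<le> (cmod c + 1) * nrm E (x' \<ominus> x)"
          using x x' by (intro mult_right_mono nrm_nonneg) auto
        also have "\<dots> < (cmod c + 1) * e2"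
          using x' by (intro mult_strict_left_mono) (auto intro: add_nonneg_pos)
        finally have 1: "cmod c' * nrm E (x' \<ominus> x) < r/2" using e2 by simp
        have "cmod (c' - c) * N \<le> e1 * (N + 1)"
          using N c' e1 by (intro mult_mono) auto
        then have 2: "cmod (c' - c) * N \<le> r/2" using e1N by simp
        have "nrm E (c' \<odot> x' \<ominus> c \<odot> x) \<le> nrm E (c' \<odot> (x' \<ominus> x)) + nrm E ((c' - c) \<odot> x)"
          unfolding eq[OF x'(1)] using x x' by (intro nrm_triangle) auto
        also have "\<dots> < r"
          using 1 2 x x' by (simp add: nrm_smult N_def)
        finally show ?thesis using r(2) x x' by auto
      qed
      then show "\<exists>V. open V \<and> (\<exists>W. openin (norm_topology E) W \<and> c \<in> V \<and> x \<in> W \<and>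
          V \<times> W \<subseteq> {p. p \<in> UNIV \<times> carrier E \<and> (case p of (c, x) \<Rightarrow> c \<odot> x) \<in> U})"
        using x e1(1) e2(1) openin_ball[OF x, of e2]
        by (intro exI[of _ "ball c e1"] conjI exI[of _ "{z \<in> carrier E. nrm E (z \<ominus> x) < e2}"])
          (auto simp: nrm_diff_eq_0 dist_norm norm_minus_commute)
    qed
  qed (auto simp: Pi_iff)
next
  fix U assume U: "openin (norm_topology E) U \<and> \<zero> \<in> U"
  then obtain r where r: "r > 0" "\<And>z. z \<in> carrier E \<Longrightarrow> nrm E (z \<ominus> \<zero>) < r \<Longrightarrow> z \<in> U"
    unfolding openin_norm_topology by blast
  have "convex_in E {y \<in> carrier E. nrm E y < r}"
    unfolding convex_in_def
  proof clarsimp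
    fix x y and t :: real
    assume x: "x \<in> carrier E" "nrm E x < r" and y: "y \<in> carrier E" "nrm E y < r" and t: "0 \<le> t" "t \<le> 1"
    have "nrm E (complex_of_real (1 - t) \<odot> x \<oplus> complex_of_real t \<odot> y) \<le> (1 - t) * nrm E x + t * nrm E y"
      using nrm_triangle[of "complex_of_real (1 - t) \<odot> x" "complex_of_real t \<odot> y"] x y t
        nrm_smult[of x "complex_of_real (1 - t)"] nrm_smult[of y "complex_of_real t"]
      by (simp del: of_real_diff)
    also have "\<dots> < r"
      using convex_bound_lt[of "nrm E x" r "nrm E y" "1 - t" t] x y t by simp
    finally show "nrm E ((1 - complex_of_real t) \<odot> x \<oplus> complex_of_real t \<odot> y) < r" by simp
  qed
  then show "\<exists>W. openin (norm_topology E) W \<and> \<zero> \<in> W \<and> W \<subseteq> U \<and> convex_in E W"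
    using r openin_zero_ball[of r] by (intro exI[of _ "{y \<in> carrier E. nrm E y < r}"]) auto
qed

end

lemma continuous_map_norm_topology:
  assumes E: "complex_normed_space E" and F: "complex_normed_space F" and f: "linear_map E F f"
    and bound: "\<And>x. x \<in> carrier E \<Longrightarrow> nrm F (f x) \<le> C * nrm E x"
  shows "continuous_map (norm_topology E) (norm_topology F) f"
proof -
  interpret E: complex_normed_space E by fact
  interpret F: complex_normed_space F by fact
  show ?thesis
    unfolding continuous_map_def
  proof (intro conjI allI impI)
    show "f \<in> topspace (norm_topology E) \<rightarrow> topspace (norm_topology F)"
      using linear_mapD(1)[OF f] by auto
    fix U assume U: "openin (norm_topology F) U"
    show "openin (norm_topology E) {x \<in> topspace (norm_topology E). f x \<in> U}"
      unfolding E.openin_norm_topology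
    proof (intro conjI ballI)
      fix x assume "x \<in> {x \<in> topspace (norm_topology E). f x \<in> U}"
      then have x: "x \<in> carrier E" "f x \<in> U" by auto
      obtain r where r: "r > 0" "\<And>z. z \<in> carrier F \<Longrightarrow> nrm F (z \<ominus>\<^bsub>F\<^esub> f x) < r \<Longrightarrow> z \<in> U"
        using U x unfolding F.openin_norm_topology by blast
      \<comment> \<open>The constant \<open>C\<close> may be zero or negative, hence the radius is
        formed with \<open>\<bar>C\<bar> + 1\<close>.\<close>
      have "f y \<in> U" if y: "y \<in> carrier E" "nrm E (y \<ominus>\<^bsub>E\<^esub> x) < r / (\<bar>C\<bar> + 1)" for y
      proof (rule r(2))
        show "f y \<in> carrier F" using linear_mapD(1)[OF f] y by blast
        have "nrm F (f y \<ominus>\<^bsub>F\<^esub> f x) \<le> C * nrm E (y \<ominus>\<^bsub>E\<^esub> x)"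
          using bound[of "y \<ominus>\<^bsub>E\<^esub> x"] x y linear_map_diff[OF E.module_axioms F.module_axioms f]
          by simp
        also have "\<dots> \<le> (\<bar>C\<bar> + 1) * nrm E (y \<ominus>\<^bsub>E\<^esub> x)"
          using x y by (intro mult_right_mono E.nrm_nonneg) auto
        also have "\<dots> < r" using y by (simp add: field_simps)
        finally show "nrm F (f y \<ominus>\<^bsub>F\<^esub> f x) < r" .
      qed
      then show "\<exists>s>0. \<forall>y\<in>carrier E. nrm E (y \<ominus>\<^bsub>E\<^esub> x) < s \<longrightarrow> y \<in> {x \<in> topspace (norm_topology E). f x \<in> U}"
        using r by (intro exI[of _ "r / (\<bar>C\<bar> + 1)"]) auto
    qed auto
  qed
qed

section \<open>Bounded operators\<close>

lemma bounded_ops_simps [simp]: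
  "zero (bounded_ops E F) = (\<lambda>x\<in>carrier E. \<zero>\<^bsub>F\<^esub>)"
  "add (bounded_ops E F) S T = (\<lambda>x\<in>carrier E. S x \<oplus>\<^bsub>F\<^esub> T x)"
  "smult (bounded_ops E F) c T = (\<lambda>x\<in>carrier E. c \<odot>\<^bsub>F\<^esub> T x)"
  by (simp_all add: bounded_ops_def)

lemma mem_bounded_ops:
  "T \<in> carrier (bounded_ops E F) \<longleftrightarrow> T \<in> extensional (carrier E) \<and> linear_map E F T \<and>
     (\<exists>C. \<forall>x\<in>carrier E. nrm F (T x) \<le> C * nrm E x)"
  by (simp add: bounded_ops_def)

lemma nrm_bounded_ops: "nrm (bounded_ops E F) T = (SUP x\<in>{x \<in> carrier E. nrm E x \<le> 1}. nrm F (T x))"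
  by (simp add: bounded_ops_def)

locale normed_space_pair = E: complex_normed_space E + F: complex_normed_space F
  for E :: "'e normed_module" and F :: "'f normed_module"
begin

abbreviation ops :: "('e \<Rightarrow> 'f) normed_module" where
  "ops \<equiv> bounded_ops E F"

lemma bounded_opsD:
  assumes "T \<in> carrier (ops)"
  shows "x \<in> carrier E \<Longrightarrow> T x \<in> carrier F"
    and "x \<in> carrier E \<Longrightarrow> y \<in> carrier E \<Longrightarrow> T (x \<oplus>\<^bsub>E\<^esub> y) = T x \<oplus>\<^bsub>F\<^esub> T y"
    and "x \<in> carrier E \<Longrightarrow> T (c \<odot>\<^bsub>E\<^esub> x) = c \<odot>\<^bsub>F\<^esub> T x"
    and "T \<in> extensional (carrier E)"
  using assms by (auto simp: mem_bounded_ops dest: linear_mapD)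

lemma nrm_bounded_ops_le:
  assumes "\<And>x. x \<in> carrier E \<Longrightarrow> nrm F (T x) \<le> C * nrm E x" "0 \<le> C"
  shows "nrm (ops) T \<le> C"
  unfolding nrm_bounded_ops
proof (rule cSUP_least)
  show "{x \<in> carrier E. nrm E x \<le> 1} \<noteq> {}"
    using E.nrm_zero by (metis (mono_tags, lifting) E.zero_closed empty_iff mem_Collect_eq zero_le_one)
  fix x assume "x \<in> {x \<in> carrier E. nrm E x \<le> 1}"
  then show "nrm F (T x) \<le> C"
    using assms(1)[of x] mult_left_mono[OF _ assms(2), of "nrm E x" 1] by auto
qed

text \<open>A supremum of reals dominates the members of a set only if the set is bounded above, so
  lower bounds for the operator norm pass through this fact. The constant of a bounded operator may
  be negative, which \<open>\<bar>C\<bar>\<close> repairs.\<close>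

lemma bounded_ops_bdd_above:
  assumes "T \<in> carrier ops"
  shows "bdd_above ((\<lambda>x. nrm F (T x)) ` {x \<in> carrier E. nrm E x \<le> 1})"
proof -
  obtain C where C: "\<And>x. x \<in> carrier E \<Longrightarrow> nrm F (T x) \<le> C * nrm E x"
    using assms by (auto simp: mem_bounded_ops)
  show ?thesis
  proof (rule bdd_aboveI2[of _ _ "\<bar>C\<bar>"])
    fix y assume y: "y \<in> {x \<in> carrier E. nrm E x \<le> 1}"
    have "C * nrm E y \<le> \<bar>C\<bar> * nrm E y" using y by (intro mult_right_mono E.nrm_nonneg) auto
    also have "\<dots> \<le> \<bar>C\<bar>" using y by (simp add: mult_left_le)
    finally show "nrm F (T y) \<le> \<bar>C\<bar>" using C[of y] y by simp
  qed
qed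

lemma bounded_ops_bound:
  assumes T: "T \<in> carrier (ops)" and x: "x \<in> carrier E"
  shows "nrm F (T x) \<le> nrm (ops) T * nrm E x"
proof (cases "x = \<zero>\<^bsub>E\<^esub>")
  case True
  then have "T x = \<zero>\<^bsub>F\<^esub>"
    using linear_map_zero[OF E.module_axioms F.module_axioms] T by (auto simp: mem_bounded_ops)
  then show ?thesis using True by simp
next
  case False
  then have pos: "nrm E x > 0" using x E.nrm_eq_0[of x] E.nrm_nonneg[of x] by simp
  have "bdd_above ((\<lambda>x. nrm F (T x)) ` {x \<in> carrier E. nrm E x \<le> 1})"
    by (rule bounded_ops_bdd_above[OF T])
  moreover define y where "y = complex_of_real (1 / nrm E x) \<odot>\<^bsub>E\<^esub> x"
  moreover have "y \<in> {x \<in> carrier E. nrm E x \<le> 1}"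
    using x pos E.nrm_smult[OF x, of "complex_of_real (1 / nrm E x)"]
    by (auto simp: y_def norm_divide)
  ultimately have "nrm F (T y) \<le> nrm (ops) T"
    unfolding nrm_bounded_ops by (intro cSUP_upper) auto
  moreover have "nrm F (T y) = nrm F (T x) / nrm E x"
    unfolding y_def bounded_opsD(3)[OF T x]
    using F.nrm_smult[OF bounded_opsD(1)[OF T x]] pos by (simp add: norm_divide)
  ultimately show ?thesis using pos by (simp add: field_simps)
qed

lemma nrm_bounded_ops_nonneg:
  assumes T: "T \<in> carrier (ops)"
  shows "0 \<le> nrm (ops) T"
proof -
  have "T \<zero>\<^bsub>E\<^esub> = \<zero>\<^bsub>F\<^esub>"
    using linear_map_zero[OF E.module_axioms F.module_axioms] assms by (auto simp: mem_bounded_ops)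
  then have "nrm F (T \<zero>\<^bsub>E\<^esub>) = 0" by simp
  moreover have "bdd_above ((\<lambda>x. nrm F (T x)) ` {x \<in> carrier E. nrm E x \<le> 1})"
    by (rule bounded_ops_bdd_above[OF T])
  then have "nrm F (T \<zero>\<^bsub>E\<^esub>) \<le> nrm (ops) T"
    unfolding nrm_bounded_ops by (intro cSUP_upper) auto
  ultimately show ?thesis by simp
qed

lemma bounded_opsI:
  assumes "T \<in> extensional (carrier E)" "linear_map E F T"
    and "\<And>x. x \<in> carrier E \<Longrightarrow> nrm F (T x) \<le> C * nrm E x"
  shows "T \<in> carrier (ops)"
  using assms by (auto simp: mem_bounded_ops)

lemma bounded_ops_add:
  assumes S: "S \<in> carrier (ops)" and T: "T \<in> carrier (ops)"
  shows "S \<oplus>\<^bsub>ops\<^esub> T \<in> carrier (ops)"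
proof (rule bounded_opsI[where C = "nrm (ops) S + nrm (ops) T"])
  show "linear_map E F (S \<oplus>\<^bsub>ops\<^esub> T)"
    using bounded_opsD[OF S] bounded_opsD[OF T]
    by (intro linear_mapI) (auto simp: F.a_ac F.smult_r_distr)
  show "nrm F ((S \<oplus>\<^bsub>ops\<^esub> T) x) \<le> (nrm (ops) S + nrm (ops) T) * nrm E x"
    if "x \<in> carrier E" for x
    using that F.nrm_triangle[of "S x" "T x"] bounded_ops_bound[OF S that] bounded_ops_bound[OF T that]
      bounded_opsD(1)[OF S that] bounded_opsD(1)[OF T that] by (simp add: algebra_simps)
qed auto

lemma bounded_ops_smult:
  assumes T: "T \<in> carrier (ops)"
  shows "c \<odot>\<^bsub>ops\<^esub> T \<in> carrier (ops)"
proof (rule bounded_opsI[where C = "cmod c * nrm (ops) T"])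
  show "linear_map E F (c \<odot>\<^bsub>ops\<^esub> T)"
    using bounded_opsD[OF T]
    by (intro linear_mapI) (auto simp: F.smult_r_distr F.smult_commute)
  show "nrm F ((c \<odot>\<^bsub>ops\<^esub> T) x) \<le> cmod c * nrm (ops) T * nrm E x"
    if "x \<in> carrier E" for x
    using that F.nrm_smult[of "T x" c] mult_left_mono[OF bounded_ops_bound[OF T that], of "cmod c"]
      bounded_opsD(1)[OF T that] by (simp add: algebra_simps)
qed auto

lemma module_bounded_ops: "module complex_field (ops)"
proof (rule module_complex_fieldI)
  show "\<zero>\<^bsub>ops\<^esub> \<in> carrier (ops)"
    by (rule bounded_opsI[where C = 0], auto intro!: linear_mapI)
  fix T assume T: "T \<in> carrier (ops)"
  note TD = bounded_opsD[OF T]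
  show "\<zero>\<^bsub>ops\<^esub> \<oplus>\<^bsub>ops\<^esub> T = T"
    by (rule extensionalityI[of _ "carrier E"]) (auto simp: TD)
  show "1 \<odot>\<^bsub>ops\<^esub> T = T"
    using F.smult_one by (intro extensionalityI[of _ "carrier E"]) (auto simp: TD)
  show "0 \<odot>\<^bsub>ops\<^esub> T = \<zero>\<^bsub>ops\<^esub>"
    using F.smult_l_null by (intro extensionalityI[of _ "carrier E"]) (auto simp: TD)
  show "(c + d) \<odot>\<^bsub>ops\<^esub> T = c \<odot>\<^bsub>ops\<^esub> T \<oplus>\<^bsub>ops\<^esub> d \<odot>\<^bsub>ops\<^esub> T" for c d
    using F.smult_l_distr by (intro extensionalityI[of _ "carrier E"]) (auto simp: TD)
  show "(c * d) \<odot>\<^bsub>ops\<^esub> T = c \<odot>\<^bsub>ops\<^esub> (d \<odot>\<^bsub>ops\<^esub> T)" for c d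
    using F.smult_assoc1 by (intro extensionalityI[of _ "carrier E"]) (auto simp: TD)
  fix S assume S: "S \<in> carrier (ops)"
  note SD = bounded_opsD[OF S]
  show "S \<oplus>\<^bsub>ops\<^esub> T = T \<oplus>\<^bsub>ops\<^esub> S"
    by (rule extensionalityI[of _ "carrier E"]) (auto simp: TD SD F.a_comm)
  show "c \<odot>\<^bsub>ops\<^esub> (S \<oplus>\<^bsub>ops\<^esub> T) =
      c \<odot>\<^bsub>ops\<^esub> S \<oplus>\<^bsub>ops\<^esub> c \<odot>\<^bsub>ops\<^esub> T" for c
    using F.smult_r_distr by (intro extensionalityI[of _ "carrier E"]) (auto simp: TD SD)
  fix R assume R: "R \<in> carrier (ops)"
  note RD = bounded_opsD[OF R]
  show "R \<oplus>\<^bsub>ops\<^esub> S \<oplus>\<^bsub>ops\<^esub> T = R \<oplus>\<^bsub>ops\<^esub> (S \<oplus>\<^bsub>ops\<^esub> T)"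
    by (rule extensionalityI[of _ "carrier E"]) (auto simp: TD SD RD F.a_assoc)
qed (use bounded_ops_add bounded_ops_smult in blast)+

lemma complex_normed_space_bounded_ops: "complex_normed_space (ops)"
proof (intro complex_normed_space.intro complex_normed_space_axioms.intro module_bounded_ops)
  fix T assume T: "T \<in> carrier (ops)"
  note TD = bounded_opsD[OF T]
  show "0 \<le> nrm (ops) T" by (rule nrm_bounded_ops_nonneg[OF T])
  show "(nrm (ops) T = 0) = (T = \<zero>\<^bsub>ops\<^esub>)"
  proof
    assume 0: "nrm (ops) T = 0"
    have "T x = \<zero>\<^bsub>F\<^esub>" if "x \<in> carrier E" for x
      using bounded_ops_bound[OF T that] 0 F.nrm_nonneg[OF TD(1)[OF that]] F.nrm_eq_0[OF TD(1)[OF that]]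
      by simp
    then show "T = \<zero>\<^bsub>ops\<^esub>"
      by (intro extensionalityI[of _ "carrier E"]) (auto simp: TD)
  next
    assume 0: "T = \<zero>\<^bsub>ops\<^esub>"
    have "nrm (ops) T \<le> 0"
      by (rule nrm_bounded_ops_le) (auto simp: 0)
    then show "nrm (ops) T = 0" using nrm_bounded_ops_nonneg[OF T] by simp
  qed
  \<comment> \<open>One inequality for all scalars suffices: applied to \<open>inverse c\<close> and
    the operator c T it yields the reverse inequality.\<close>
  have le: "nrm (ops) (c \<odot>\<^bsub>ops\<^esub> S) \<le> cmod c * nrm (ops) S"
    if S: "S \<in> carrier (ops)" for c S
  proof (rule nrm_bounded_ops_le)
    show "nrm F ((c \<odot>\<^bsub>ops\<^esub> S) x) \<le> cmod c * nrm (ops) S * nrm E x"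
      if "x \<in> carrier E" for x
      using that F.nrm_smult[of "S x" c] mult_left_mono[OF bounded_ops_bound[OF S that], of "cmod c"]
        bounded_opsD(1)[OF S that] by (simp add: algebra_simps)
  qed (use nrm_bounded_ops_nonneg[OF S] in simp)
  show "nrm (ops) (c \<odot>\<^bsub>ops\<^esub> T) = cmod c * nrm (ops) T" for c
  proof (cases "c = 0")
    case True
    then show ?thesis using le[OF T, of c] nrm_bounded_ops_nonneg[OF bounded_ops_smult[OF T], of c] by simp
  next
    case False
    have eq: "inverse c \<odot>\<^bsub>ops\<^esub> (c \<odot>\<^bsub>ops\<^esub> T) = T"
      using False by (intro extensionalityI[of _ "carrier E"]) (auto simp: TD F.smult_inverse)
    then have "nrm (ops) T \<le> cmod (inverse c) * nrm (ops) (c \<odot>\<^bsub>ops\<^esub> T)"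
      using le[OF bounded_ops_smult[OF T, of c], of "inverse c"] by (simp only: eq)
    then have "cmod c * nrm (ops) T \<le> nrm (ops) (c \<odot>\<^bsub>ops\<^esub> T)"
      using False by (simp add: norm_inverse norm_divide field_simps)
    then show ?thesis using le[OF T, of c] by simp
  qed
  fix S assume S: "S \<in> carrier (ops)"
  show "nrm (ops) (T \<oplus>\<^bsub>ops\<^esub> S) \<le> nrm (ops) T + nrm (ops) S"
  proof (rule nrm_bounded_ops_le)
    show "nrm F ((T \<oplus>\<^bsub>ops\<^esub> S) x) \<le> (nrm (ops) T + nrm (ops) S) * nrm E x"
      if "x \<in> carrier E" for x
      using that F.nrm_triangle[of "T x" "S x"] bounded_ops_bound[OF S that] bounded_ops_bound[OF T that]
        bounded_opsD(1)[OF S that] bounded_opsD(1)[OF T that] by (simp add: algebra_simps)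
  qed (use nrm_bounded_ops_nonneg S T in simp)
qed

end

section \<open>Scalars, dual spaces and adjoints\<close>

lemma complex_space_simps [simp]:
  "carrier complex_space = UNIV" "zero complex_space = 0" "add complex_space = (+)"
  "smult complex_space = (*)" "nrm complex_space = cmod"
  by (simp_all add: complex_space_def)

interpretation complex_space: complex_normed_space complex_space
proof (intro complex_normed_space.intro complex_normed_space_axioms.intro)
  show "module complex_field complex_space"
    by (rule module_complex_fieldI) (auto simp: algebra_simps)
qed (auto simp: norm_triangle_ineq norm_mult)

lemma complex_space_minus [simp]: "x \<ominus>\<^bsub>complex_space\<^esub> y = x - y"
  by (simp add: complex_space.diff_eq_smult)

lemma normed_space_pair_dual: "complex_normed_space E \<Longrightarrow> normed_space_pair E complex_space"
  by (simp add: normed_space_pair_def complex_space.complex_normed_space_axioms)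

lemma complex_normed_space_dual: "complex_normed_space E \<Longrightarrow> complex_normed_space (dual E)"
  unfolding dual_def
  by (intro normed_space_pair.complex_normed_space_bounded_ops normed_space_pair_dual)

lemma adjoint_closed:
  assumes "complex_normed_space E" "T \<in> carrier (bounded_ops E E)" "\<phi> \<in> carrier (dual E)"
  shows "adjoint E T \<phi> \<in> carrier (dual E)"
proof -
  interpret EE: normed_space_pair E E using assms by (simp add: normed_space_pair_def)
  interpret EC: normed_space_pair E complex_space using assms normed_space_pair_dual by blast
  note \<phi> = assms(3)[unfolded dual_def]
  note T = assms(2)
  show ?thesis
    unfolding dual_def
  proof (rule EC.bounded_opsI[where C = "nrm (dual E) \<phi> * nrm (bounded_ops E E) T"])
    show "adjoint E T \<phi> \<in> extensional (carrier E)" by (simp add: adjoint_def compose_def)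
    show "linear_map E complex_space (adjoint E T \<phi>)"
      using EE.bounded_opsD[OF T] EC.bounded_opsD[OF \<phi>]
      by (intro linear_mapI) (auto simp: adjoint_def compose_def)
    fix x assume x: "x \<in> carrier E"
    have "cmod (\<phi> (T x)) \<le> nrm (dual E) \<phi> * nrm E (T x)"
      using EC.bounded_ops_bound[OF \<phi> EE.bounded_opsD(1)[OF T x]] by (simp add: dual_def)
    also have "\<dots> \<le> nrm (dual E) \<phi> * (nrm (bounded_ops E E) T * nrm E x)"
      using EC.nrm_bounded_ops_nonneg[OF \<phi>] EE.bounded_ops_bound[OF T x]
      by (intro mult_left_mono) (auto simp: dual_def)
    finally show "nrm complex_space (adjoint E T \<phi> x) \<le> nrm (dual E) \<phi> * nrm (bounded_ops E E) T * nrm E x"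
      using x by (simp add: adjoint_def compose_def mult.assoc)
  qed
qed


section \<open>Locally convex topologies\<close>

lemma locally_convex_topspace: "locally_convex_topology V \<tau> \<Longrightarrow> topspace \<tau> = carrier V"
  by (simp add: locally_convex_topology_def)

lemma locally_convex_add:
  assumes "locally_convex_topology V \<tau>" "continuous_map X \<tau> f" "continuous_map X \<tau> g"
  shows "continuous_map X \<tau> (\<lambda>z. f z \<oplus>\<^bsub>V\<^esub> g z)"
proof -
  have "continuous_map (prod_topology \<tau> \<tau>) \<tau> (\<lambda>(x, y). x \<oplus>\<^bsub>V\<^esub> y)"
    using assms(1) by (simp add: locally_convex_topology_def)
  from continuous_map_compose[OF continuous_map_pairedI[OF assms(2,3)] this]
  show ?thesis by (simp add: o_def)
qed

lemma locally_convex_smult: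
  assumes "locally_convex_topology V \<tau>" "continuous_map X euclidean c" "continuous_map X \<tau> f"
  shows "continuous_map X \<tau> (\<lambda>z. c z \<odot>\<^bsub>V\<^esub> f z)"
proof -
  have "continuous_map (prod_topology euclidean \<tau>) \<tau> (\<lambda>(c, x). c \<odot>\<^bsub>V\<^esub> x)"
    using assms(1) by (simp add: locally_convex_topology_def)
  from continuous_map_compose[OF continuous_map_pairedI[OF assms(2,3)] this]
  show ?thesis by (simp add: o_def)
qed

text \<open>Linearity turns the operations of \<open>V\<close> into those of \<open>W\<close>, and
  preimages of convex sets under a linear map are convex. This serves both the subspace topology
  (along the inclusion) and the universal property of inductive limits.\<close>

lemma locally_convex_pullback:
  assumes V: "module complex_field V" and W: "module complex_field W" and f: "linear_map V W f"
    and \<tau>: "locally_convex_topology W \<tau>"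
  shows "locally_convex_topology V (pullback_topology (carrier V) f \<tau>)" (is "locally_convex_topology V ?P")
proof -
  interpret V: module complex_field V by fact
  have top: "topspace ?P = carrier V"
    using linear_mapD(1)[OF f] by (auto simp: topspace_pullback_topology locally_convex_topspace[OF \<tau>])
  have cf: "continuous_map ?P \<tau> f"
    using continuous_map_pullback[OF continuous_map_id, of "carrier V" f \<tau>] by simp
  have "continuous_map (prod_topology ?P ?P) ?P (\<lambda>(x, y). x \<oplus>\<^bsub>V\<^esub> y)"
  proof (rule continuous_map_pullback')
    have "continuous_map (prod_topology ?P ?P) \<tau> (\<lambda>z. f (fst z) \<oplus>\<^bsub>W\<^esub> f (snd z))"
      using continuous_map_compose[OF continuous_map_fst cf] continuous_map_compose[OF continuous_map_snd cf]
      by (intro locally_convex_add[OF \<tau>]) (auto simp: o_def)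
    then show "continuous_map (prod_topology ?P ?P) \<tau> (f \<circ> (\<lambda>(x, y). x \<oplus>\<^bsub>V\<^esub> y))"
      by (rule continuous_map_eq) (auto simp: top linear_mapD(2)[OF f])
  qed (auto simp: top)
  moreover have "continuous_map (prod_topology euclidean ?P) ?P (\<lambda>(c, x). c \<odot>\<^bsub>V\<^esub> x)"
  proof (rule continuous_map_pullback')
    have "continuous_map (prod_topology euclidean ?P) \<tau> (\<lambda>z. fst z \<odot>\<^bsub>W\<^esub> f (snd z))"
      using continuous_map_compose[OF continuous_map_snd cf]
      by (intro locally_convex_smult[OF \<tau>] continuous_map_fst) (auto simp: o_def)
    then show "continuous_map (prod_topology euclidean ?P) \<tau> (f \<circ> (\<lambda>(c, x). c \<odot>\<^bsub>V\<^esub> x))"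
      by (rule continuous_map_eq) (auto simp: top linear_mapD(3)[OF f])
  qed (use V.smult_closed in \<open>auto simp: top\<close>)
  moreover have "\<exists>S. openin ?P S \<and> \<zero>\<^bsub>V\<^esub> \<in> S \<and> S \<subseteq> U \<and> convex_in V S"
    if U: "openin ?P U" "\<zero>\<^bsub>V\<^esub> \<in> U" for U
  proof -
    obtain U' where U': "openin \<tau> U'" "U = f -` U' \<inter> carrier V"
      using U by (auto simp: openin_pullback_topology)
    then have "\<zero>\<^bsub>W\<^esub> \<in> U'"
      using U linear_map_zero[OF V W f] by auto
    then obtain S where S: "openin \<tau> S" "\<zero>\<^bsub>W\<^esub> \<in> S" "S \<subseteq> U'" "convex_in W S"
      using \<tau> U' unfolding locally_convex_topology_def by blast
    have "convex_in V (f -` S \<inter> carrier V)"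
      using S(4) V.smult_closed linear_mapD[OF f] unfolding convex_in_def by auto
    then show ?thesis
      using S U' linear_map_zero[OF V W f]
      by (intro exI[of _ "f -` S \<inter> carrier V"]) (auto simp: openin_pullback_topology)
  qed
  ultimately show ?thesis
    using top by (simp add: locally_convex_topology_def)
qed

lemma subtopology_eq_pullback: "subtopology \<tau> S = pullback_topology S (\<lambda>x. x) \<tau>"
  by (auto simp: topology_eq openin_subtopology openin_pullback_topology)

section \<open>Locally convex inductive limits\<close>

lemma openin_lc_inductive_limit:
  assumes "locally_convex_topology V \<tau>" "\<And>X. X \<in> \<X> \<Longrightarrow> continuous_map X \<tau> (\<lambda>x. x)" "openin \<tau> U"
  shows "openin (lc_inductive_limit V \<X>) U"
  unfolding lc_inductive_limit_def using assms by (intro topology_generated_by_Basis) blast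

text \<open>The pullback of \<open>\<tau>\<close> along \<open>f\<close> is itself one of the
  topologies whose supremum is taken, so its open sets are open in the limit. The same topology
  shows that the limit lives on all of \<open>carrier V\<close>.\<close>

lemma continuous_map_from_lc_inductive_limit:
  assumes V: "module complex_field V" and W: "module complex_field W" and f: "linear_map V W f"
    and \<tau>: "locally_convex_topology W \<tau>"
    and top: "\<And>X. X \<in> \<X> \<Longrightarrow> topspace X \<subseteq> carrier V"
    and cont: "\<And>X. X \<in> \<X> \<Longrightarrow> continuous_map X \<tau> f"
  shows "continuous_map (lc_inductive_limit V \<X>) \<tau> f \<and> topspace (lc_inductive_limit V \<X>) = carrier V"
proof -
  let ?P = "pullback_topology (carrier V) f \<tau>"
  have P: "locally_convex_topology V ?P" by (rule locally_convex_pullback[OF V W f \<tau>])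
  have XP: "continuous_map X ?P (\<lambda>x. x)" if "X \<in> \<X>" for X
    using cont[OF that] top[OF that] by (intro continuous_map_pullback') (auto simp: o_def)
  have openin: "openin (lc_inductive_limit V \<X>) U" if "openin ?P U" for U
    using openin_lc_inductive_limit[OF P XP that] .
  have topT: "topspace (lc_inductive_limit V \<X>) = carrier V"
  proof
    show "carrier V \<subseteq> topspace (lc_inductive_limit V \<X>)"
      using openin[of "topspace ?P"] by (metis locally_convex_topspace[OF P] openin_subset openin_topspace)
    show "topspace (lc_inductive_limit V \<X>) \<subseteq> carrier V"
    proof
      fix x assume "x \<in> topspace (lc_inductive_limit V \<X>)"
      then obtain \<tau> U where "locally_convex_topology V \<tau>" "openin \<tau> U" "x \<in> U"
        unfolding lc_inductive_limit_def topology_generated_by_topspace by blast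
      then show "x \<in> carrier V" using locally_convex_topspace openin_subset by blast
    qed
  qed
  have "continuous_map (lc_inductive_limit V \<X>) \<tau> f"
    unfolding continuous_map_def
  proof (intro conjI allI impI)
    show "f \<in> topspace (lc_inductive_limit V \<X>) \<rightarrow> topspace \<tau>"
      using topT linear_mapD(1)[OF f] locally_convex_topspace[OF \<tau>] by auto
    fix U assume "openin \<tau> U"
    then have "openin ?P (f -` U \<inter> carrier V)" by (auto simp: openin_pullback_topology)
    moreover have "f -` U \<inter> carrier V = {x \<in> topspace (lc_inductive_limit V \<X>). f x \<in> U}"
      using topT by auto
    ultimately show "openin (lc_inductive_limit V \<X>) {x \<in> topspace (lc_inductive_limit V \<X>). f x \<in> U}"
      using openin by metis
  qed
  then show ?thesis using topT by blast
qed

context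
  fixes V :: "(complex, 'v, 'm) module_scheme" and \<X>
  assumes V: "module complex_field V" and top: "\<And>X. X \<in> \<X> \<Longrightarrow> topspace X \<subseteq> carrier V"
begin

text \<open>A topology generated by no sets at all would have an empty space. The zero functional
  guarantees a member of the family: its pullback is the indiscrete topology.\<close>

lemma topspace_lc_inductive_limit: "topspace (lc_inductive_limit V \<X>) = carrier V"
proof -
  have "linear_map V complex_space (\<lambda>x. 0)" by (simp add: linear_map_def)
  moreover have "continuous_map X (norm_topology complex_space) (\<lambda>x. 0)" for X :: "'v topology"
    by (simp add: continuous_map_const)
  ultimately show ?thesis
    using continuous_map_from_lc_inductive_limit[OF V complex_space.module_axioms _
        complex_space.locally_convex_norm_topology] top by blast
qed

lemma continuous_map_into_lc_inductive_limit:
  assumes "X \<in> \<X>"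
  shows "continuous_map X (lc_inductive_limit V \<X>) (\<lambda>x. x)"
  unfolding lc_inductive_limit_def
proof (rule continuous_on_generated_topo)
  fix U assume "U \<in> \<Union> {{U. openin \<tau> U} |\<tau>. locally_convex_topology V \<tau> \<and> (\<forall>X\<in>\<X>. continuous_map X \<tau> (\<lambda>x. x))}"
  then obtain \<tau> where "openin \<tau> U" "\<forall>X\<in>\<X>. continuous_map X \<tau> (\<lambda>x. x)" by blast
  then show "openin X ((\<lambda>x. x) -` U \<inter> topspace X)"
    using assms by (auto simp: continuous_map_alt)
next
  show "(\<lambda>x. x) ` topspace X \<subseteq>
    \<Union> (\<Union> {{U. openin \<tau> U} |\<tau>. locally_convex_topology V \<tau> \<and> (\<forall>X\<in>\<X>. continuous_map X \<tau> (\<lambda>x. x))})"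
    using top[OF assms] topspace_lc_inductive_limit
    unfolding lc_inductive_limit_def topology_generated_by_topspace by simp
qed

text \<open>Continuity of the operations is tested on generating sets, each open in a single locally
  convex \<open>\<tau>\<close> below the limit. Convex neighbourhoods of zero are found by induction
  on the generation of an open set: the intersection of two convex sets is convex, and for a union
  one member containing zero is enough.\<close>

lemma locally_convex_lc_inductive_limit:
  "locally_convex_topology V (lc_inductive_limit V \<X>)" (is "locally_convex_topology V ?T")
proof -
  interpret V: module complex_field V by (rule V)
  define \<S> where "\<S> = \<Union> {{U. openin \<tau> U} |\<tau>. locally_convex_topology V \<tau> \<and> (\<forall>X\<in>\<X>. continuous_map X \<tau> (\<lambda>x. x))}"
  have T: "?T = topology_generated_by \<S>" by (simp add: lc_inductive_limit_def \<S>_def)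
  have S: "\<exists>\<tau>. locally_convex_topology V \<tau> \<and> openin \<tau> U \<and> continuous_map ?T \<tau> (\<lambda>x. x)" if U: "U \<in> \<S>" for U
  proof -
    obtain \<tau> where \<tau>: "openin \<tau> U" "locally_convex_topology V \<tau>" "\<forall>X\<in>\<X>. continuous_map X \<tau> (\<lambda>x. x)"
      using U by (auto simp: \<S>_def)
    moreover have "linear_map V V (\<lambda>x. x)" by (simp add: linear_map_def)
    ultimately show ?thesis
      using continuous_map_from_lc_inductive_limit[OF V V _ \<tau>(2)] top by blast
  qed
  have top_T: "topspace ?T = carrier V" by (rule topspace_lc_inductive_limit)
  then have US: "\<Union>\<S> = carrier V" by (simp add: T)
  have "continuous_map (prod_topology ?T ?T) ?T (\<lambda>(x, y). x \<oplus>\<^bsub>V\<^esub> y)"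
  proof (subst (3) T, rule continuous_on_generated_topo)
    fix U assume "U \<in> \<S>"
    then obtain \<tau> where \<tau>: "locally_convex_topology V \<tau>" "openin \<tau> U" "continuous_map ?T \<tau> (\<lambda>x. x)"
      using S by blast
    have "continuous_map (prod_topology ?T ?T) \<tau> (\<lambda>z. fst z \<oplus>\<^bsub>V\<^esub> snd z)"
      using continuous_map_compose[OF continuous_map_fst \<tau>(3)] continuous_map_compose[OF continuous_map_snd \<tau>(3)]
      by (intro locally_convex_add[OF \<tau>(1)]) (auto simp: o_def)
    then show "openin (prod_topology ?T ?T) ((\<lambda>(x, y). x \<oplus>\<^bsub>V\<^esub> y) -` U \<inter> topspace (prod_topology ?T ?T))"
      using \<tau>(2) by (simp add: continuous_map_alt case_prod_beta' del: topspace_prod_topology)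
  qed (auto simp: top_T US)
  moreover have "continuous_map (prod_topology euclidean ?T) ?T (\<lambda>(c, x). c \<odot>\<^bsub>V\<^esub> x)"
  proof (subst (2) T, rule continuous_on_generated_topo)
    fix U assume "U \<in> \<S>"
    then obtain \<tau> where \<tau>: "locally_convex_topology V \<tau>" "openin \<tau> U" "continuous_map ?T \<tau> (\<lambda>x. x)"
      using S by blast
    have "continuous_map (prod_topology euclidean ?T) \<tau> (\<lambda>z. fst z \<odot>\<^bsub>V\<^esub> snd z)"
      using continuous_map_compose[OF continuous_map_snd \<tau>(3)]
      by (intro locally_convex_smult[OF \<tau>(1)] continuous_map_fst) (auto simp: o_def)
    then show "openin (prod_topology euclidean ?T) ((\<lambda>(c, x). c \<odot>\<^bsub>V\<^esub> x) -` U \<inter> topspace (prod_topology euclidean ?T))"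
      using \<tau>(2) by (simp add: continuous_map_alt case_prod_beta' del: topspace_prod_topology)
  qed (use V.smult_closed in \<open>auto simp: top_T US\<close>)
  moreover have "\<exists>W. openin ?T W \<and> \<zero>\<^bsub>V\<^esub> \<in> W \<and> W \<subseteq> U \<and> convex_in V W"
    if "openin ?T U" "\<zero>\<^bsub>V\<^esub> \<in> U" for U
  proof -
    have "generate_topology_on \<S> U"
      using that by (simp add: T openin_topology_generated_by)
    then show ?thesis using that(2)
    proof induction
      case Empty
      then show ?case by simp
    next
      case (Int a b)
      then obtain A B where "openin ?T A" "\<zero>\<^bsub>V\<^esub> \<in> A" "A \<subseteq> a" "convex_in V A"
        "openin ?T B" "\<zero>\<^bsub>V\<^esub> \<in> B" "B \<subseteq> b" "convex_in V B" by auto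
      then show ?case
        by (intro exI[of _ "A \<inter> B"]) (auto simp: convex_in_def)
    next
      case (UN K)
      then obtain k where k: "k \<in> K" "\<zero>\<^bsub>V\<^esub> \<in> k" by auto
      then obtain W where "openin ?T W" "\<zero>\<^bsub>V\<^esub> \<in> W" "W \<subseteq> k" "convex_in V W"
        using UN.IH[OF k] by auto
      then show ?case using k(1) by (intro exI[of _ W]) auto
    next
      case (Basis U)
      then obtain \<tau> where \<tau>: "locally_convex_topology V \<tau>" "openin \<tau> U" "continuous_map ?T \<tau> (\<lambda>x. x)"
        using S by blast
      then obtain W where W: "openin \<tau> W" "\<zero>\<^bsub>V\<^esub> \<in> W" "W \<subseteq> U" "convex_in V W"
        using Basis unfolding locally_convex_topology_def by blast
      have "openin ?T {x \<in> topspace ?T. x \<in> W}"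
        using \<tau>(3) W(1) unfolding continuous_map_def by blast
      moreover have "{x \<in> topspace ?T. x \<in> W} = W"
        using openin_subset[OF W(1)] locally_convex_topspace[OF \<tau>(1)] top_T by auto
      ultimately show ?case using W by auto
    qed
  qed
  ultimately show ?thesis using top_T unfolding locally_convex_topology_def by blast
qed

end

section \<open>Approximate identities, property (CB) and amenability\<close>

lemma dual_diff_apply:
  assumes "complex_normed_space E" "S \<in> carrier (dual E)" "T \<in> carrier (dual E)" "x \<in> carrier E"
  shows "(S \<ominus>\<^bsub>dual E\<^esub> T) x = S x - T x"
proof -
  interpret complex_normed_space "dual E" by (rule complex_normed_space_dual) fact
  show ?thesis using assms diff_eq_smult[of S T] by (simp add: dual_def)
qed

lemma dual_bound:
  assumes "complex_normed_space E" "S \<in> carrier (dual E)" "x \<in> carrier E"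
  shows "cmod (S x) \<le> nrm (dual E) S * nrm E x"
  using normed_space_pair.bounded_ops_bound[OF normed_space_pair_dual[OF assms(1)], of S x] assms
  by (simp add: dual_def)

section \<open>Nets and their weak-* cluster points\<close>

lemma directed_setD:
  assumes "directed_set I D"
  shows "I \<noteq> {}" "i \<in> I \<Longrightarrow> (i, i) \<in> D"
    and "i \<in> I \<Longrightarrow> j \<in> I \<Longrightarrow> k \<in> I \<Longrightarrow> (i, j) \<in> D \<Longrightarrow> (j, k) \<in> D \<Longrightarrow> (i, k) \<in> D"
    and "i \<in> I \<Longrightarrow> j \<in> I \<Longrightarrow> \<exists>k\<in>I. (i, k) \<in> D \<and> (j, k) \<in> D"
proof -
  have *: "I \<noteq> {}" "\<forall>i\<in>I. (i, i) \<in> D"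
    "\<forall>i\<in>I. \<forall>j\<in>I. \<forall>k\<in>I. (i, j) \<in> D \<longrightarrow> (j, k) \<in> D \<longrightarrow> (i, k) \<in> D"
    "\<forall>i\<in>I. \<forall>j\<in>I. \<exists>k\<in>I. (i, k) \<in> D \<and> (j, k) \<in> D"
    using assms unfolding directed_set_def by satx+
  show "I \<noteq> {}" "i \<in> I \<Longrightarrow> (i, i) \<in> D" using *(1,2) by simp_all
  show "i \<in> I \<Longrightarrow> j \<in> I \<Longrightarrow> k \<in> I \<Longrightarrow> (i, j) \<in> D \<Longrightarrow> (j, k) \<in> D \<Longrightarrow> (i, k) \<in> D"
    using *(3)[rule_format, of i j k] by simp
  show "i \<in> I \<Longrightarrow> j \<in> I \<Longrightarrow> \<exists>k\<in>I. (i, k) \<in> D \<and> (j, k) \<in> D"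
    using *(4)[rule_format, of i j] by simp
qed

text \<open>Directedness makes the tails a filter base, so the infimum of filters reduces to a
  single tail.\<close>

lemma eventually_tails:
  assumes "directed_set I D"
  shows "eventually P (tails I D) \<longleftrightarrow> (\<exists>i\<in>I. \<forall>j\<in>I. (i, j) \<in> D \<longrightarrow> P j)"
  unfolding tails_def
proof (subst eventually_INF_base)
  show "I \<noteq> {}" using assms by (simp add: directed_set_def)
  fix a b assume ab: "a \<in> I" "b \<in> I"
  then obtain k where k: "k \<in> I" "(a, k) \<in> D" "(b, k) \<in> D" using directed_setD(4)[OF assms] by blast
  have "(a, j) \<in> D \<and> (b, j) \<in> D" if "j \<in> I" "(k, j) \<in> D" for j
    using directed_setD(3)[OF assms _ k(1) that(1) _ that(2)] ab k by blast
  with k show "\<exists>x\<in>I. principal {j \<in> I. (x, j) \<in> D} \<le> inf (principal {j \<in> I. (a, j) \<in> D}) (principal {j \<in> I. (b, j) \<in> D})"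
    by (intro bexI[of _ k]) auto
qed (auto simp: eventually_principal)

lemma directed_set_upper_bound:
  assumes "directed_set I D" "finite J" "J \<subseteq> I"
  shows "\<exists>k\<in>I. \<forall>j\<in>J. (j, k) \<in> D"
  using assms(2,3)
proof (induction J)
  case empty
  then show ?case using directed_setD(1)[OF assms(1)] by auto
next
  case (insert i J)
  then obtain k where k: "k \<in> I" "\<forall>j\<in>J. (j, k) \<in> D" by auto
  then obtain l where l: "l \<in> I" "(i, l) \<in> D" "(k, l) \<in> D"
    using insert.prems directed_setD(4)[OF assms(1), of i k] by auto
  have "(j, l) \<in> D" if "j \<in> J" for j
    using directed_setD(3)[OF assms(1) _ k(1) l(1) _ l(3)] k(2) that insert.prems by blast
  then show ?case using l by auto
qed

text \<open>Alaoglu's theorem: \<open>\<phi>\<close> is a weak-* cluster point of the net \<open>f\<close>.\<close>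

lemma dual_net_cluster_point:
  fixes E :: "'e normed_module"
  assumes E: "complex_normed_space E" and D: "directed_set I D"
    and f: "\<And>i. i \<in> I \<Longrightarrow> f i \<in> carrier (dual E)" "\<And>i. i \<in> I \<Longrightarrow> nrm (dual E) (f i) \<le> M"
  shows "\<exists>\<phi>\<in>carrier (dual E). \<forall>X e i. finite X \<longrightarrow> e > 0 \<longrightarrow> i \<in> I \<longrightarrow>
           (\<exists>j\<in>I. (i, j) \<in> D \<and> (\<forall>x\<in>X \<inter> carrier E. cmod (f j x - \<phi> x) < e))"
proof -
  interpret E: complex_normed_space E by fact
  interpret EC: normed_space_pair E complex_space by (rule normed_space_pair_dual[OF E])
  \<comment> \<open>\<open>P\<close> is the topology of pointwise convergence on the carrier. All
    \<open>f i\<close> lie in the product \<open>K\<close> of closed discs, compact by Tychonoff;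
    \<open>C i\<close> is the closure of the tail at \<open>i\<close>, and a point common to all
    \<open>C i\<close> is a cluster point.\<close>
  define P :: "('e \<Rightarrow> complex) topology" where "P = product_topology (\<lambda>x. euclidean) (carrier E)"
  define K where "K = (\<Pi>\<^sub>E x\<in>carrier E. cball (0::complex) (M * nrm E x))"
  define C where "C i = P closure_of (f ` {j \<in> I. (i, j) \<in> D})" for i
  have K: "compactin P K"
    unfolding P_def K_def by (subst compactin_PiE) auto
  have fK: "f i \<in> K" if "i \<in> I" for i
  proof -
    have "cmod (f i x) \<le> M * nrm E x" if "x \<in> carrier E" for x
      using dual_bound[OF E f(1)[OF \<open>i \<in> I\<close>] that] mult_right_mono[OF f(2)[OF \<open>i \<in> I\<close>] E.nrm_nonneg[OF that]]
      by linarith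
    then show ?thesis
      using f(1)[OF that] by (auto simp: K_def dual_def mem_bounded_ops PiE_iff)
  qed
  \<comment> \<open>Finitely many tails share an index \<open>k\<close> by directedness, and
    \<open>f k\<close> witnesses the finite intersection property.\<close>
  have fin: "K \<inter> \<Inter>\<F> \<noteq> {}" if \<F>: "finite \<F>" "\<F> \<subseteq> C ` I" for \<F>
  proof -
    obtain J where J: "J \<subseteq> I" "finite J" "\<F> = C ` J" using finite_subset_image[OF \<F>] by blast
    obtain k where k: "k \<in> I" "\<forall>j\<in>J. (j, k) \<in> D" using directed_set_upper_bound[OF D J(2,1)] by blast
    have "f k \<in> C j" if "j \<in> J" for j
    proof -
      have "f ` {l \<in> I. (j, l) \<in> D} \<subseteq> topspace P"
        using fK compactin_subset_topspace[OF K] by blast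
      then show ?thesis
        using closure_of_subset[of "f ` {l \<in> I. (j, l) \<in> D}" P] k that unfolding C_def by blast
    qed
    then show ?thesis using fK[OF k(1)] J by blast
  qed
  have "K \<inter> \<Inter>(C ` I) \<noteq> {}"
    using K fin unfolding compactin_fip by (auto simp: C_def)
  then obtain \<phi> where \<phi>: "\<phi> \<in> K" "\<And>i. i \<in> I \<Longrightarrow> \<phi> \<in> C i" by blast
  have approx: "\<exists>j\<in>I. (i, j) \<in> D \<and> (\<forall>x\<in>X \<inter> carrier E. cmod (f j x - \<phi> x) < e)"
    if "finite X" "e > 0" "i \<in> I" for X e i
  proof -
    define U where "U = (\<Pi>\<^sub>E x\<in>carrier E. if x \<in> X then ball (\<phi> x) e else UNIV)"
    have "finite {x. (if x \<in> X then ball (\<phi> x) e else UNIV) \<noteq> topspace euclidean}"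
      by (rule finite_subset[OF _ \<open>finite X\<close>]) (auto split: if_splits)
    then have "openin P U"
      unfolding P_def U_def by (intro product_topology_basis) (auto simp flip: open_openin)
    moreover have "\<phi> \<in> U"
      using \<phi>(1) \<open>e > 0\<close> by (auto simp: U_def K_def PiE_iff)
    ultimately obtain j where j: "j \<in> I" "(i, j) \<in> D" "f j \<in> U"
      using \<phi>(2)[OF \<open>i \<in> I\<close>] unfolding C_def in_closure_of by blast
    have "cmod (f j x - \<phi> x) < e" if "x \<in> X \<inter> carrier E" for x
    proof -
      have "f j x \<in> ball (\<phi> x) e" using j(3) that by (auto simp: U_def PiE_iff)
      then show ?thesis by (simp add: dist_norm norm_minus_commute)
    qed
    then show ?thesis using j by blast
  qed
  obtain i0 where i0: "i0 \<in> I" using directed_setD(1)[OF D] by blast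
  have "\<phi> \<in> carrier (dual E)"
    unfolding dual_def
  proof (rule EC.bounded_opsI)
    show "\<phi> \<in> extensional (carrier E)" using \<phi>(1) by (auto simp: K_def PiE_def)
    show "nrm complex_space (\<phi> x) \<le> M * nrm E x" if "x \<in> carrier E" for x
      using \<phi>(1) that by (auto simp: K_def PiE_iff)
    show "linear_map E complex_space \<phi>"
    proof (rule linear_mapI)
      fix x y assume x: "x \<in> carrier E" and y: "y \<in> carrier E"
      have "cmod (\<phi> (x \<oplus>\<^bsub>E\<^esub> y) - (\<phi> x + \<phi> y)) \<le> e" if e: "e > 0" for e
      proof -
        \<comment> \<open>A single index serves all three points at once, which lets the additivity
          of \<open>f j\<close> pass to \<open>\<phi>\<close>.\<close>
        obtain j where j: "j \<in> I" "\<forall>z\<in>{x, y, x \<oplus>\<^bsub>E\<^esub> y} \<inter> carrier E. cmod (f j z - \<phi> z) < e / 3"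
          using approx[of "{x, y, x \<oplus>\<^bsub>E\<^esub> y}" "e/3" i0] i0 e by auto
        then have "cmod (f j x - \<phi> x) < e/3" "cmod (f j y - \<phi> y) < e/3"
          "cmod (f j x + f j y - \<phi> (x \<oplus>\<^bsub>E\<^esub> y)) < e/3"
          using x y EC.bounded_opsD(2)[of "f j" x y] f(1)[OF j(1)] by (auto simp: dual_def)
        moreover have "cmod (\<phi> (x \<oplus>\<^bsub>E\<^esub> y) - (\<phi> x + \<phi> y)) =
            cmod ((f j x - \<phi> x) + (f j y - \<phi> y) - (f j x + f j y - \<phi> (x \<oplus>\<^bsub>E\<^esub> y)))"
          by (rule arg_cong[of _ _ cmod]) simp
        ultimately show ?thesis
          using norm_triangle_ineq4[of "(f j x - \<phi> x) + (f j y - \<phi> y)" "f j x + f j y - \<phi> (x \<oplus>\<^bsub>E\<^esub> y)"]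
            norm_triangle_ineq[of "f j x - \<phi> x" "f j y - \<phi> y"] by linarith
      qed
      then have "cmod (\<phi> (x \<oplus>\<^bsub>E\<^esub> y) - (\<phi> x + \<phi> y)) \<le> 0" by (rule field_le_epsilon[where y = 0, simplified])
      then show "\<phi> (x \<oplus>\<^bsub>E\<^esub> y) = \<phi> x \<oplus>\<^bsub>complex_space\<^esub> \<phi> y" by simp
    next
      fix c x assume x: "x \<in> carrier E"
      have "cmod (\<phi> (c \<odot>\<^bsub>E\<^esub> x) - c * \<phi> x) \<le> e" if "e > 0" for e
      proof -
        define d where "d = e / (cmod c + 1)"
        have d: "d > 0" "d * (cmod c + 1) = e"
          using that add_nonneg_pos[OF norm_ge_zero[of c] zero_less_one] by (simp_all add: d_def)
        obtain j where j: "j \<in> I" "\<forall>z\<in>{x, c \<odot>\<^bsub>E\<^esub> x} \<inter> carrier E. cmod (f j z - \<phi> z) < d"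
          using approx[of "{x, c \<odot>\<^bsub>E\<^esub> x}" d i0] i0 d by auto
        then have "cmod (f j x - \<phi> x) < d" "cmod (c * f j x - \<phi> (c \<odot>\<^bsub>E\<^esub> x)) < d"
          using x EC.bounded_opsD(3)[of "f j" x c] f(1)[OF j(1)] by (auto simp: dual_def)
        then have "cmod (c * (f j x - \<phi> x)) \<le> cmod c * d" "cmod (c * f j x - \<phi> (c \<odot>\<^bsub>E\<^esub> x)) < d"
          by (auto simp: norm_mult intro!: mult_left_mono)
        moreover have "cmod (\<phi> (c \<odot>\<^bsub>E\<^esub> x) - c * \<phi> x) =
            cmod (c * (f j x - \<phi> x) - (c * f j x - \<phi> (c \<odot>\<^bsub>E\<^esub> x)))"
          by (rule arg_cong[of _ _ cmod]) (simp add: algebra_simps)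
        ultimately have "cmod (\<phi> (c \<odot>\<^bsub>E\<^esub> x) - c * \<phi> x) \<le> cmod c * d + d"
          using norm_triangle_ineq4[of "c * (f j x - \<phi> x)" "c * f j x - \<phi> (c \<odot>\<^bsub>E\<^esub> x)"] by linarith
        then show ?thesis using d(2) by (simp add: algebra_simps)
      qed
      then have "cmod (\<phi> (c \<odot>\<^bsub>E\<^esub> x) - c * \<phi> x) \<le> 0" by (rule field_le_epsilon[where y = 0, simplified])
      then show "\<phi> (c \<odot>\<^bsub>E\<^esub> x) = c \<odot>\<^bsub>complex_space\<^esub> \<phi> x" by simp
    qed simp
  qed
  then show ?thesis using approx by blast
qed

context locally_convex_algebra
begin

lemma topspace_lctop: "topspace (lctop B) = carrier B"
  by (rule locally_convex_topspace[OF locally_convex])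

text \<open>The preimage of the open unit ball is a neighbourhood of zero; the factor
  \<open>\<kappa>\<close> by which it absorbs \<open>S\<close> is a norm bound on the image.\<close>

lemma continuous_linear_bounded_image:
  assumes S: "bounded_subset S" and E: "complex_normed_space E" and f: "continuous_linear E f"
  shows "\<exists>M. \<forall>s\<in>S. nrm E (f s) \<le> M"
proof -
  interpret E: complex_normed_space E by fact
  have lin: "linear_map B E f" using f by (simp add: continuous_linear_def)
  define U where "U = {a \<in> carrier B. nrm E (f a) < 1}"
  have "openin (lctop B) {a \<in> topspace (lctop B). f a \<in> {y \<in> carrier E. nrm E y < 1}}"
    using f E.openin_zero_ball[of 1] unfolding continuous_linear_def continuous_map_def by blast
  moreover have "{a \<in> topspace (lctop B). f a \<in> {y \<in> carrier E. nrm E y < 1}} = U"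
    using linear_mapD(1)[OF lin] by (auto simp: U_def topspace_lctop)
  ultimately have "openin (lctop B) U" by simp
  moreover have "\<zero> \<in> U"
    using linear_map_zero[OF module_axioms E.module_axioms lin] by (simp add: U_def)
  moreover have "U \<subseteq> carrier B" by (auto simp: U_def)
  ultimately obtain \<kappa> :: real where \<kappa>: "\<kappa> > 0" "S \<subseteq> (\<lambda>v. complex_of_real \<kappa> \<odot> v) ` U"
    using S unfolding bounded_subset_def by blast
  have "nrm E (f s) \<le> \<kappa>" if s: "s \<in> S" for s
  proof -
    obtain v where v: "v \<in> carrier B" "nrm E (f v) < 1" "s = complex_of_real \<kappa> \<odot> v"
      using \<kappa> s by (auto simp: U_def)
    then have "nrm E (f s) = \<kappa> * nrm E (f v)"
      using linear_mapD[OF lin] \<kappa> by (simp add: E.nrm_smult)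
    then show ?thesis using v \<kappa> by simp
  qed
  then show ?thesis by blast
qed

text \<open>The identity \<open>\<Xi> (a \<otimes> h j) x = \<Xi> (h j) (\<Phi> a x)\<close> is read
  from both sides: the left tends to \<open>\<Xi> a x\<close> by continuity, the right has the
  cluster value \<open>\<phi> (\<Phi> a x)\<close>. Boundedness of the approximate identity puts all
  \<open>\<Xi> (h j)\<close> into one ball of the dual, so that a cluster point exists.\<close>

theorem bounded_approximate_identity_imp_CB:
  assumes "has_bounded_approximate_identity TYPE('i)"
  shows "property_CB TYPE('e)"
  unfolding property_CB_def
proof (intro allI impI)
  fix E :: "'e normed_module" and \<Phi> \<Xi>
  assume E: "nonzero_banach_space E" and \<Phi>: "continuous_anti_representation E \<Phi>"
    and \<Xi>: "continuous_linear (dual E) \<Xi>"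
    and eq: "\<forall>a\<in>carrier B. \<forall>b\<in>carrier B. \<Xi> (a \<otimes> b) = adjoint E (\<Phi> a) (\<Xi> b)"
  interpret E: nonzero_banach_space E by fact
  note En = E.complex_normed_space_axioms
  interpret dual: complex_normed_space "dual E" by (rule complex_normed_space_dual[OF En])
  interpret EE: normed_space_pair E E using En by (simp add: normed_space_pair_def)
  obtain I :: "'i set" and D h where h: "approximate_identity I D h" "bounded_subset (h ` I)"
    using assms unfolding has_bounded_approximate_identity_def by blast
  have D: "directed_set I D" and hB: "\<And>i. i \<in> I \<Longrightarrow> h i \<in> carrier B"
    using h by (auto simp: approximate_identity_def)
  have \<Xi>l: "\<And>a. a \<in> carrier B \<Longrightarrow> \<Xi> a \<in> carrier (dual E)"
    using \<Xi> by (auto simp: continuous_linear_def dest: linear_mapD)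
  have \<Phi>l: "\<And>a. a \<in> carrier B \<Longrightarrow> \<Phi> a \<in> carrier (bounded_ops E E)"
    using \<Phi> by (auto simp: continuous_anti_representation_def continuous_linear_def dest: linear_mapD)
  obtain M where M: "\<And>i. i \<in> I \<Longrightarrow> nrm (dual E) (\<Xi> (h i)) \<le> M"
    using continuous_linear_bounded_image[OF h(2) dual.complex_normed_space_axioms \<Xi>] by auto
  obtain \<phi> where \<phi>: "\<phi> \<in> carrier (dual E)"
    and approx: "\<And>X e i. finite X \<Longrightarrow> e > 0 \<Longrightarrow> i \<in> I \<Longrightarrow>
       \<exists>j\<in>I. (i, j) \<in> D \<and> (\<forall>x\<in>X \<inter> carrier E. cmod (\<Xi> (h j) x - \<phi> x) < e)"
    using dual_net_cluster_point[OF En D, of "\<lambda>i. \<Xi> (h i)" M] hB \<Xi>l M by blast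
  have "\<Xi> a = adjoint E (\<Phi> a) \<phi>" if a: "a \<in> carrier B" for a
  proof (rule extensionalityI[of _ "carrier E"])
    show "\<Xi> a \<in> extensional (carrier E)" using \<Xi>l[OF a] by (simp add: dual_def mem_bounded_ops)
    show "adjoint E (\<Phi> a) \<phi> \<in> extensional (carrier E)" by (simp add: adjoint_def compose_def)
    fix x assume x: "x \<in> carrier E"
    define y where "y = \<Phi> a x"
    have y: "y \<in> carrier E" using EE.bounded_opsD(1)[OF \<Phi>l[OF a] x] by (simp add: y_def)
    have lim: "limitin (norm_topology (dual E)) (\<lambda>i. \<Xi> (a \<otimes> h i)) (\<Xi> a) (tails I D)"
      using continuous_map_limit[of "lctop B" "norm_topology (dual E)" \<Xi> "\<lambda>i. a \<otimes> h i" a "tails I D"] \<Xi> h(1) a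
      by (simp add: continuous_linear_def approximate_identity_def o_def)
    have "cmod (\<Xi> a x - \<phi> y) \<le> e" if "e > 0" for e
    proof -
      \<comment> \<open>The norm convergence costs d times the norm of x, the cluster point costs d;
        together they make e.\<close>
      define d where "d = e / (nrm E x + 1)"
      have d: "d > 0" "d * (nrm E x + 1) = e"
        using that add_nonneg_pos[OF E.nrm_nonneg[OF x] zero_less_one] by (simp_all add: d_def)
      obtain i where i: "i \<in> I" "\<And>j. j \<in> I \<Longrightarrow> (i, j) \<in> D \<Longrightarrow> nrm (dual E) (\<Xi> (a \<otimes> h j) \<ominus>\<^bsub>dual E\<^esub> \<Xi> a) < d"
        using lim d(1) unfolding dual.limitin_norm_topology eventually_tails[OF D] by blast
      obtain j where j: "j \<in> I" "(i, j) \<in> D" "cmod (\<Xi> (h j) y - \<phi> y) < d"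
        using approx[of "{y}" d i] d i y by auto
      have "\<Xi> (a \<otimes> h j) x = \<Xi> (h j) y"
        using eq a hB[OF j(1)] x by (simp add: adjoint_def compose_def y_def)
      then have "cmod (\<Xi> (h j) y - \<Xi> a x) = cmod ((\<Xi> (a \<otimes> h j) \<ominus>\<^bsub>dual E\<^esub> \<Xi> a) x)"
        using dual_diff_apply[OF En _ _ x] \<Xi>l a mult_closed[OF a hB[OF j(1)]] by simp
      also have "\<dots> \<le> nrm (dual E) (\<Xi> (a \<otimes> h j) \<ominus>\<^bsub>dual E\<^esub> \<Xi> a) * nrm E x"
        using \<Xi>l a mult_closed[OF a hB[OF j(1)]] x by (intro dual_bound[OF En]) auto
      also have "\<dots> \<le> d * nrm E x"
        using i(2)[OF j(1,2)] E.nrm_nonneg[OF x] by (intro mult_right_mono) auto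
      finally have "cmod (\<Xi> (h j) y - \<Xi> a x) \<le> d * nrm E x" .
      then have "cmod (\<Xi> a x - \<phi> y) \<le> d * nrm E x + d"
        using j(3) norm_triangle_ineq4[of "\<Xi> (h j) y - \<phi> y" "\<Xi> (h j) y - \<Xi> a x"] by simp
      then show ?thesis using d(2) by (simp add: algebra_simps)
    qed
    then have "cmod (\<Xi> a x - \<phi> y) \<le> 0" by (rule field_le_epsilon[where y = 0, simplified])
    then show "\<Xi> a x = adjoint E (\<Phi> a) \<phi> x" using x by (simp add: adjoint_def compose_def y_def)
  qed
  then show "\<exists>\<phi>\<in>carrier (dual E). \<forall>a\<in>carrier B. \<Xi> a = adjoint E (\<Phi> a) \<phi>"
    using \<phi> by blast
qed

end

text \<open>On the kernel of \<open>\<omega>\<close> the summand with \<open>\<omega> b\<close>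
  drops out of the derivation identity, leaving the hypothesis of (CB). Every a splits into a kernel
  element and \<omega>(a)e, whence \<open>\<theta> a x = \<phi>\<^sub>0 (\<Phi> a x) + \<omega> a *
  \<psi> x\<close> on all of \<open>B\<close>. The derivation identity for the product of a and e
  then shows that \<open>\<phi>\<^sub>0\<close> agrees with -\<psi> on the range of
  \<open>\<Phi> a\<close>.\<close>

theorem (in continuous_character) CB_kernel_imp_amenable:
  fixes B\<^sub>0 :: "'a lc_algebra"
  assumes "locally_convex_algebra B\<^sub>0"
    and carrier: "carrier B\<^sub>0 = {a \<in> carrier B. \<omega> a = 0}"
    and ops: "add B\<^sub>0 = add B" "smult B\<^sub>0 = smult B" "mult B\<^sub>0 = mult B"
    and top: "lctop B\<^sub>0 = subtopology (lctop B) (carrier B\<^sub>0)"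
    and CB: "locally_convex_algebra.property_CB B\<^sub>0 TYPE('e)"
  shows "amenable TYPE('e)"
  unfolding amenable_def
proof (intro allI impI)
  fix E :: "'e normed_module" and \<Phi> \<theta>
  assume E: "nonzero_banach_space E" and \<Phi>: "continuous_anti_representation E \<Phi>"
    and \<theta>: "continuous_linear (dual E) \<theta>"
    and eq: "\<forall>a\<in>carrier B. \<forall>b\<in>carrier B.
           \<theta> (a \<otimes> b) = adjoint E (\<Phi> a) (\<theta> b) \<oplus>\<^bsub>dual E\<^esub> (\<omega> b \<odot>\<^bsub>dual E\<^esub> \<theta> a)"
  interpret B\<^sub>0: locally_convex_algebra B\<^sub>0 by fact
  interpret E: nonzero_banach_space E by fact
  note En = E.complex_normed_space_axioms
  interpret dual: complex_normed_space "dual E" by (rule complex_normed_space_dual[OF En])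
  interpret EE: normed_space_pair E E using En by (simp add: normed_space_pair_def)
  have B\<^sub>0D: "a \<in> carrier B" "\<omega> a = 0" if "a \<in> carrier B\<^sub>0" for a using that by (auto simp: carrier)
  have restrict: "B\<^sub>0.continuous_linear F f" if "continuous_linear F f" for F :: "'z normed_module" and f
    using that continuous_map_from_subtopology
    by (auto simp: continuous_linear_def B\<^sub>0.continuous_linear_def top linear_map_def ops B\<^sub>0D)
  have restrict_rep: "B\<^sub>0.continuous_anti_representation E \<Phi>"
    using \<Phi> restrict
    by (auto simp: continuous_anti_representation_def B\<^sub>0.continuous_anti_representation_def ops B\<^sub>0D
        continuous_linear_def B\<^sub>0.continuous_linear_def top linear_map_def continuous_map_from_subtopology)
  have \<theta>l: "linear_map B (dual E) \<theta>" using \<theta> by (simp add: continuous_linear_def)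
  note \<theta>D = linear_mapD[OF \<theta>l]
  have \<Phi>l: "linear_map B (bounded_ops E E) \<Phi>"
    using \<Phi> by (simp add: continuous_anti_representation_def continuous_linear_def)
  note \<Phi>D = linear_mapD[OF \<Phi>l]
  have \<omega>l: "linear_map B complex_space \<omega>"
    using character_continuous_linear by (simp add: continuous_linear_def)
  have "\<forall>a\<in>carrier B\<^sub>0. \<forall>b\<in>carrier B\<^sub>0. \<theta> (a \<otimes>\<^bsub>B\<^sub>0\<^esub> b) = adjoint E (\<Phi> a) (\<theta> b)"
  proof (intro ballI)
    fix a b assume a: "a \<in> carrier B\<^sub>0" and b: "b \<in> carrier B\<^sub>0"
    have "\<theta> (a \<otimes> b) = adjoint E (\<Phi> a) (\<theta> b) \<oplus>\<^bsub>dual E\<^esub> (0 \<odot>\<^bsub>dual E\<^esub> \<theta> a)"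
      using eq B\<^sub>0D[OF a] B\<^sub>0D[OF b] by simp
    also have "0 \<odot>\<^bsub>dual E\<^esub> \<theta> a = \<zero>\<^bsub>dual E\<^esub>"
      using dual.smult_l_null[of "\<theta> a"] \<theta>D(1)[OF B\<^sub>0D(1)[OF a]] by simp
    finally show "\<theta> (a \<otimes>\<^bsub>B\<^sub>0\<^esub> b) = adjoint E (\<Phi> a) (\<theta> b)"
      using adjoint_closed[OF En \<Phi>D(1) \<theta>D(1)] B\<^sub>0D(1)[OF a] B\<^sub>0D(1)[OF b] by (simp add: ops)
  qed
  then obtain \<phi>\<^sub>0 where \<phi>\<^sub>0: "\<phi>\<^sub>0 \<in> carrier (dual E)" "\<And>a. a \<in> carrier B\<^sub>0 \<Longrightarrow> \<theta> a = adjoint E (\<Phi> a) \<phi>\<^sub>0"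
    using CB E restrict_rep \<theta> continuous_map_from_subtopology
    unfolding B\<^sub>0.property_CB_def
    by (metis (no_types, lifting) restrict)
  obtain e' where e': "e' \<in> carrier B" "\<omega> e' \<noteq> 0" using character_nonzero by blast
  define e where "e = inverse (\<omega> e') \<odot> e'"
  have e: "e \<in> carrier B" "\<omega> e = 1"
    using e' linear_mapD(3)[OF \<omega>l] smult_closed by (auto simp: e_def)
  define \<psi> where "\<psi> = \<theta> e \<ominus>\<^bsub>dual E\<^esub> adjoint E (\<Phi> e) \<phi>\<^sub>0"
  have \<psi>: "\<psi> \<in> carrier (dual E)"
    unfolding \<psi>_def using \<theta>D(1)[OF e(1)] adjoint_closed[OF En \<Phi>D(1)[OF e(1)] \<phi>\<^sub>0(1)] by simp
  have dual_apply: "(S \<oplus>\<^bsub>dual E\<^esub> T) x = S x + T x" "(c \<odot>\<^bsub>dual E\<^esub> T) x = c * T x" "adjoint E A T x = T (A x)"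
    if "x \<in> carrier E" for S T A c x
    using that by (auto simp: dual_def adjoint_def compose_def)
  have dual_lin: "T (x \<oplus>\<^bsub>E\<^esub> y) = T x + T y" "T (c \<odot>\<^bsub>E\<^esub> x) = c * T x"
    if "T \<in> carrier (dual E)" "x \<in> carrier E" "y \<in> carrier E" for T x y c
    using that by (auto simp: dual_def mem_bounded_ops dest: linear_mapD)
  have \<psi>_apply: "\<psi> x = \<theta> e x - \<phi>\<^sub>0 (\<Phi> e x)" if "x \<in> carrier E" for x
    using dual_diff_apply[OF En \<theta>D(1)[OF e(1)] adjoint_closed[OF En \<Phi>D(1)[OF e(1)] \<phi>\<^sub>0(1)] that] dual_apply(3)[OF that]
    by (simp add: \<psi>_def)
  have \<theta>_apply: "\<theta> a x = \<phi>\<^sub>0 (\<Phi> a x) + \<omega> a * \<psi> x" if a: "a \<in> carrier B" and x: "x \<in> carrier E" for a x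
  proof -
    \<comment> \<open>The projection of a to the kernel of \<open>\<omega>\<close> along e.\<close>
    define b where "b = a \<oplus> (- \<omega> a) \<odot> e"
    have ce: "(- \<omega> a) \<odot> e \<in> carrier B" using e smult_closed by simp
    have "b \<in> carrier B\<^sub>0"
      using linear_mapD[OF \<omega>l] a e ce by (auto simp: b_def carrier)
    then have "\<theta> b x = \<phi>\<^sub>0 (\<Phi> b x)" using \<phi>\<^sub>0(2) dual_apply(3)[OF x] by simp
    moreover have "\<theta> b x = \<theta> a x - \<omega> a * \<theta> e x"
      using \<theta>D(2)[OF a ce] \<theta>D(3)[OF e(1)] x by (simp add: b_def dual_apply)
    moreover have "\<Phi> b x = \<Phi> a x \<oplus>\<^bsub>E\<^esub> (- \<omega> a) \<odot>\<^bsub>E\<^esub> \<Phi> e x"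
      using \<Phi>D(2)[OF a ce] \<Phi>D(3)[OF e(1)] x by (simp add: b_def)
    moreover have "\<phi>\<^sub>0 (\<Phi> a x \<oplus>\<^bsub>E\<^esub> (- \<omega> a) \<odot>\<^bsub>E\<^esub> \<Phi> e x) = \<phi>\<^sub>0 (\<Phi> a x) - \<omega> a * \<phi>\<^sub>0 (\<Phi> e x)"
      using dual_lin[OF \<phi>\<^sub>0(1)] EE.bounded_opsD(1)[OF \<Phi>D(1)[OF a] x] EE.bounded_opsD(1)[OF \<Phi>D(1)[OF e(1)] x]
      by simp
    ultimately show ?thesis unfolding \<psi>_apply[OF x] by (simp add: algebra_simps)
  qed
  \<comment> \<open>\<open>\<theta> (a \<otimes> e)\<close> at x is computed once by the derivation
    identity, with \<omega>(e) = 1, and once by \<open>\<theta>_apply\<close>; comparing the results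
    gives the claim.\<close>
  have vanish: "\<phi>\<^sub>0 (\<Phi> a x) = - \<psi> (\<Phi> a x)" if a: "a \<in> carrier B" and x: "x \<in> carrier E" for a x
  proof -
    have ax: "\<Phi> a x \<in> carrier E" using EE.bounded_opsD(1)[OF \<Phi>D(1)[OF a] x] .
    have "\<theta> (a \<otimes> e) x = \<theta> e (\<Phi> a x) + \<theta> a x"
      using eq a e x by (simp add: dual_apply)
    moreover have "\<Phi> (a \<otimes> e) x = \<Phi> e (\<Phi> a x)"
      using \<Phi> a e x by (simp add: continuous_anti_representation_def compose_def)
    ultimately show ?thesis
      using \<theta>_apply[OF mult_closed[OF a e(1)] x] \<theta>_apply[OF e(1) ax] \<theta>_apply[OF a x] character_mult[OF a e(1)] e(2)
      by (simp add: algebra_simps add_eq_0_iff)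
  qed
  have "\<theta> a = (\<omega> a \<odot>\<^bsub>dual E\<^esub> \<psi>) \<ominus>\<^bsub>dual E\<^esub> adjoint E (\<Phi> a) \<psi>" if a: "a \<in> carrier B" for a
  proof (rule extensionalityI[of _ "carrier E"])
    have cl: "\<omega> a \<odot>\<^bsub>dual E\<^esub> \<psi> \<in> carrier (dual E)" "adjoint E (\<Phi> a) \<psi> \<in> carrier (dual E)"
      using \<psi> adjoint_closed[OF En \<Phi>D(1)[OF a] \<psi>] by auto
    show "\<theta> a \<in> extensional (carrier E)"
      using \<theta>D(1)[OF a] by (simp add: dual_def mem_bounded_ops)
    show "(\<omega> a \<odot>\<^bsub>dual E\<^esub> \<psi>) \<ominus>\<^bsub>dual E\<^esub> adjoint E (\<Phi> a) \<psi> \<in> extensional (carrier E)"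
      using dual.minus_closed[OF cl] by (simp add: dual_def mem_bounded_ops)
    fix x assume x: "x \<in> carrier E"
    show "\<theta> a x = ((\<omega> a \<odot>\<^bsub>dual E\<^esub> \<psi>) \<ominus>\<^bsub>dual E\<^esub> adjoint E (\<Phi> a) \<psi>) x"
      using dual_diff_apply[OF En cl x] \<theta>_apply[OF a x] vanish[OF a x] by (simp add: dual_apply[OF x])
  qed
  then show "\<exists>\<phi>\<in>carrier (dual E). \<forall>a\<in>carrier B.
           \<theta> a = (\<omega> a \<odot>\<^bsub>dual E\<^esub> \<phi>) \<ominus>\<^bsub>dual E\<^esub> adjoint E (\<Phi> a) \<phi>"
    using \<psi> by blast
qed


section \<open>Haar integrals of continuous functions with compact support\<close>

text \<open>Confining the error to a set \<open>K\<close> of finite measure makes uniform estimates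
  usable although the whole space may have infinite measure.\<close>

lemma norm_integral_diff_le:
  fixes f g :: "'a \<Rightarrow> 'b::{banach, second_countable_topology}"
  assumes f: "integrable M f" and g: "integrable M g" and K: "K \<in> sets M" "emeasure M K < \<infinity>"
    and le: "\<And>x. norm (f x - g x) \<le> e * indicator K x"
  shows "norm ((\<integral>x. f x \<partial>M) - (\<integral>x. g x \<partial>M)) \<le> e * measure M K"
proof -
  have "norm ((\<integral>x. f x \<partial>M) - (\<integral>x. g x \<partial>M)) = norm (\<integral>x. f x - g x \<partial>M)"
    using f g by simp
  also have "\<dots> \<le> (\<integral>x. norm (f x - g x) \<partial>M)" by (rule integral_norm_bound)
  also have "\<dots> \<le> (\<integral>x. e * indicator K x \<partial>M)"
    using f g K le by (intro integral_mono) auto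
  also have "\<dots> = e * measure M K"
    using K sets.sets_into_space[OF K(1)] by (simp add: Int_absorb2)
  finally show ?thesis .
qed

section \<open>Continuous functions with compact support\<close>

lemma closure_nonzero_subset:
  fixes f :: "'a::t2_space \<Rightarrow> 'b::zero"
  assumes "compact K" "\<And>t. t \<notin> K \<Longrightarrow> f t = 0"
  shows "closure {t. f t \<noteq> 0} \<subseteq> K"
  using assms by (intro closure_minimal compact_imp_closed) auto

lemma supp_outside: "t \<notin> supp f \<Longrightarrow> f t = 0"
  unfolding supp_def using closure_subset[of "{t. f t \<noteq> 0}"] by blast

lemma closed_supp: "closed (supp f)"
  by (simp add: supp_def)

lemma supp_subset:
  fixes f :: "'a::t2_space \<Rightarrow> complex"
  assumes "compact K" "\<And>t. t \<notin> K \<Longrightarrow> f t = 0"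
  shows "supp f \<subseteq> K"
  unfolding supp_def using closure_nonzero_subset[OF assms] .

text \<open>In a Hausdorff space a compact \<open>K\<close> is closed, so it contains the support,
  which need not be computed.\<close>

lemma CcI:
  fixes f :: "'a::t2_space \<Rightarrow> complex"
  assumes "continuous_on UNIV f" "compact K" "\<And>t. t \<notin> K \<Longrightarrow> f t = 0"
  shows "f \<in> Cc"
  using assms(1) compact_Int_closed[OF assms(2) closed_supp[of f]] supp_subset[OF assms(2,3)]
  by (simp add: Cc_def Int_absorb1)

lemma CcD:
  assumes "f \<in> Cc"
  shows "continuous_on UNIV f" "compact (supp f)"
  using assms by (auto simp: Cc_def)

lemma CK_iff:
  fixes f :: "'a::t2_space \<Rightarrow> complex"
  assumes "compact K"
  shows "f \<in> CK K \<longleftrightarrow> continuous_on UNIV f \<and> (\<forall>t. t \<notin> K \<longrightarrow> f t = 0)"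
  using assms supp_subset[of K f] supp_outside[of _ f] CcI[of f K] unfolding CK_def by (auto dest: CcD)

lemma CK_subset_Cc: "CK K \<subseteq> Cc"
  by (auto simp: CK_def)

lemma mem_CK_supp: "f \<in> Cc \<Longrightarrow> f \<in> CK (supp f)"
  by (simp add: CK_def)

lemma CK_mono: "K \<subseteq> L \<Longrightarrow> f \<in> CK K \<Longrightarrow> f \<in> CK L"
  by (auto simp: CK_def)

lemma Cc_zero: "(\<lambda>t. 0) \<in> Cc"
  by (simp add: Cc_def supp_def)

lemma Cc_add:
  fixes f g :: "'a::t2_space \<Rightarrow> complex"
  assumes "f \<in> Cc" "g \<in> Cc"
  shows "(\<lambda>t. f t + g t) \<in> Cc"
  using CcD[OF assms(1)] CcD[OF assms(2)]
  by (intro CcI[of _ "supp f \<union> supp g"] continuous_intros compact_Un) (auto simp: supp_outside)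

lemma Cc_smult:
  fixes f :: "'a::t2_space \<Rightarrow> complex"
  assumes "f \<in> Cc"
  shows "(\<lambda>t. c * f t) \<in> Cc"
  using CcD[OF assms] by (intro CcI[of _ "supp f"] continuous_intros) (auto dest: supp_outside)

lemma continuous_on_group_uminus [continuous_intros]:
  fixes f :: "'b::topological_space \<Rightarrow> 'a::topological_group_add"
  assumes "continuous_on S f"
  shows "continuous_on S (\<lambda>x. - f x)"
  using assms by (auto simp: continuous_on_def intro: tendsto_minus)

lemma compact_group_sums:
  fixes A B :: "'a::topological_group_add set"
  assumes "compact A" "compact B"
  shows "compact {x + y | x y. x \<in> A \<and> y \<in> B}"
proof -
  have "compact ((\<lambda>(x, y). x + y) ` (A \<times> B))"
    by (intro compact_continuous_image compact_Times assms) (auto intro!: continuous_intros simp: case_prod_beta')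
  moreover have "(\<lambda>(x, y). x + y) ` (A \<times> B) = {x + y | x y. x \<in> A \<and> y \<in> B}" by auto
  ultimately show ?thesis by simp
qed

lemma compact_group_uminus:
  fixes A :: "'a::topological_group_add set"
  assumes "compact A"
  shows "compact (uminus ` A)"
  by (intro compact_continuous_image assms continuous_intros)

section \<open>Integration of continuous functions against Haar measure\<close>

locale haar =
  fixes \<mu> :: "'a::{topological_group_add, t2_space} measure"
  assumes locally_compact: "locally_compact_space (euclidean :: 'a topology)"
    and left_haar: "left_haar_measure \<mu>"
begin

lemma sets_haar [simp, measurable_cong]: "sets \<mu> = sets borel"
  using left_haar by (simp add: left_haar_measure_def radon_measure_def)

lemma space_haar [simp]: "space \<mu> = UNIV"
  using sets_eq_imp_space_eq[OF sets_haar] by simp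

lemma compact_sets [measurable]: "compact (K :: 'a set) \<Longrightarrow> K \<in> sets borel"
  by (intro borel_closed compact_imp_closed)

lemma emeasure_compact: "compact K \<Longrightarrow> emeasure \<mu> K < \<infinity>"
proof -
  have "\<forall>K. compact K \<longrightarrow> emeasure \<mu> K < \<infinity>"
    using left_haar unfolding left_haar_measure_def radon_measure_def by satx
  then show "compact K \<Longrightarrow> emeasure \<mu> K < \<infinity>" by simp
qed

lemma emeasure_left_translate: "A \<in> sets borel \<Longrightarrow> emeasure \<mu> ((\<lambda>t. g + t) ` A) = emeasure \<mu> A"
proof -
  have "\<forall>g. \<forall>A\<in>sets borel. emeasure \<mu> ((\<lambda>t. g + t) ` A) = emeasure \<mu> A"
    using left_haar unfolding left_haar_measure_def by satx
  then show "A \<in> sets borel \<Longrightarrow> emeasure \<mu> ((\<lambda>t. g + t) ` A) = emeasure \<mu> A" by simp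
qed

lemma emeasure_UNIV_inner: "emeasure \<mu> UNIV = (SUP K\<in>{K. compact K \<and> K \<subseteq> UNIV}. emeasure \<mu> K)"
proof -
  have "\<forall>U. open U \<longrightarrow> emeasure \<mu> U = (SUP K\<in>{K. compact K \<and> K \<subseteq> U}. emeasure \<mu> K)"
    using left_haar unfolding left_haar_measure_def radon_measure_def by satx
  from this[rule_format, OF open_UNIV] show ?thesis .
qed

lemma measurable_continuous: "continuous_on UNIV f \<Longrightarrow> f \<in> borel_measurable \<mu>"
  by (simp add: measurable_cong_sets[OF sets_haar refl] borel_measurable_continuous_onI)

lemma integrable_continuous_compact:
  fixes f :: "'a \<Rightarrow> 'b::{banach, second_countable_topology}"
  assumes f: "continuous_on UNIV f" and K: "compact K" "\<And>t. t \<notin> K \<Longrightarrow> f t = 0"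
  shows "integrable \<mu> f"
proof -
  have "compact (f ` K)" using K f by (intro compact_continuous_image) (auto intro: continuous_on_subset)
  then obtain B where "\<And>t. t \<in> K \<Longrightarrow> norm (f t) \<le> B"
    using compact_imp_bounded[of "f ` K"] by (auto simp: bounded_iff)
  then show ?thesis
    using K emeasure_compact[OF K(1)] measurable_continuous[OF f] compact_sets[OF K(1)]
    by (intro integrableI_bounded_set[where A = K and B = B]) auto
qed

lemma integrable_Cc: "f \<in> Cc \<Longrightarrow> integrable \<mu> f"
  using integrable_continuous_compact[of f "supp f"] by (auto dest: CcD supp_outside)

lemma integrable_norm_Cc: "f \<in> Cc \<Longrightarrow> integrable \<mu> (\<lambda>t. cmod (f t))"
  using integrable_Cc by (rule integrable_norm)

text \<open>Continuity on a general topological space cannot be tested on sequences, which rules out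
  arguing by dominated convergence. The tube lemma replaces it: for t near t0 the integrand is close
  to its value at t0 uniformly for s in the compact set \<open>K\<close>.\<close>

lemma continuous_on_integral:
  fixes F :: "'a \<times> 'b::t2_space \<Rightarrow> 'c::{banach, second_countable_topology}"
  assumes F: "continuous_on UNIV F" and K: "compact K" "\<And>s t. s \<notin> K \<Longrightarrow> F (s, t) = 0"
  shows "continuous_on UNIV (\<lambda>t. \<integral>s. F (s, t) \<partial>\<mu>)"
proof (intro continuous_at_imp_continuous_on ballI)
  have cont: "continuous_on UNIV (\<lambda>s. F (s, t))" for t
    by (rule continuous_on_compose2[OF F]) (auto intro!: continuous_intros)
  have int: "integrable \<mu> (\<lambda>s. F (s, t))" for t
    by (rule integrable_continuous_compact[OF cont K(1)]) (use K(2) in auto)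
  fix t0 :: 'b
  show "isCont (\<lambda>t. \<integral>s. F (s, t) \<partial>\<mu>) t0"
    unfolding continuous_at
  proof (rule tendstoI)
    fix e :: real assume e: "e > 0"
    define d where "d = e / (measure \<mu> K + 1)"
    have d: "d > 0" "d * measure \<mu> K < e"
      using e measure_nonneg[of \<mu> K] by (auto simp: d_def add_nonneg_pos divide_simps intro!: divide_pos_pos)
    have "continuous_on UNIV (\<lambda>p. norm (F (snd p, fst p) - F (snd p, t0)))"
      by (intro continuous_on_norm continuous_on_diff continuous_on_compose2[OF F] continuous_intros) auto
    then have op: "open {p. norm (F (snd p, fst p) - F (snd p, t0)) < d}"
      by (intro open_Collect_less continuous_on_const)
    have sub: "{t0} \<times> K \<subseteq> {p. norm (F (snd p, fst p) - F (snd p, t0)) < d}" using d(1) by auto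
    obtain X where X: "t0 \<in> X" "open X"
      "X \<times> K \<subseteq> {p. norm (F (snd p, fst p) - F (snd p, t0)) < d}"
      using Elementary_Topology.tube_lemma[OF K(1) op sub] by (elim exE conjE)
    have "dist (\<integral>s. F (s, t) \<partial>\<mu>) (\<integral>s. F (s, t0) \<partial>\<mu>) < e" if t: "t \<in> X" for t
    proof -
      have "norm (F (s, t) - F (s, t0)) \<le> d * indicator K s" for s
        using X(3) t K(2)[of s] by (cases "s \<in> K") (auto simp: less_imp_le)
      then have "norm ((\<integral>s. F (s, t) \<partial>\<mu>) - (\<integral>s. F (s, t0) \<partial>\<mu>)) \<le> d * measure \<mu> K"
        using compact_sets[OF K(1)] emeasure_compact[OF K(1)] by (intro norm_integral_diff_le int) auto
      then show ?thesis using d by (simp add: dist_norm)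
    qed
    then show "\<forall>\<^sub>F t in at t0. dist (\<integral>s. F (s, t) \<partial>\<mu>) (\<integral>s. F (s, t0) \<partial>\<mu>) < e"
      using X(1,2) by (auto simp: eventually_at_topological)
  qed
qed

text \<open>
  The product \<open>\<sigma>\<close>-algebra need not contain the Borel sets of \<open>G \<times> G\<close>, and \<open>\<mu>\<close> need not be
  \<open>\<sigma>\<close>-finite, so Fubini's theorem is proved directly for continuous functions, by approximating
  them uniformly by functions that are step functions of the first variable.
\<close>

lemma integral_swap:
  fixes F :: "'a \<times> 'a \<Rightarrow> 'c::{banach, second_countable_topology}"
  assumes F: "continuous_on UNIV F" and K: "compact K" "\<And>s t. s \<notin> K \<Longrightarrow> F (s, t) = 0"
    and L: "compact L" "\<And>s t. t \<notin> L \<Longrightarrow> F (s, t) = 0"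
  shows "(\<integral>t. (\<integral>s. F (s, t) \<partial>\<mu>) \<partial>\<mu>) = (\<integral>s. (\<integral>t. F (s, t) \<partial>\<mu>) \<partial>\<mu>)"
proof -
  have cont1: "continuous_on UNIV (\<lambda>s. F (s, t))" for t
    by (rule continuous_on_compose2[OF F]) (auto intro!: continuous_intros)
  have cont2: "continuous_on UNIV (\<lambda>t. F (s, t))" for s
    by (rule continuous_on_compose2[OF F]) (auto intro!: continuous_intros)
  have int1: "integrable \<mu> (\<lambda>s. F (s, t))" for t
    by (rule integrable_continuous_compact[OF cont1 K(1)]) (use K(2) in auto)
  have int2: "integrable \<mu> (\<lambda>t. F (s, t))" for s
    by (rule integrable_continuous_compact[OF cont2 L(1)]) (use L(2) in auto)
  have int3: "integrable \<mu> (\<lambda>t. \<integral>s. F (s, t) \<partial>\<mu>)"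
  proof (rule integrable_continuous_compact[OF continuous_on_integral[OF F K] L(1)])
    show "(\<integral>s. F (s, t) \<partial>\<mu>) = 0" if "t \<notin> L" for t using L(2)[OF that] by simp
  qed
  have F': "continuous_on UNIV (\<lambda>p. F (snd p, fst p))"
    by (rule continuous_on_compose2[OF F]) (auto intro!: continuous_intros)
  have int4: "integrable \<mu> (\<lambda>s. \<integral>t. F (s, t) \<partial>\<mu>)"
  proof (rule integrable_continuous_compact[OF _ K(1)])
    show "continuous_on UNIV (\<lambda>s. \<integral>t. F (s, t) \<partial>\<mu>)"
      using continuous_on_integral[OF F' L(1)] L(2) by simp
    show "(\<integral>t. F (s, t) \<partial>\<mu>) = 0" if "s \<notin> K" for s using K(2)[OF that] by simp
  qed
  note Kf = compact_sets[OF K(1)] emeasure_compact[OF K(1)]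
  note Lf = compact_sets[OF L(1)] emeasure_compact[OF L(1)]
  have bound: "norm ((\<integral>t. (\<integral>s. F (s, t) \<partial>\<mu>) \<partial>\<mu>) - (\<integral>s. (\<integral>t. F (s, t) \<partial>\<mu>) \<partial>\<mu>)) \<le> d * (2 * measure \<mu> K * measure \<mu> L)"
    if d: "d > 0" for d :: real
  proof -
    \<comment> \<open>The tube lemma over the compact set \<open>L\<close>: for s' near s,
      \<open>F (s', t)\<close> is close to \<open>F (s, t)\<close> uniformly in t.\<close>
    have "\<exists>U. open U \<and> s \<in> U \<and> (\<forall>s'\<in>U. \<forall>t\<in>L. norm (F (s', t) - F (s, t)) < d)" for s
    proof -
      have "continuous_on UNIV (\<lambda>p. norm (F p - F (s, snd p)))"
        by (intro continuous_on_norm continuous_on_diff F continuous_on_compose2[OF F] continuous_intros) auto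
      then have op: "open {p. norm (F p - F (s, snd p)) < d}"
        by (intro open_Collect_less continuous_on_const)
      have sub: "{s} \<times> L \<subseteq> {p. norm (F p - F (s, snd p)) < d}" using d by auto
      obtain X where "s \<in> X" "open X" "X \<times> L \<subseteq> {p. norm (F p - F (s, snd p)) < d}"
        using Elementary_Topology.tube_lemma[OF L(1) op sub] by (elim exE conjE)
      then show ?thesis by fastforce
    qed
    then obtain U where U: "\<And>s. open (U s)" "\<And>s. s \<in> U s"
      "\<And>s s' t. s' \<in> U s \<Longrightarrow> t \<in> L \<Longrightarrow> norm (F (s', t) - F (s, t)) < d" by metis
    obtain C where C: "C \<subseteq> K" "finite C" "K \<subseteq> (\<Union>c\<in>C. U c)"
      using compactE_image[OF K(1), of K U] U(1,2) by blast
    obtain n and e :: "nat \<Rightarrow> 'a" where n: "C = e ` {i. i < n}"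
      using C(2) finite_imp_nat_seg_image_inj_on by metis
    \<comment> \<open>The finite cover of \<open>K\<close> made disjoint: \<open>A i\<close> holds
      the points of \<open>K\<close> whose first covering index is i.\<close>
    define A where "A i = K \<inter> (U (e i) - (\<Union>j<i. U (e j)))" for i
    have A_sets: "A i \<in> sets \<mu>" for i
      using Kf U(1) by (auto simp: A_def intro!: sets.Int sets.Diff sets.finite_UN)
    have A_finite: "emeasure \<mu> (A i) < \<infinity>" for i
    proof -
      have "emeasure \<mu> (A i) \<le> emeasure \<mu> K" using Kf by (intro emeasure_mono) (auto simp: A_def)
      then show ?thesis using Kf(2) by (rule le_less_trans)
    qed
    \<comment> \<open>A step function of s whose coefficients are continuous in t. Both of its
      iterated integrals are finite sums with the same value, \<open>I\<close> below.\<close>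
    define G where "G s t = (\<Sum>i<n. indicator (A i) s *\<^sub>R F (e i, t))" for s t
    have near: "norm (F (s, t) - G s t) \<le> d * indicator K s * indicator L t" for s t
    proof (cases "s \<in> K \<and> t \<in> L")
      case True
      then have "\<exists>i<n. s \<in> U (e i)" using C(3) n by auto
      define i where "i = (LEAST i. i < n \<and> s \<in> U (e i))"
      have i: "i < n" "s \<in> U (e i)"
        using LeastI_ex[OF \<open>\<exists>i<n. s \<in> U (e i)\<close>] by (auto simp: i_def)
      have min: "j \<ge> i" if "j < n" "s \<in> U (e j)" for j
        using that by (auto simp: i_def intro: Least_le)
      have mem: "s \<in> A j \<longleftrightarrow> j = i" if "j < n" for j
      proof -
        have "s \<in> A j \<longleftrightarrow> s \<in> U (e j) \<and> (\<forall>k<j. s \<notin> U (e k))" using True by (auto simp: A_def)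
        moreover have "s \<notin> U (e k)" if "k < i" for k using min[of k] that i(1) by linarith
        moreover have "j = i" if "s \<in> U (e j)" "\<forall>k<j. s \<notin> U (e k)"
          using min[OF \<open>j < n\<close> that(1)] that(2) i(2) le_neq_implies_less by blast
        ultimately show ?thesis using i(2) by blast
      qed
      have "G s t = (\<Sum>j<n. if j = i then F (e i, t) else 0)"
        unfolding G_def by (rule sum.cong) (auto simp: mem)
      then have "G s t = F (e i, t)" using i by simp
      then show ?thesis using U(3)[OF i(2), of t] True by simp
    next
      case False
      then have "F (s, t) = 0" using K(2) L(2) by blast
      moreover have "G s t = 0"
        using False L(2) unfolding G_def by (intro sum.neutral) (auto simp: A_def)
      ultimately show ?thesis using False by auto
    qed
    have G1: "has_bochner_integral \<mu> (\<lambda>s. G s t) (\<Sum>i<n. measure \<mu> (A i) *\<^sub>R F (e i, t))" for t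
      unfolding G_def by (intro has_bochner_integral_sum has_bochner_integral_indicator A_sets A_finite)
    have G2: "integrable \<mu> (G s)" "(\<integral>t. G s t \<partial>\<mu>) = (\<Sum>i<n. indicator (A i) s *\<^sub>R (\<integral>t. F (e i, t) \<partial>\<mu>))" for s
      unfolding G_def[abs_def] using int2 by (auto simp: Bochner_Integration.integral_sum)
    define I where "I = (\<Sum>i<n. measure \<mu> (A i) *\<^sub>R (\<integral>t. F (e i, t) \<partial>\<mu>))"
    have I1: "has_bochner_integral \<mu> (\<lambda>s. \<integral>t. G s t \<partial>\<mu>) I"
      unfolding G2(2) I_def by (intro has_bochner_integral_sum has_bochner_integral_indicator A_sets A_finite)
    have I2: "integrable \<mu> (\<lambda>t. \<integral>s. G s t \<partial>\<mu>)" "(\<integral>t. (\<integral>s. G s t \<partial>\<mu>) \<partial>\<mu>) = I"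
      unfolding has_bochner_integral_integral_eq[OF G1] I_def using int2
      by (auto simp: Bochner_Integration.integral_sum)
    have "norm ((\<integral>t. (\<integral>s. F (s, t) \<partial>\<mu>) \<partial>\<mu>) - I) \<le> (d * measure \<mu> K) * measure \<mu> L"
      unfolding I2(2)[symmetric]
    proof (rule norm_integral_diff_le[OF int3 I2(1)])
      fix t
      have "norm ((\<integral>s. F (s, t) \<partial>\<mu>) - (\<integral>s. G s t \<partial>\<mu>)) \<le> (d * indicator L t) * measure \<mu> K"
        using Kf near[of _ t] has_bochner_integral_iff[THEN iffD1, OF G1]
        by (intro norm_integral_diff_le int1) (auto simp: mult_ac)
      then show "norm ((\<integral>s. F (s, t) \<partial>\<mu>) - (\<integral>s. G s t \<partial>\<mu>)) \<le> d * measure \<mu> K * indicator L t"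
        by (simp add: mult_ac)
    qed (use Lf in auto)
    moreover have "norm ((\<integral>s. (\<integral>t. F (s, t) \<partial>\<mu>) \<partial>\<mu>) - I) \<le> (d * measure \<mu> L) * measure \<mu> K"
      unfolding has_bochner_integral_integral_eq[OF I1, symmetric]
    proof (rule norm_integral_diff_le[OF int4])
      fix s
      have "norm ((\<integral>t. F (s, t) \<partial>\<mu>) - (\<integral>t. G s t \<partial>\<mu>)) \<le> (d * indicator K s) * measure \<mu> L"
        using Lf near[of s] by (intro norm_integral_diff_le int2 G2(1)) auto
      then show "norm ((\<integral>t. F (s, t) \<partial>\<mu>) - (\<integral>t. G s t \<partial>\<mu>)) \<le> d * measure \<mu> L * indicator K s"
        by (simp add: mult_ac)
    qed (use Kf I1 in \<open>auto simp: has_bochner_integral_iff\<close>)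
    ultimately show ?thesis
      using norm_triangle_ineq4[of "(\<integral>t. (\<integral>s. F (s, t) \<partial>\<mu>) \<partial>\<mu>) - I" "(\<integral>s. (\<integral>t. F (s, t) \<partial>\<mu>) \<partial>\<mu>) - I"]
      by (simp add: algebra_simps)
  qed
  define c where "c = 2 * measure \<mu> K * measure \<mu> L"
  have c: "c \<ge> 0" by (simp add: c_def)
  have "norm ((\<integral>t. (\<integral>s. F (s, t) \<partial>\<mu>) \<partial>\<mu>) - (\<integral>s. (\<integral>t. F (s, t) \<partial>\<mu>) \<partial>\<mu>)) \<le> e" if "e > 0" for e
  proof -
    have "norm ((\<integral>t. (\<integral>s. F (s, t) \<partial>\<mu>) \<partial>\<mu>) - (\<integral>s. (\<integral>t. F (s, t) \<partial>\<mu>) \<partial>\<mu>)) \<le> e / (c + 1) * c"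
      unfolding c_def[symmetric] using bound[of "e / (c + 1)"] that c by (simp add: c_def[symmetric])
    also have "\<dots> \<le> e" using that c by (simp add: divide_simps mult_left_mono)
    finally show ?thesis .
  qed
  then have "norm ((\<integral>t. (\<integral>s. F (s, t) \<partial>\<mu>) \<partial>\<mu>) - (\<integral>s. (\<integral>t. F (s, t) \<partial>\<mu>) \<partial>\<mu>)) \<le> 0"
    by (rule field_le_epsilon[where y = 0, simplified])
  then show ?thesis by simp
qed

lemma distr_left_translate: "distr \<mu> borel (\<lambda>t. g + t) = \<mu>"
proof (rule measure_eqI)
  have meas: "(\<lambda>t. g + t) \<in> measurable \<mu> borel"
    by (intro measurable_continuous continuous_intros)
  fix A assume "A \<in> sets (distr \<mu> borel (\<lambda>t. g + t))"
  then have A: "A \<in> sets borel" by simp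
  have "(\<lambda>t. g + t) -` A \<inter> space \<mu> = (\<lambda>t. - g + t) ` A"
    by (auto simp: image_iff add.assoc[symmetric] intro!: bexI[of _ "g + t" for t])
  then show "emeasure (distr \<mu> borel (\<lambda>t. g + t)) A = emeasure \<mu> A"
    using emeasure_left_translate[OF A] by (simp add: emeasure_distr[OF meas A])
qed simp

lemma integral_left_translate:
  fixes f :: "'a \<Rightarrow> 'b::{banach, second_countable_topology}"
  assumes "continuous_on UNIV f"
  shows "(\<integral>t. f (g + t) \<partial>\<mu>) = (\<integral>t. f t \<partial>\<mu>)"
proof -
  have "(\<integral>t. f t \<partial>distr \<mu> borel (\<lambda>t. g + t)) = (\<integral>t. f (g + t) \<partial>\<mu>)"
    using assms by (intro integral_distr measurable_continuous borel_measurable_continuous_onI continuous_intros)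
  then show ?thesis by (simp add: distr_left_translate)
qed

text \<open>If \<open>U\<close> were null, finitely many of its translates would cover any given
  compact set, so every compact set would be null; inner regularity then forces the whole measure to
  vanish.\<close>

lemma emeasure_open_pos:
  assumes U: "open U" "U \<noteq> {}"
  shows "emeasure \<mu> U > 0"
proof (rule ccontr)
  assume "\<not> emeasure \<mu> U > 0"
  then have U0: "emeasure \<mu> U = 0" by (simp add: zero_less_iff_neq_zero)
  obtain u where u: "u \<in> U" using U(2) by blast
  have "emeasure \<mu> K = 0" if K: "compact K" for K
  proof -
    \<comment> \<open>Left translation by \<open>g k\<close> carries u to k.\<close>
    define g where "g k = k + - u" for k
    define V where "V k = (\<lambda>t. g k + t) ` U" for k
    have V_eq: "V k = (\<lambda>t. - g k + t) -` U" for k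
      by (auto simp: V_def image_iff intro!: bexI[of _ "- g k + t" for t])
    have V_open: "open (V k)" for k
      unfolding V_eq using U(1) by (intro open_vimage continuous_intros)
    have kV: "k \<in> V k" for k
      using u by (auto simp: V_def g_def image_iff intro!: bexI[of _ u])
    have V0: "emeasure \<mu> (V k) = 0" for k
      using emeasure_left_translate[OF borel_open[OF U(1)]] U0 by (simp add: V_def)
    obtain C where C: "C \<subseteq> K" "finite C" "K \<subseteq> (\<Union>c\<in>C. V c)"
      using compactE_image[OF K, of K V] V_open kV by blast
    have "emeasure \<mu> K \<le> emeasure \<mu> (\<Union>c\<in>C. V c)"
      using C V_open by (intro emeasure_mono) (auto intro!: borel_open)
    also have "\<dots> \<le> (\<Sum>c\<in>C. emeasure \<mu> (V c))"
      using C V_open by (intro emeasure_subadditive_finite) auto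
    finally show ?thesis by (simp add: V0)
  qed
  then have "(SUP K\<in>{K. compact K \<and> K \<subseteq> UNIV}. emeasure \<mu> K) \<le> 0" by (intro SUP_least) auto
  then have "emeasure \<mu> UNIV = 0" by (simp add: emeasure_UNIV_inner)
  then show False using left_haar unfolding left_haar_measure_def by satx
qed

text \<open>A positive value f(t) would make f exceed f(t)/2 on a nonempty open set, which has
  positive measure. This upgrades vanishing almost everywhere to vanishing everywhere and makes
  \<open>L1_norm\<close> definite on \<open>Cc\<close>.\<close>

lemma integral_nonneg_eq_0:
  fixes f :: "'a \<Rightarrow> real"
  assumes f: "continuous_on UNIV f" "\<And>t. 0 \<le> f t" and int: "integrable \<mu> f" and 0: "(\<integral>t. f t \<partial>\<mu>) = 0"
  shows "f t = 0"
proof (rule ccontr)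
  assume "f t \<noteq> 0"
  then have t: "f t > 0" using f(2)[of t] by simp
  define U where "U = {x. f x > f t / 2}"
  have U: "open U" unfolding U_def by (intro open_Collect_less continuous_on_const f)
  have "AE x in \<mu>. f x = 0" using integral_nonneg_eq_0_iff_AE[OF int] f(2) 0 by simp
  then have "AE x in \<mu>. x \<notin> U"
  proof eventually_elim
    case (elim x)
    then show ?case using t by (simp add: U_def)
  qed
  then have "emeasure \<mu> U = 0"
    using U by (subst (asm) AE_iff_measurable[of U]) auto
  moreover have "t \<in> U" using t by (simp add: U_def)
  ultimately show False using emeasure_open_pos[OF U] by auto
qed

section \<open>Cutoff functions and bumps\<close>

lemma completely_regular: "completely_regular_space (euclidean :: 'a topology)"
proof (rule locally_compact_regular_imp_completely_regular_space[OF locally_compact disjI1])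
  show "Hausdorff_space (euclidean :: 'a topology)"
    unfolding Hausdorff_space_def disjnt_def using hausdorff by auto
qed

lemma ex_cutoff:
  assumes "compact K" "open U" "K \<subseteq> U"
  shows "\<exists>f :: 'a \<Rightarrow> real. continuous_on UNIV f \<and> (\<forall>t. 0 \<le> f t \<and> f t \<le> 1) \<and>
    (\<forall>t\<in>K. f t = 1) \<and> (\<forall>t. t \<notin> U \<longrightarrow> f t = 0)"
proof -
  have "closedin euclidean (- U)" "compactin euclidean K" "disjnt (- U) K"
    using assms by (auto simp: disjnt_def)
  from Urysohn_completely_regular_closed_compact[OF zero_le_one completely_regular this]
  obtain f :: "'a \<Rightarrow> real" where f: "continuous_map euclidean (top_of_set {0..1}) f" "f ` K \<subseteq> {0}" "f ` (- U) \<subseteq> {1}"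
    by blast
  then have "continuous_on UNIV f" "\<forall>t. f t \<in> {0..1}"
    by (auto simp: continuous_map_in_subtopology Pi_iff)
  then show ?thesis
    using f(2,3) by (intro exI[of _ "\<lambda>t. 1 - f t"]) (auto intro!: continuous_intros)
qed

lemma ex_compact_neighbourhood:
  fixes K :: "'a set"
  assumes "compact K"
  shows "\<exists>U L. open U \<and> compact L \<and> K \<subseteq> U \<and> U \<subseteq> L"
proof -
  have "\<forall>x :: 'a. \<exists>p. open (fst p) \<and> compact (snd p) \<and> x \<in> fst p \<and> fst p \<subseteq> snd p"
    using locally_compact unfolding locally_compact_space_def by force
  from choice[OF this] obtain p :: "'a \<Rightarrow> 'a set \<times> 'a set"
    where p: "\<forall>x. open (fst (p x)) \<and> compact (snd (p x)) \<and> x \<in> fst (p x) \<and> fst (p x) \<subseteq> snd (p x)"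
    by (elim exE)
  define U L where "U x = fst (p x)" and "L x = snd (p x)" for x
  have UL: "open (U x)" "compact (L x)" "x \<in> U x" "U x \<subseteq> L x" for x
    using p by (auto simp: U_def L_def)
  obtain C where C: "C \<subseteq> K" "finite C" "K \<subseteq> (\<Union>c\<in>C. U c)"
    using compactE_image[OF assms, of K U] UL(1,3) by blast
  show ?thesis
  proof (intro exI conjI)
    show "open (\<Union>c\<in>C. U c)" "compact (\<Union>c\<in>C. L c)"
      using C(2) UL(1,2) by (auto intro!: compact_UN)
    show "K \<subseteq> (\<Union>c\<in>C. U c)" by (rule C(3))
    show "(\<Union>c\<in>C. U c) \<subseteq> (\<Union>c\<in>C. L c)" using UL(4) by (intro UN_mono) auto
  qed
qed

text \<open>A cutoff function divided by its integral, which is positive because nonempty open sets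
  have positive measure. Intersecting \<open>U\<close> with a relatively compact neighbourhood keeps
  the support compact.\<close>

lemma ex_bump:
  assumes U: "open U" "x \<in> U"
  shows "\<exists>u :: 'a \<Rightarrow> real. continuous_on UNIV u \<and> (\<forall>t. 0 \<le> u t) \<and> (\<forall>t. t \<notin> U \<longrightarrow> u t = 0) \<and>
     (\<lambda>t. complex_of_real (u t)) \<in> Cc \<and> integrable \<mu> u \<and> (\<integral>t. u t \<partial>\<mu>) = 1"
proof -
  obtain V L where V: "open V" "compact L" "x \<in> V" "V \<subseteq> L" using ex_compact_neighbourhood[of "{x}"] by auto
  have UV: "compact {x}" "open (U \<inter> V)" "{x} \<subseteq> U \<inter> V" using U V by auto
  obtain f :: "'a \<Rightarrow> real" where "continuous_on UNIV f" "\<forall>t. 0 \<le> f t \<and> f t \<le> 1" "\<forall>t\<in>{x}. f t = 1"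
    "\<forall>t. t \<notin> U \<inter> V \<longrightarrow> f t = 0" using ex_cutoff[OF UV] by (elim exE conjE)
  then have f: "continuous_on UNIV f" "\<And>t. 0 \<le> f t" "f x = 1" "\<And>t. t \<notin> U \<inter> V \<Longrightarrow> f t = 0"
    by auto
  have int: "integrable \<mu> f" using integrable_continuous_compact[OF f(1) V(2)] f(4) V(4) by blast
  define c where "c = (\<integral>t. f t \<partial>\<mu>)"
  have "c \<ge> 0" unfolding c_def using f(2) by simp
  moreover have "c \<noteq> 0" using integral_nonneg_eq_0[OF f(1,2) int, of x] f(3) by (auto simp: c_def)
  ultimately have c: "c > 0" by simp
  have "(\<lambda>t. complex_of_real (f t / c)) \<in> Cc"
    using f V c by (intro CcI[of _ L] continuous_intros) auto
  then show ?thesis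
    using f c int by (intro exI[of _ "\<lambda>t. f t / c"]) (auto intro!: continuous_intros simp: c_def)
qed

end


section \<open>Convolution\<close>

lemma L1_space_simps [simp]:
  "carrier (L1_space \<mu> S) = S" "zero (L1_space \<mu> S) = (\<lambda>t. 0)" "add (L1_space \<mu> S) = (\<lambda>f g t. f t + g t)"
  "smult (L1_space \<mu> S) = (\<lambda>c f t. c * f t)" "nrm (L1_space \<mu> S) = L1_norm \<mu>"
  by (simp_all add: L1_space_def)

lemma convolution_algebra_simps [simp]:
  "carrier (convolution_algebra \<mu> S \<tau>) = S" "zero (convolution_algebra \<mu> S \<tau>) = (\<lambda>t. 0)"
  "add (convolution_algebra \<mu> S \<tau>) = (\<lambda>f g t. f t + g t)"
  "smult (convolution_algebra \<mu> S \<tau>) = (\<lambda>c f t. c * f t)"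
  "mult (convolution_algebra \<mu> S \<tau>) = convolution \<mu>" "lctop (convolution_algebra \<mu> S \<tau>) = \<tau>"
  by (simp_all add: convolution_algebra_def)

lemma CK_zero: "(\<lambda>t. 0) \<in> CK K"
  by (simp add: CK_def Cc_zero) (simp add: supp_def)

lemma CK_add:
  fixes K :: "'a::t2_space set"
  shows "compact K \<Longrightarrow> f \<in> CK K \<Longrightarrow> g \<in> CK K \<Longrightarrow> (\<lambda>t. f t + g t) \<in> CK K"
  by (auto simp: CK_iff intro!: continuous_intros)

lemma CK_smult:
  fixes K :: "'a::t2_space set"
  shows "compact K \<Longrightarrow> f \<in> CK K \<Longrightarrow> (\<lambda>t. c * f t) \<in> CK K"
  by (auto simp: CK_iff intro!: continuous_intros)

context haar
begin

lemma continuous_convolution_integrand: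
  fixes f g :: "'a \<Rightarrow> complex"
  assumes "continuous_on UNIV f" "continuous_on UNIV g"
  shows "continuous_on UNIV (\<lambda>p. f (fst p) * g (- fst p + snd p))"
  by (intro continuous_on_mult continuous_on_compose2[OF assms(1)] continuous_on_compose2[OF assms(2)]
      continuous_intros) auto

lemma integrable_convolution_integrand:
  fixes f g :: "'a \<Rightarrow> complex"
  assumes "f \<in> Cc" "continuous_on UNIV g"
  shows "integrable \<mu> (\<lambda>s. f s * g (- s + t))"
proof (rule integrable_continuous_compact[OF _ CcD(2)[OF assms(1)]])
  show "continuous_on UNIV (\<lambda>s. f s * g (- s + t))"
    by (intro continuous_on_mult CcD[OF assms(1)] continuous_on_compose2[OF assms(2)] continuous_intros) auto
qed (simp add: supp_outside)

lemma convolution_CK: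
  assumes f: "f \<in> CK K" and g: "g \<in> CK L" and K: "compact K" and L: "compact L"
  shows "convolution \<mu> f g \<in> CK {x + y | x y. x \<in> K \<and> y \<in> L}"
  unfolding CK_iff[OF compact_group_sums[OF K L]]
proof (intro conjI allI impI)
  have fc: "continuous_on UNIV f" "\<And>t. t \<notin> K \<Longrightarrow> f t = 0" and gc: "continuous_on UNIV g" "\<And>t. t \<notin> L \<Longrightarrow> g t = 0"
    using f g K L by (auto simp: CK_iff)
  have "continuous_on UNIV (\<lambda>t. \<integral>s. (\<lambda>p. f (fst p) * g (- fst p + snd p)) (s, t) \<partial>\<mu>)"
    by (rule continuous_on_integral[OF continuous_convolution_integrand[OF fc(1) gc(1)] K]) (simp add: fc(2))
  then show "continuous_on UNIV (convolution \<mu> f g)" by (simp add: convolution_def[abs_def])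
  fix t assume t: "t \<notin> {x + y | x y. x \<in> K \<and> y \<in> L}"
  have "f s * g (- s + t) = 0" for s
  proof (cases "s \<in> K")
    case True
    have "t = s + (- s + t)" by simp
    then have "- s + t \<notin> L" using True t by blast
    then show ?thesis by (simp add: gc(2))
  qed (simp add: fc(2))
  then have "(\<lambda>s. f s * g (- s + t)) = (\<lambda>s. 0)" by (rule ext)
  then show "convolution \<mu> f g t = 0" by (simp only: convolution_def) simp
qed

lemma convolution_Cc: "f \<in> Cc \<Longrightarrow> g \<in> Cc \<Longrightarrow> convolution \<mu> f g \<in> Cc"
  using convolution_CK[OF mem_CK_supp mem_CK_supp, of f g] CK_subset_Cc by (auto dest: CcD(2))

lemma convolution_add_left:
  assumes "f \<in> Cc" "f' \<in> Cc" "continuous_on UNIV g"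
  shows "convolution \<mu> (\<lambda>t. f t + f' t) g = (\<lambda>t. convolution \<mu> f g t + convolution \<mu> f' g t)"
  using integrable_convolution_integrand[OF assms(1,3)] integrable_convolution_integrand[OF assms(2,3)]
  by (simp add: convolution_def fun_eq_iff distrib_right)

lemma convolution_add_right:
  assumes "f \<in> Cc" "continuous_on UNIV g" "continuous_on UNIV g'"
  shows "convolution \<mu> f (\<lambda>t. g t + g' t) = (\<lambda>t. convolution \<mu> f g t + convolution \<mu> f g' t)"
  using integrable_convolution_integrand[OF assms(1,2)] integrable_convolution_integrand[OF assms(1,3)]
  by (simp add: convolution_def fun_eq_iff distrib_left)

lemma convolution_smult_left: "convolution \<mu> (\<lambda>t. c * f t) g = (\<lambda>t. c * convolution \<mu> f g t)"
  by (simp add: convolution_def fun_eq_iff mult.assoc)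

lemma convolution_smult_right: "convolution \<mu> f (\<lambda>t. c * g t) = (\<lambda>t. c * convolution \<mu> f g t)"
  by (simp add: convolution_def fun_eq_iff mult.left_commute)

text \<open>
  Multiplicativity of the integral is the case \<open>h = (\<lambda>_. 1)\<close>, associativity the case of a translate of \<open>h\<close>.
\<close>

lemma integral_convolution:
  assumes f: "f \<in> Cc" and g: "g \<in> Cc" and h: "continuous_on UNIV h"
  shows "(\<integral>t. convolution \<mu> f g t * h t \<partial>\<mu>) = (\<integral>s. f s * (\<integral>t. g t * h (s + t) \<partial>\<mu>) \<partial>\<mu>)"
proof -
  define F where "F p = (f (fst p) * g (- fst p + snd p)) * h (snd p)" for p
  note fc = CcD[OF f] and gc = CcD[OF g]
  have F: "continuous_on UNIV F"
    unfolding F_def by (intro continuous_on_mult[OF continuous_convolution_integrand[OF fc(1) gc(1)]]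
      continuous_on_compose2[OF h] continuous_intros) auto
  have 1: "F (s, t) = 0" if "s \<notin> supp f" for s t
    using that by (simp add: F_def supp_outside)
  have 2: "F (s, t) = 0" if "t \<notin> {x + y | x y. x \<in> supp f \<and> y \<in> supp g}" for s t
  proof (cases "s \<in> supp f")
    case True
    have "t = s + (- s + t)" by simp
    then have "- s + t \<notin> supp g" using True that by blast
    then show ?thesis by (simp add: F_def supp_outside)
  qed (simp add: 1)
  have "(\<integral>t. convolution \<mu> f g t * h t \<partial>\<mu>) = (\<integral>t. (\<integral>s. F (s, t) \<partial>\<mu>) \<partial>\<mu>)"
    by (simp add: convolution_def F_def)
  also have "\<dots> = (\<integral>s. (\<integral>t. F (s, t) \<partial>\<mu>) \<partial>\<mu>)"
    by (rule integral_swap[OF F fc(2) 1 compact_group_sums[OF fc(2) gc(2)] 2])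
  also have "\<dots> = (\<integral>s. f s * (\<integral>t. g t * h (s + t) \<partial>\<mu>) \<partial>\<mu>)"
  proof (rule Bochner_Integration.integral_cong[OF refl])
    fix s
    have "continuous_on UNIV (\<lambda>t. F (s, t))"
      by (rule continuous_on_compose2[OF F]) (auto intro!: continuous_intros)
    from integral_left_translate[OF this, of s]
    have "(\<integral>t. F (s, t) \<partial>\<mu>) = (\<integral>t. F (s, s + t) \<partial>\<mu>)" by simp
    also have "\<dots> = f s * (\<integral>t. g t * h (s + t) \<partial>\<mu>)"
      by (simp add: F_def mult.assoc)
    finally show "(\<integral>t. F (s, t) \<partial>\<mu>) = f s * (\<integral>t. g t * h (s + t) \<partial>\<mu>)" .
  qed
  finally show ?thesis .
qed

lemma haar_integral_convolution:
  assumes "f \<in> Cc" "g \<in> Cc"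
  shows "haar_integral \<mu> (convolution \<mu> f g) = haar_integral \<mu> f * haar_integral \<mu> g"
  using integral_convolution[OF assms, of "\<lambda>_. 1"] by (simp add: haar_integral_def)

lemma convolution_assoc:
  assumes f: "f \<in> Cc" and g: "g \<in> Cc" and h: "h \<in> Cc"
  shows "convolution \<mu> (convolution \<mu> f g) h = convolution \<mu> f (convolution \<mu> g h)"
proof
  fix t
  have "continuous_on UNIV (\<lambda>s. h (- s + t))"
    by (rule continuous_on_compose2[OF CcD(1)[OF h]]) (auto intro!: continuous_intros)
  from integral_convolution[OF f g this]
  show "convolution \<mu> (convolution \<mu> f g) h t = convolution \<mu> f (convolution \<mu> g h) t"
    by (simp only: convolution_def minus_add add.assoc)
qed

lemma L1_norm_nonneg: "0 \<le> L1_norm \<mu> f"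
  by (simp add: L1_norm_def)

lemma norm_haar_integral_le: "cmod (haar_integral \<mu> f) \<le> L1_norm \<mu> f"
  by (simp add: haar_integral_def L1_norm_def integral_norm_bound)

lemma L1_norm_eq_0:
  assumes f: "f \<in> Cc"
  shows "L1_norm \<mu> f = 0 \<longleftrightarrow> f = (\<lambda>t. 0)"
proof
  assume 0: "L1_norm \<mu> f = 0"
  have "continuous_on UNIV (\<lambda>t. cmod (f t))" using CcD(1)[OF f] by (rule continuous_on_norm)
  from integral_nonneg_eq_0[OF this norm_ge_zero integrable_norm_Cc[OF f] 0[unfolded L1_norm_def]]
  show "f = (\<lambda>t. 0)" by (simp add: fun_eq_iff)
qed (simp add: L1_norm_def)

lemma L1_norm_add: "f \<in> Cc \<Longrightarrow> g \<in> Cc \<Longrightarrow> L1_norm \<mu> (\<lambda>t. f t + g t) \<le> L1_norm \<mu> f + L1_norm \<mu> g"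
  unfolding L1_norm_def
  by (subst Bochner_Integration.integral_add[symmetric])
    (auto intro!: integral_mono integrable_norm_Cc Cc_add norm_triangle_ineq)

lemma L1_norm_smult: "L1_norm \<mu> (\<lambda>t. c * f t) = cmod c * L1_norm \<mu> f"
  by (simp add: L1_norm_def norm_mult)

text \<open>The modulus of the convolution is at most the convolution of the moduli, on which the
  integral is multiplicative. The moduli are kept complex-valued so that they belong to
  \<open>Cc\<close> and \<open>haar_integral_convolution\<close> applies.\<close>

lemma L1_norm_convolution:
  assumes f: "f \<in> Cc" and g: "g \<in> Cc"
  shows "L1_norm \<mu> (convolution \<mu> f g) \<le> L1_norm \<mu> f * L1_norm \<mu> g"
proof -
  define f' g' where "f' t = complex_of_real (cmod (f t))" and "g' t = complex_of_real (cmod (g t))" for t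
  have f': "f' \<in> Cc"
    unfolding f'_def[abs_def] using CcD[OF f]
    by (intro CcI[of _ "supp f"] continuous_intros) (auto simp: supp_outside)
  have g': "g' \<in> Cc"
    unfolding g'_def[abs_def] using CcD[OF g]
    by (intro CcI[of _ "supp g"] continuous_intros) (auto simp: supp_outside)
  have le: "cmod (convolution \<mu> f g t) \<le> Re (convolution \<mu> f' g' t)" for t
  proof -
    have "cmod (convolution \<mu> f g t) \<le> (\<integral>s. cmod (f s * g (- s + t)) \<partial>\<mu>)"
      unfolding convolution_def by (rule integral_norm_bound)
    also have "\<dots> = (\<integral>s. Re (f' s * g' (- s + t)) \<partial>\<mu>)"
      by (simp add: f'_def g'_def norm_mult)
    also have "\<dots> = Re (convolution \<mu> f' g' t)"
      unfolding convolution_def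
      by (rule integral_Re[OF integrable_convolution_integrand[OF f' CcD(1)[OF g']]])
    finally show ?thesis .
  qed
  have "L1_norm \<mu> (convolution \<mu> f g) \<le> (\<integral>t. Re (convolution \<mu> f' g' t) \<partial>\<mu>)"
    unfolding L1_norm_def using le
    by (intro integral_mono integrable_norm_Cc convolution_Cc f g integrable_Re integrable_Cc f' g')
  also have "\<dots> = Re (haar_integral \<mu> (convolution \<mu> f' g'))"
    unfolding haar_integral_def by (rule integral_Re[OF integrable_Cc[OF convolution_Cc[OF f' g']]])
  also have "\<dots> = Re (haar_integral \<mu> f' * haar_integral \<mu> g')"
    by (simp add: haar_integral_convolution f' g')
  also have "\<dots> = L1_norm \<mu> f * L1_norm \<mu> g"
    by (simp add: haar_integral_def f'_def g'_def L1_norm_def)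
  finally show ?thesis .
qed

section \<open>The algebras of compactly supported functions\<close>

text \<open>\<open>Cc\<close>, each \<open>CK K\<close> and \<open>Cc0 \<mu>\<close> are the
  instances; the module and norm axioms are checked once for all of them.\<close>

definition Cc_subspace :: "('a \<Rightarrow> complex) set \<Rightarrow> bool" where
  "Cc_subspace S \<longleftrightarrow> S \<subseteq> Cc \<and> (\<lambda>t. 0) \<in> S \<and> (\<forall>f\<in>S. \<forall>g\<in>S. (\<lambda>t. f t + g t) \<in> S) \<and>
     (\<forall>c. \<forall>f\<in>S. (\<lambda>t. c * f t) \<in> S)"

lemma Cc_subspace_Cc: "Cc_subspace Cc"
  by (simp add: Cc_subspace_def Cc_zero Cc_add Cc_smult)

lemma Cc_subspace_CK: "compact K \<Longrightarrow> Cc_subspace (CK K)"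
  by (simp add: Cc_subspace_def CK_subset_Cc CK_zero CK_add CK_smult)

lemma Cc_subspace_Cc0: "Cc_subspace (Cc0 \<mu>)"
  by (auto simp: Cc_subspace_def Cc0_def Cc_zero Cc_add Cc_smult haar_integral_def integrable_Cc)

lemma module_convolution_algebra:
  "Cc_subspace S \<Longrightarrow> module complex_field (convolution_algebra \<mu> S \<tau>)"
  by (rule function_module[where j = "\<lambda>x. x" and S = S]) (auto simp: Cc_subspace_def)

lemma complex_normed_space_L1:
  assumes S: "Cc_subspace S"
  shows "complex_normed_space (L1_space \<mu> S)"
proof (intro complex_normed_space.intro complex_normed_space_axioms.intro)
  show "module complex_field (L1_space \<mu> S)"
    using S by (intro function_module[where j = "\<lambda>x. x" and S = S]) (auto simp: Cc_subspace_def)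
qed (use S in \<open>auto simp: Cc_subspace_def L1_norm_nonneg L1_norm_eq_0 L1_norm_smult subset_iff intro!: L1_norm_add\<close>)

lemma module_L1: "Cc_subspace S \<Longrightarrow> module complex_field (L1_space \<mu> S)"
  using complex_normed_space_L1 by (rule complex_normed_space.axioms)

text \<open>The records differ in the last field only; linear maps see the carrier, the sum and the
  scalars, which coincide. Statements can thus move between the algebra and the normed
  space.\<close>

lemma linear_map_convolution_algebra:
  "linear_map (convolution_algebra \<mu> S \<tau>) W f \<longleftrightarrow> linear_map (L1_space \<mu> S) W f"
  by (simp add: linear_map_def)

lemma locally_convex_topology_convolution_algebra:
  "locally_convex_topology (convolution_algebra \<mu> S \<tau>) \<sigma> \<longleftrightarrow> locally_convex_topology (L1_space \<mu> S) \<sigma>"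
  by (simp add: locally_convex_topology_def convex_in_def)

lemma locally_convex_algebraI:
  assumes S: "Cc_subspace S" and mult: "\<And>f g. f \<in> S \<Longrightarrow> g \<in> S \<Longrightarrow> convolution \<mu> f g \<in> S"
    and lct: "locally_convex_topology (L1_space \<mu> S) \<tau>" and haus: "Hausdorff_space \<tau>"
    and right: "\<And>f. f \<in> S \<Longrightarrow> continuous_map \<tau> \<tau> (\<lambda>g. convolution \<mu> f g)"
    and left: "\<And>g. g \<in> S \<Longrightarrow> continuous_map \<tau> \<tau> (\<lambda>f. convolution \<mu> f g)"
  shows "locally_convex_algebra (convolution_algebra \<mu> S \<tau>)"
proof (intro locally_convex_algebra.intro locally_convex_algebra_axioms.intro module_convolution_algebra[OF S])
  have sub: "f \<in> Cc" "continuous_on UNIV f" if "f \<in> S" for f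
    using that S CcD(1)[of f] by (auto simp: Cc_subspace_def)
  show "locally_convex_topology (convolution_algebra \<mu> S \<tau>) (lctop (convolution_algebra \<mu> S \<tau>))"
    using lct by (simp add: locally_convex_topology_convolution_algebra)
  fix f assume f: "f \<in> carrier (convolution_algebra \<mu> S \<tau>)"
  show "linear_map (convolution_algebra \<mu> S \<tau>) (convolution_algebra \<mu> S \<tau>) ((\<otimes>\<^bsub>convolution_algebra \<mu> S \<tau>\<^esub>) f)"
    using f mult by (intro linear_mapI) (auto simp: convolution_add_right convolution_smult_right sub)
  show "linear_map (convolution_algebra \<mu> S \<tau>) (convolution_algebra \<mu> S \<tau>) (\<lambda>g. g \<otimes>\<^bsub>convolution_algebra \<mu> S \<tau>\<^esub> f)"
    using f mult by (intro linear_mapI) (auto simp: convolution_add_left convolution_smult_left sub)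
  fix g h assume "g \<in> carrier (convolution_algebra \<mu> S \<tau>)" "h \<in> carrier (convolution_algebra \<mu> S \<tau>)"
  then show "f \<otimes>\<^bsub>convolution_algebra \<mu> S \<tau>\<^esub> g \<otimes>\<^bsub>convolution_algebra \<mu> S \<tau>\<^esub> h =
      f \<otimes>\<^bsub>convolution_algebra \<mu> S \<tau>\<^esub> (g \<otimes>\<^bsub>convolution_algebra \<mu> S \<tau>\<^esub> h)"
    using f by (simp add: convolution_assoc sub)
qed (use mult haus left right in auto)

lemma Cc0_convolution_left: "f \<in> Cc0 \<mu> \<Longrightarrow> g \<in> Cc \<Longrightarrow> convolution \<mu> f g \<in> Cc0 \<mu>"
  by (simp add: Cc0_def convolution_Cc haar_integral_convolution)

lemma Cc0_subset_Cc: "Cc0 \<mu> \<subseteq> Cc"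
  by (auto simp: Cc0_def)

lemma topspace_norm_topology_L1: "Cc_subspace S \<Longrightarrow> topspace (norm_topology (L1_space \<mu> S)) = S"
  using complex_normed_space.topspace_norm_topology[OF complex_normed_space_L1] by simp

lemma continuous_map_L1:
  assumes "Cc_subspace S" "complex_normed_space F" "linear_map (L1_space \<mu> S) F f"
    and "\<And>x. x \<in> S \<Longrightarrow> nrm F (f x) \<le> C * L1_norm \<mu> x"
  shows "continuous_map (norm_topology (L1_space \<mu> S)) (norm_topology F) f"
  by (rule continuous_map_norm_topology[OF complex_normed_space_L1[OF assms(1)] assms(2,3), where C = C])
    (simp add: assms(4))

lemma linear_map_convolution:
  assumes "Cc_subspace S" "\<And>g. g \<in> S \<Longrightarrow> convolution \<mu> f g \<in> T" "f \<in> Cc"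
  shows "linear_map (L1_space \<mu> S) (L1_space \<mu> T) (convolution \<mu> f)"
proof -
  have "continuous_on UNIV g" if "g \<in> S" for g
    using assms(1) that CcD(1)[of g] by (auto simp: Cc_subspace_def)
  then show ?thesis
    using assms(2,3) by (intro linear_mapI) (auto simp: convolution_add_right convolution_smult_right)
qed

lemma linear_map_convolution':
  assumes "Cc_subspace S" "\<And>f. f \<in> S \<Longrightarrow> convolution \<mu> f g \<in> T" "g \<in> Cc"
  shows "linear_map (L1_space \<mu> S) (L1_space \<mu> T) (\<lambda>f. convolution \<mu> f g)"
proof -
  have "f \<in> Cc" if "f \<in> S" for f
    using assms(1) that by (auto simp: Cc_subspace_def)
  then show ?thesis
    using assms(2,3) CcD(1)[of g]
    by (intro linear_mapI) (auto simp: convolution_add_left convolution_smult_left)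
qed

lemma locally_convex_algebra_Cc0_L1: "locally_convex_algebra (Cc0_L1_algebra \<mu>)"
  unfolding Cc0_L1_algebra_def
proof (rule locally_convex_algebraI[OF Cc_subspace_Cc0])
  note N = complex_normed_space_L1[OF Cc_subspace_Cc0]
  show "locally_convex_topology (L1_space \<mu> (Cc0 \<mu>)) (norm_topology (L1_space \<mu> (Cc0 \<mu>)))"
    by (rule complex_normed_space.locally_convex_norm_topology[OF N])
  show "Hausdorff_space (norm_topology (L1_space \<mu> (Cc0 \<mu>)))"
    by (rule complex_normed_space.Hausdorff_norm_topology[OF N])
  show mult: "convolution \<mu> f g \<in> Cc0 \<mu>" if "f \<in> Cc0 \<mu>" "g \<in> Cc0 \<mu>" for f g
    using that Cc0_convolution_left Cc0_subset_Cc by blast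
  fix f assume f: "f \<in> Cc0 \<mu>"
  then have fc: "f \<in> Cc" using Cc0_subset_Cc by blast
  show "continuous_map (norm_topology (L1_space \<mu> (Cc0 \<mu>))) (norm_topology (L1_space \<mu> (Cc0 \<mu>))) (convolution \<mu> f)"
  proof (rule continuous_map_L1[OF Cc_subspace_Cc0 N linear_map_convolution[OF Cc_subspace_Cc0 mult[OF f] fc]])
    fix g assume "g \<in> Cc0 \<mu>"
    then show "nrm (L1_space \<mu> (Cc0 \<mu>)) (convolution \<mu> f g) \<le> L1_norm \<mu> f * L1_norm \<mu> g"
      using L1_norm_convolution[OF fc] Cc0_subset_Cc by auto
  qed
  show "continuous_map (norm_topology (L1_space \<mu> (Cc0 \<mu>))) (norm_topology (L1_space \<mu> (Cc0 \<mu>))) (\<lambda>g. convolution \<mu> g f)"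
  proof (rule continuous_map_L1[OF Cc_subspace_Cc0 N linear_map_convolution'[OF Cc_subspace_Cc0 mult[OF _ f] fc]])
    fix g assume "g \<in> Cc0 \<mu>"
    then show "nrm (L1_space \<mu> (Cc0 \<mu>)) (convolution \<mu> g f) \<le> L1_norm \<mu> f * L1_norm \<mu> g"
      using L1_norm_convolution[of g f] fc Cc0_subset_Cc by (auto simp: mult.commute)
  qed
qed

section \<open>The inductive limit topology on \<open>Cc\<close>\<close>

lemma topspace_CK_family:
  "X \<in> {norm_topology (L1_space \<mu> (CK K)) |K. compact K \<and> K \<noteq> {}} \<Longrightarrow> topspace X \<subseteq> carrier (L1_space \<mu> Cc)"
  using topspace_norm_topology_L1[OF Cc_subspace_CK] CK_subset_Cc by auto

lemma locally_convex_Cc_topology: "locally_convex_topology (L1_space \<mu> Cc) (Cc_topology \<mu>)"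
  unfolding Cc_topology_def
  by (rule locally_convex_lc_inductive_limit[OF module_L1[OF Cc_subspace_Cc] topspace_CK_family])

lemma continuous_map_CK_into_Cc_topology:
  assumes "compact K" "K \<noteq> {}"
  shows "continuous_map (norm_topology (L1_space \<mu> (CK K))) (Cc_topology \<mu>) (\<lambda>x. x)"
  unfolding Cc_topology_def using assms
  by (intro continuous_map_into_lc_inductive_limit[OF module_L1[OF Cc_subspace_Cc] topspace_CK_family]) auto

lemma continuous_map_from_Cc_topology:
  assumes W: "module complex_field W" and f: "linear_map (L1_space \<mu> Cc) W f"
    and \<tau>: "locally_convex_topology W \<tau>"
    and cont: "\<And>K. compact K \<Longrightarrow> K \<noteq> {} \<Longrightarrow> continuous_map (norm_topology (L1_space \<mu> (CK K))) \<tau> f"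
  shows "continuous_map (Cc_topology \<mu>) \<tau> f"
  unfolding Cc_topology_def
  by (rule continuous_map_from_lc_inductive_limit[OF module_L1[OF Cc_subspace_Cc] W f \<tau> topspace_CK_family, THEN conjunct1])
    (use cont in auto)

lemma linear_map_restrict: "linear_map (L1_space \<mu> S) W f \<Longrightarrow> T \<subseteq> S \<Longrightarrow> linear_map (L1_space \<mu> T) W f"
  unfolding linear_map_def by (simp add: subset_iff Pi_iff)

text \<open>The constant may grow with \<open>K\<close>. This freedom separates \<TT> from the
  topology of the global \<open>L1_norm\<close>, and the maps into operators on the weighted space
  below rely on it.\<close>

lemma continuous_map_Cc_topology_norm_topology:
  assumes F: "complex_normed_space F" and f: "linear_map (L1_space \<mu> Cc) F f"
    and bound: "\<And>K. compact K \<Longrightarrow> \<exists>C. \<forall>x\<in>CK K. nrm F (f x) \<le> C * L1_norm \<mu> x"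
  shows "continuous_map (Cc_topology \<mu>) (norm_topology F) f"
proof (rule continuous_map_from_Cc_topology[OF complex_normed_space.axioms(1)[OF F] f
      complex_normed_space.locally_convex_norm_topology[OF F]])
  fix K :: "'a set" assume K: "compact K"
  then obtain C where "\<forall>x\<in>CK K. nrm F (f x) \<le> C * L1_norm \<mu> x" using bound by blast
  then show "continuous_map (norm_topology (L1_space \<mu> (CK K))) (norm_topology F) f"
    using continuous_map_L1[OF Cc_subspace_CK[OF K] F linear_map_restrict[OF f CK_subset_Cc]] by blast
qed

text \<open>The identity is continuous from \<TT> to the topology of the global
  \<open>L1_norm\<close>, which is Hausdorff.\<close>

lemma Hausdorff_Cc_topology: "Hausdorff_space (Cc_topology \<mu>)"
proof (rule Hausdorff_space_injective_preimage)
  note N = complex_normed_space_L1[OF Cc_subspace_Cc]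
  show "Hausdorff_space (norm_topology (L1_space \<mu> Cc))"
    by (rule complex_normed_space.Hausdorff_norm_topology[OF N])
  show "continuous_map (Cc_topology \<mu>) (norm_topology (L1_space \<mu> Cc)) (\<lambda>x. x)"
    by (rule continuous_map_Cc_topology_norm_topology[OF N]) (auto simp: linear_map_def intro!: exI[of _ 1])
qed simp

text \<open>Convolution with f, from either side, maps \<open>CK K\<close> into \<open>CK\<close> of
  a sum of \<open>K\<close> and the support of f, with operator norm at most
  \<open>L1_norm \<mu> f\<close>. Each restriction therefore lands in one step of the inductive
  limit.\<close>

lemma continuous_map_convolution_Cc_topology:
  assumes f: "f \<in> Cc"
  shows "continuous_map (Cc_topology \<mu>) (Cc_topology \<mu>) (convolution \<mu> f)"
    and "continuous_map (Cc_topology \<mu>) (Cc_topology \<mu>) (\<lambda>g. convolution \<mu> g f)"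
proof -
  have into: "continuous_map (norm_topology (L1_space \<mu> (CK K))) (Cc_topology \<mu>) T"
    if K: "compact K" and L: "compact L" and T: "linear_map (L1_space \<mu> (CK K)) (L1_space \<mu> (CK L)) T"
      and bound: "\<And>g. g \<in> Cc \<Longrightarrow> L1_norm \<mu> (T g) \<le> L1_norm \<mu> f * L1_norm \<mu> g" for K L T
  proof -
    \<comment> \<open>Only nonempty compact sets index the inductive limit, whereas the support of f
      may be empty; adding the unit of the group repairs this.\<close>
    have "L \<union> {0} \<noteq> {}" "compact (L \<union> {0})" using L by auto
    moreover have "linear_map (L1_space \<mu> (CK K)) (L1_space \<mu> (CK (L \<union> {0}))) T"
      using T CK_mono[of L "L \<union> {0}"] by (auto simp: linear_map_def Pi_iff)
    then have "continuous_map (norm_topology (L1_space \<mu> (CK K))) (norm_topology (L1_space \<mu> (CK (L \<union> {0})))) T"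
      using bound CK_subset_Cc calculation
      by (intro continuous_map_L1[OF Cc_subspace_CK[OF K] complex_normed_space_L1[OF Cc_subspace_CK]]) auto
    ultimately show ?thesis
      using continuous_map_compose[OF _ continuous_map_CK_into_Cc_topology[of "L \<union> {0}"]] by (simp add: o_def)
  qed
  have bound': "L1_norm \<mu> (convolution \<mu> g f) \<le> L1_norm \<mu> f * L1_norm \<mu> g" if "g \<in> Cc" for g
    using L1_norm_convolution[OF that f] by (simp add: mult.commute)
  note fS = mem_CK_supp[OF f] CcD(2)[OF f]
  show "continuous_map (Cc_topology \<mu>) (Cc_topology \<mu>) (convolution \<mu> f)"
  proof (rule continuous_map_from_Cc_topology[OF module_L1[OF Cc_subspace_Cc] _ locally_convex_Cc_topology])
    show "linear_map (L1_space \<mu> Cc) (L1_space \<mu> Cc) (convolution \<mu> f)"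
      by (rule linear_map_convolution[OF Cc_subspace_Cc convolution_Cc[OF f] f])
    fix K :: "'a set" assume K: "compact K"
    show "continuous_map (norm_topology (L1_space \<mu> (CK K))) (Cc_topology \<mu>) (convolution \<mu> f)"
      by (rule into[OF K compact_group_sums[OF fS(2) K]
          linear_map_convolution[OF Cc_subspace_CK[OF K] convolution_CK[OF fS(1) _ fS(2) K] f]])
        (auto intro: L1_norm_convolution[OF f])
  qed
  show "continuous_map (Cc_topology \<mu>) (Cc_topology \<mu>) (\<lambda>g. convolution \<mu> g f)"
  proof (rule continuous_map_from_Cc_topology[OF module_L1[OF Cc_subspace_Cc] _ locally_convex_Cc_topology])
    show "linear_map (L1_space \<mu> Cc) (L1_space \<mu> Cc) (\<lambda>g. convolution \<mu> g f)"
      by (rule linear_map_convolution'[OF Cc_subspace_Cc convolution_Cc[OF _ f] f])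
    fix K :: "'a set" assume K: "compact K"
    show "continuous_map (norm_topology (L1_space \<mu> (CK K))) (Cc_topology \<mu>) (\<lambda>g. convolution \<mu> g f)"
      by (rule into[OF K compact_group_sums[OF K fS(2)]
          linear_map_convolution'[OF Cc_subspace_CK[OF K] convolution_CK[OF _ fS(1) K fS(2)] f]])
        (auto intro: bound')
  qed
qed

lemma locally_convex_algebra_Cc: "locally_convex_algebra (Cc_algebra \<mu>)"
  unfolding Cc_algebra_def
  by (intro locally_convex_algebraI Cc_subspace_Cc convolution_Cc locally_convex_Cc_topology
      Hausdorff_Cc_topology continuous_map_convolution_Cc_topology)

lemma locally_convex_algebra_Cc0: "locally_convex_algebra (Cc0_algebra \<mu>)"
  unfolding Cc0_algebra_def
proof (rule locally_convex_algebraI[OF Cc_subspace_Cc0])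
  show "locally_convex_topology (L1_space \<mu> (Cc0 \<mu>)) (subtopology (Cc_topology \<mu>) (Cc0 \<mu>))"
    unfolding subtopology_eq_pullback
    using locally_convex_pullback[OF module_L1[OF Cc_subspace_Cc0] module_L1[OF Cc_subspace_Cc] _ locally_convex_Cc_topology,
        of "\<lambda>x. x"] Cc0_subset_Cc by (auto simp: linear_map_def)
  show "Hausdorff_space (subtopology (Cc_topology \<mu>) (Cc0 \<mu>))"
    by (rule Hausdorff_space_subtopology[OF Hausdorff_Cc_topology])
  show mult: "convolution \<mu> f g \<in> Cc0 \<mu>" if "f \<in> Cc0 \<mu>" "g \<in> Cc0 \<mu>" for f g
    using that Cc0_convolution_left Cc0_subset_Cc by blast
  fix f assume f: "f \<in> Cc0 \<mu>"
  then have fc: "f \<in> Cc" using Cc0_subset_Cc by blast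
  show "continuous_map (subtopology (Cc_topology \<mu>) (Cc0 \<mu>)) (subtopology (Cc_topology \<mu>) (Cc0 \<mu>)) (convolution \<mu> f)"
    using mult f by (auto simp: continuous_map_in_subtopology
        intro!: continuous_map_from_subtopology continuous_map_convolution_Cc_topology(1)[OF fc])
  show "continuous_map (subtopology (Cc_topology \<mu>) (Cc0 \<mu>)) (subtopology (Cc_topology \<mu>) (Cc0 \<mu>)) (\<lambda>g. convolution \<mu> g f)"
    using mult f by (auto simp: continuous_map_in_subtopology
        intro!: continuous_map_from_subtopology continuous_map_convolution_Cc_topology(2)[OF fc])
qed

lemma linear_map_haar_integral: "linear_map (L1_space \<mu> Cc) complex_space (haar_integral \<mu>)"
  by (rule linear_mapI) (auto simp: haar_integral_def integrable_Cc)

lemma continuous_character_haar_integral: "continuous_character (Cc_algebra \<mu>) (haar_integral \<mu>)"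
proof -
  interpret locally_convex_algebra "Cc_algebra \<mu>" by (rule locally_convex_algebra_Cc)
  show ?thesis
  proof
    have "continuous_map (Cc_topology \<mu>) (norm_topology complex_space) (haar_integral \<mu>)"
      by (rule continuous_map_Cc_topology_norm_topology[OF complex_space.complex_normed_space_axioms
          linear_map_haar_integral]) (auto intro!: exI[of _ 1] norm_haar_integral_le)
    then show "continuous_linear complex_space (haar_integral \<mu>)"
      using linear_map_haar_integral unfolding continuous_linear_def
      by (simp add: Cc_algebra_def linear_map_convolution_algebra)
    show "haar_integral \<mu> (f \<otimes>\<^bsub>Cc_algebra \<mu>\<^esub> g) = haar_integral \<mu> f * haar_integral \<mu> g"
      if "f \<in> carrier (Cc_algebra \<mu>)" "g \<in> carrier (Cc_algebra \<mu>)" for f g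
      using that by (simp add: Cc_algebra_def haar_integral_convolution)
    obtain u :: "'a \<Rightarrow> real" where u: "(\<lambda>t. complex_of_real (u t)) \<in> Cc" "(\<integral>t. u t \<partial>\<mu>) = 1"
      using ex_bump[OF open_UNIV, of 0] by auto
    then show "\<exists>f\<in>carrier (Cc_algebra \<mu>). haar_integral \<mu> f \<noteq> 0"
      by (intro bexI[of _ "\<lambda>t. complex_of_real (u t)"]) (auto simp: Cc_algebra_def haar_integral_def)
  qed
qed

theorem CB_imp_amenable:
  assumes "locally_convex_algebra.property_CB (Cc0_algebra \<mu>) TYPE('e)"
  shows "continuous_character.amenable (Cc_algebra \<mu>) (haar_integral \<mu>) TYPE('e)"
  by (rule continuous_character.CB_kernel_imp_amenable[OF continuous_character_haar_integral
        locally_convex_algebra_Cc0 _ _ _ _ _ assms])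
    (auto simp: Cc0_algebra_def Cc_algebra_def Cc0_def)

end


section \<open>Approximate identities in \<open>C\<^sub>c\<^sup>0(G)\<close>\<close>

context haar
begin

lemma L1_diff:
  assumes "Cc_subspace S" "f \<in> S" "g \<in> S"
  shows "f \<ominus>\<^bsub>L1_space \<mu> S\<^esub> g = (\<lambda>t. f t - g t)"
  using complex_normed_space.diff_eq_smult[OF complex_normed_space_L1[OF assms(1)], of f g] assms by simp

lemma Cc_subspace_smult: "Cc_subspace S \<Longrightarrow> f \<in> S \<Longrightarrow> (\<lambda>t. c * f t) \<in> S"
  by (simp add: Cc_subspace_def)

lemma limitin_Cc0_topology:
  assumes lim: "limitin (norm_topology (L1_space \<mu> (Cc0 \<mu>))) f l F"
    and K: "compact K" "K \<noteq> {}" "l \<in> CK K" "eventually (\<lambda>i. f i \<in> CK K) F"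
  shows "limitin (subtopology (Cc_topology \<mu>) (Cc0 \<mu>)) f l F"
proof -
  note N = complex_normed_space_L1[OF Cc_subspace_Cc0]
  note NK = complex_normed_space_L1[OF Cc_subspace_CK[OF K(1)]]
  have l: "l \<in> Cc0 \<mu>"
    and ev: "\<And>e. e > 0 \<Longrightarrow> eventually (\<lambda>i. f i \<in> Cc0 \<mu> \<and> L1_norm \<mu> (f i \<ominus>\<^bsub>L1_space \<mu> (Cc0 \<mu>)\<^esub> l) < e) F"
    using lim by (auto simp: complex_normed_space.limitin_norm_topology[OF N])
  have "limitin (norm_topology (L1_space \<mu> (CK K))) f l F"
    unfolding complex_normed_space.limitin_norm_topology[OF NK]
  proof (intro conjI allI impI)
    fix e :: real assume "e > 0"
    from ev[OF this] K(4)
    show "eventually (\<lambda>i. f i \<in> carrier (L1_space \<mu> (CK K)) \<and> nrm (L1_space \<mu> (CK K)) (f i \<ominus>\<^bsub>L1_space \<mu> (CK K)\<^esub> l) < e) F"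
    proof eventually_elim
      case (elim i)
      then show ?case
        using K(3) l L1_diff[OF Cc_subspace_Cc0, of "f i" l] L1_diff[OF Cc_subspace_CK[OF K(1)], of "f i" l] by simp
    qed
  qed (use K in simp)
  from continuous_map_limit[OF continuous_map_CK_into_Cc_topology[OF K(1,2)] this]
  have "limitin (Cc_topology \<mu>) f l F" by (simp add: o_def)
  then show ?thesis
    using l ev[OF zero_less_one] by (auto simp: limitin_subtopology elim: eventually_mono)
qed

text \<open>A \<TT>-open set around zero contains an \<open>L1_norm\<close> ball of
  \<open>CK L\<close>, and such a ball absorbs every norm-bounded subset of
  \<open>CK L\<close>.\<close>

lemma bounded_subset_Cc0:
  assumes K: "compact K" and S: "S \<subseteq> Cc0 \<mu>" "S \<subseteq> CK K" and M: "\<And>f. f \<in> S \<Longrightarrow> L1_norm \<mu> f \<le> M"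
  shows "locally_convex_algebra.bounded_subset (Cc0_algebra \<mu>) S"
  unfolding locally_convex_algebra.bounded_subset_def[OF locally_convex_algebra_Cc0]
proof (intro conjI allI impI)
  show "S \<subseteq> carrier (Cc0_algebra \<mu>)" using S by (simp add: Cc0_algebra_def)
  fix U V assume UV: "openin (lctop (Cc0_algebra \<mu>)) U \<and> \<zero>\<^bsub>Cc0_algebra \<mu>\<^esub> \<in> U \<and> U \<subseteq> V \<and> V \<subseteq> carrier (Cc0_algebra \<mu>)"
  then obtain W where W: "openin (Cc_topology \<mu>) W" "U = W \<inter> Cc0 \<mu>"
    by (auto simp: Cc0_algebra_def openin_subtopology)
  define L where "L = K \<union> {0}"
  have L: "compact L" "L \<noteq> {}" and SL: "S \<subseteq> CK L" using K S(2) CK_mono[of K L] by (auto simp: L_def)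
  note NL = complex_normed_space_L1[OF Cc_subspace_CK[OF L(1)]]
  have "openin (norm_topology (L1_space \<mu> (CK L))) {f \<in> topspace (norm_topology (L1_space \<mu> (CK L))). f \<in> W}"
    using continuous_map_CK_into_Cc_topology[OF L] W(1) unfolding continuous_map_def by blast
  moreover have "(\<lambda>t. 0) \<in> {f \<in> topspace (norm_topology (L1_space \<mu> (CK L))). f \<in> W}"
    using UV W by (simp add: Cc0_algebra_def topspace_norm_topology_L1[OF Cc_subspace_CK[OF L(1)]] CK_zero)
  ultimately obtain r where r: "r > 0"
    "\<forall>f\<in>CK L. L1_norm \<mu> (f \<ominus>\<^bsub>L1_space \<mu> (CK L)\<^esub> (\<lambda>t. 0)) < r \<longrightarrow> f \<in> W"
    unfolding complex_normed_space.openin_norm_topology[OF NL] by auto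
  have ball: "f \<in> W" if "f \<in> CK L" "L1_norm \<mu> f < r" for f
    using r(2) that L1_diff[OF Cc_subspace_CK[OF L(1)] that(1) CK_zero] by simp
  \<comment> \<open>The summand 1 makes \<open>L1_norm \<mu> v < r\<close> strict and keeps the
    factor positive.\<close>
  define \<kappa> where "\<kappa> = (\<bar>M\<bar> + 1) / r"
  have \<kappa>: "\<kappa> > 0" using r by (simp add: \<kappa>_def add_nonneg_pos)
  have "f \<in> (\<lambda>v. complex_of_real \<kappa> \<odot>\<^bsub>Cc0_algebra \<mu>\<^esub> v) ` V" if f: "f \<in> S" for f
  proof
    define v where "v = (\<lambda>t. complex_of_real (1 / \<kappa>) * f t)"
    show "f = complex_of_real \<kappa> \<odot>\<^bsub>Cc0_algebra \<mu>\<^esub> v"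
      using \<kappa> by (simp add: v_def Cc0_algebra_def fun_eq_iff)
    have v: "v \<in> Cc0 \<mu>" "v \<in> CK L"
      unfolding v_def using f S(1) SL
      by (blast intro: Cc_subspace_smult[OF Cc_subspace_Cc0] Cc_subspace_smult[OF Cc_subspace_CK[OF L(1)]])+
    have "L1_norm \<mu> v = L1_norm \<mu> f / \<kappa>"
      using L1_norm_smult[of "complex_of_real (1 / \<kappa>)" f] \<kappa> by (simp add: v_def norm_divide)
    also have "\<dots> < r"
    proof -
      have "L1_norm \<mu> f < \<bar>M\<bar> + 1" using M[OF f] by linarith
      then show ?thesis using \<kappa> r by (simp add: \<kappa>_def divide_simps mult.commute)
    qed
    finally have "v \<in> W" using ball v by simp
    then show "v \<in> V" using v UV W by blast
  qed
  then show "\<exists>\<kappa>>0. S \<subseteq> (\<lambda>v. complex_of_real \<kappa> \<odot>\<^bsub>Cc0_algebra \<mu>\<^esub> v) ` V"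
    using \<kappa> by blast
qed

theorem L1_approximate_identity_imp_approximate_identity:
  assumes "has_bounded_L1_approximate_identity_in_compact \<mu> TYPE('i)"
  shows "locally_convex_algebra.has_bounded_approximate_identity (Cc0_algebra \<mu>) TYPE('i)"
proof -
  interpret L: locally_convex_algebra "Cc0_L1_algebra \<mu>" by (rule locally_convex_algebra_Cc0_L1)
  interpret A: locally_convex_algebra "Cc0_algebra \<mu>" by (rule locally_convex_algebra_Cc0)
  obtain K and I :: "'i set" and D h M where K: "compact K" and h: "L.approximate_identity I D h"
    and M: "\<And>i. i \<in> I \<Longrightarrow> L1_norm \<mu> (h i) \<le> M" and hK: "\<And>i. i \<in> I \<Longrightarrow> supp (h i) \<subseteq> K"
    using assms unfolding has_bounded_L1_approximate_identity_in_compact_def by (elim exE conjE) blast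
  have D: "directed_set I D" and h0: "\<And>i. i \<in> I \<Longrightarrow> h i \<in> Cc0 \<mu>"
    and lim: "\<And>b. b \<in> Cc0 \<mu> \<Longrightarrow> limitin (norm_topology (L1_space \<mu> (Cc0 \<mu>))) (\<lambda>i. convolution \<mu> (h i) b) b (tails I D)"
      "\<And>b. b \<in> Cc0 \<mu> \<Longrightarrow> limitin (norm_topology (L1_space \<mu> (Cc0 \<mu>))) (\<lambda>i. convolution \<mu> b (h i)) b (tails I D)"
    using h unfolding L.approximate_identity_def by (auto simp: Cc0_L1_algebra_def)
  have hCK: "h i \<in> CK K" if "i \<in> I" for i
    using h0[OF that] hK[OF that] Cc0_subset_Cc by (auto simp: CK_def)
  have I: "eventually (\<lambda>i. i \<in> I) (tails I D)"
    unfolding eventually_tails[OF D] using directed_setD(1)[OF D] by blast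
  have "A.approximate_identity I D h"
    unfolding A.approximate_identity_def
  proof (intro conjI ballI D)
    show "h \<in> I \<rightarrow> carrier (Cc0_algebra \<mu>)" using h0 by (simp add: Cc0_algebra_def)
    fix b assume "b \<in> carrier (Cc0_algebra \<mu>)"
    then have b: "b \<in> Cc0 \<mu>" by (simp add: Cc0_algebra_def)
    then have bc: "b \<in> Cc" using Cc0_subset_Cc by blast
    note bS = CcD(2)[OF bc] mem_CK_supp[OF bc]
    define L1 L2 where "L1 = {x + y | x y. x \<in> K \<and> y \<in> supp b}" and "L2 = {x + y | x y. x \<in> supp b \<and> y \<in> K}"
    \<comment> \<open>One compact set that carries the products from both sides and the limit b
      itself; the unit 0 keeps it nonempty.\<close>
    define L where "L = L1 \<union> L2 \<union> supp b \<union> {0}"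
    have "compact L1" "compact L2"
      unfolding L1_def L2_def using compact_group_sums K bS(1) by blast+
    then have L: "compact L" "L \<noteq> {}"
      using bS(1) by (simp_all add: L_def compact_Un)
    have bL: "b \<in> CK L" by (rule CK_mono[OF _ bS(2)]) (auto simp: L_def)
    have 1: "convolution \<mu> (h i) b \<in> CK L" if "i \<in> I" for i
      by (rule CK_mono[OF _ convolution_CK[OF hCK[OF that] bS(2) K bS(1)]]) (auto simp: L_def L1_def)
    have 2: "convolution \<mu> b (h i) \<in> CK L" if "i \<in> I" for i
      by (rule CK_mono[OF _ convolution_CK[OF bS(2) hCK[OF that] bS(1) K]]) (auto simp: L_def L2_def)
    show "limitin (lctop (Cc0_algebra \<mu>)) (\<lambda>i. h i \<otimes>\<^bsub>Cc0_algebra \<mu>\<^esub> b) b (tails I D)"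
      using limitin_Cc0_topology[OF lim(1)[OF b] L bL] eventually_mono[OF I 1] by (simp add: Cc0_algebra_def)
    show "limitin (lctop (Cc0_algebra \<mu>)) (\<lambda>i. b \<otimes>\<^bsub>Cc0_algebra \<mu>\<^esub> h i) b (tails I D)"
      using limitin_Cc0_topology[OF lim(2)[OF b] L bL] eventually_mono[OF I 2] by (simp add: Cc0_algebra_def)
  qed
  moreover have "A.bounded_subset (h ` I)"
    by (rule bounded_subset_Cc0[OF K, of _ M]) (use h0 hCK M in auto)
  ultimately show ?thesis unfolding A.has_bounded_approximate_identity_def by blast
qed

section \<open>Compact groups: unimodularity and approximate units\<close>

context
  assumes compact_UNIV: "compact (UNIV :: 'a set)"
begin

lemma integrable_continuous:
  fixes f :: "'a \<Rightarrow> 'b::{banach, second_countable_topology}"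
  shows "continuous_on UNIV f \<Longrightarrow> integrable \<mu> f"
  by (rule integrable_continuous_compact[OF _ compact_UNIV]) auto

lemma measure_UNIV_pos: "measure \<mu> UNIV > 0"
  using emeasure_open_pos[of UNIV] emeasure_compact[OF compact_UNIV]
  by (simp add: measure_def enn2real_positive_iff)

text \<open>Unimodularity of compact groups: integrate \<open>f (- s + t)\<close> over \<open>s\<close> and \<open>t\<close> in both orders.\<close>

lemma integral_uminus:
  fixes f :: "'a \<Rightarrow> 'b::{banach, second_countable_topology}"
  assumes f: "continuous_on UNIV f"
  shows "(\<integral>s. f (- s) \<partial>\<mu>) = (\<integral>s. f s \<partial>\<mu>)"
proof -
  define F where "F p = f (- fst p + snd p)" for p
  have F: "continuous_on UNIV F"
    unfolding F_def by (rule continuous_on_compose2[OF f]) (auto intro!: continuous_intros)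
  have "(\<integral>t. (\<integral>s. F (s, t) \<partial>\<mu>) \<partial>\<mu>) = (\<integral>s. (\<integral>t. F (s, t) \<partial>\<mu>) \<partial>\<mu>)"
    by (rule integral_swap[OF F compact_UNIV _ compact_UNIV]) auto
  moreover have "(\<integral>t. F (s, t) \<partial>\<mu>) = (\<integral>t. f t \<partial>\<mu>)" for s
    using integral_left_translate[OF f, of "- s"] by (simp add: F_def)
  \<comment> \<open>The substitution s \<mapsto> t + s turns -s + t into -s, so this inner integral
    does not depend on t. Both iterated integrals are then \<open>measure \<mu> UNIV\<close> times a
    constant.\<close>
  moreover have "(\<integral>s. F (s, t) \<partial>\<mu>) = (\<integral>s. f (- s) \<partial>\<mu>)" for t
  proof -
    have "continuous_on UNIV (\<lambda>s. f (- s + t))"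
      by (rule continuous_on_compose2[OF f]) (auto intro!: continuous_intros)
    from integral_left_translate[OF this, of t] show ?thesis
      by (simp only: F_def fst_conv snd_conv minus_add add.assoc) simp
  qed
  ultimately show ?thesis using measure_UNIV_pos by simp
qed

text \<open>Unimodularity enters here. Together with \<open>convolution_const_right\<close> this
  shows that constants annihilate \<open>Cc0\<close> from both sides, so subtracting a constant
  moves an approximate unit into \<open>Cc0\<close> without changing its products.\<close>

lemma convolution_const_left:
  assumes "continuous_on UNIV b"
  shows "convolution \<mu> (\<lambda>t. c) b = (\<lambda>t. c * haar_integral \<mu> b)"
proof
  fix t
  have "continuous_on UNIV (\<lambda>s. b (- s + t))"
    by (rule continuous_on_compose2[OF assms]) (auto intro!: continuous_intros)
  from integral_left_translate[OF this, of t]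
  have "(\<integral>s. b (- s + t) \<partial>\<mu>) = (\<integral>s. b (- s) \<partial>\<mu>)"
    by (simp only: minus_add add.assoc) simp
  then show "convolution \<mu> (\<lambda>t. c) b t = c * haar_integral \<mu> b"
    by (simp add: convolution_def haar_integral_def integral_uminus[OF assms])
qed

lemma convolution_const_right: "convolution \<mu> b (\<lambda>t. c) = (\<lambda>t. haar_integral \<mu> b * c)"
  by (simp add: convolution_def haar_integral_def fun_eq_iff)

text \<open>Uniform continuity, by the tube lemma over the compact group. Left and right translates
  are treated together because the group need not be commutative.\<close>

lemma uniform_neighbourhood:
  fixes b :: "'a \<Rightarrow> complex"
  assumes b: "continuous_on UNIV b" and e: "e > 0"
  shows "\<exists>V. open V \<and> 0 \<in> V \<and> (\<forall>s\<in>V. \<forall>t. cmod (b (- s + t) - b t) < e \<and> cmod (b (t + - s) - b t) < e)"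
proof -
  define W where "W = {p. cmod (b (- fst p + snd p) - b (snd p)) < e} \<inter> {p. cmod (b (snd p + - fst p) - b (snd p)) < e}"
  have W: "open W"
    unfolding W_def by (intro open_Int open_Collect_less continuous_on_const continuous_on_norm continuous_on_diff
        continuous_on_compose2[OF b] continuous_intros) auto
  have sub: "{0} \<times> UNIV \<subseteq> W" using e by (auto simp: W_def)
  obtain V where V: "0 \<in> V" "open V" "V \<times> UNIV \<subseteq> W"
    using Elementary_Topology.tube_lemma[OF compact_UNIV W sub] by (elim exE conjE)
  have "cmod (b (- s + t) - b t) < e \<and> cmod (b (t + - s) - b t) < e" if "s \<in> V" for s t
  proof -
    have "(s, t) \<in> W" using V(3) that by blast
    then show ?thesis by (simp add: W_def)
  qed
  then show ?thesis using V by blast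
qed

text \<open>The weight u is a probability density, so the integral averages values that lie within e
  of c.\<close>

lemma norm_weighted_integral_le:
  fixes u :: "'a \<Rightarrow> real" and g :: "'a \<Rightarrow> complex"
  assumes u: "continuous_on UNIV u" "\<And>s. 0 \<le> u s" "(\<integral>s. u s \<partial>\<mu>) = 1" and g: "continuous_on UNIV g"
    and le: "\<And>s. u s \<noteq> 0 \<Longrightarrow> cmod (g s - c) \<le> e"
  shows "cmod ((\<integral>s. complex_of_real (u s) * g s \<partial>\<mu>) - c) \<le> e"
proof -
  have i1: "integrable \<mu> (\<lambda>s. complex_of_real (u s) * g s)" "integrable \<mu> (\<lambda>s. complex_of_real (u s) * c)"
    "integrable \<mu> (\<lambda>s. u s * e)" "integrable \<mu> (\<lambda>s. complex_of_real (u s))"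
    by (auto intro!: integrable_continuous continuous_intros u g)
  have "cmod ((\<integral>s. complex_of_real (u s) * g s \<partial>\<mu>) - c) = cmod (\<integral>s. complex_of_real (u s) * g s - complex_of_real (u s) * c \<partial>\<mu>)"
    by (subst Bochner_Integration.integral_diff[OF i1(1,2)]) (simp add: u(3))
  also have "\<dots> \<le> (\<integral>s. cmod (complex_of_real (u s) * g s - complex_of_real (u s) * c) \<partial>\<mu>)"
    by (rule integral_norm_bound)
  also have "\<dots> \<le> (\<integral>s. u s * e \<partial>\<mu>)"
  proof (rule integral_mono[OF integrable_norm[OF Bochner_Integration.integrable_diff[OF i1(1,2)]] i1(3)])
    fix s
    show "cmod (complex_of_real (u s) * g s - complex_of_real (u s) * c) \<le> u s * e"
    proof (cases "u s = 0")
      case False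
      have "cmod (complex_of_real (u s) * g s - complex_of_real (u s) * c) = u s * cmod (g s - c)"
        using u(2)[of s] by (simp add: right_diff_distrib[symmetric] norm_mult)
      then show ?thesis using le[OF False] u(2)[of s] by (simp add: mult_left_mono)
    qed simp
  qed
  also have "\<dots> = e" using u(3) by simp
  finally show ?thesis .
qed

lemma L1_norm_le_sup:
  assumes "f \<in> Cc" "\<And>t. cmod (f t) \<le> e"
  shows "L1_norm \<mu> f \<le> e * measure \<mu> UNIV"
proof -
  have "L1_norm \<mu> f \<le> (\<integral>t. e \<partial>\<mu>)"
    unfolding L1_norm_def using assms
    by (intro integral_mono integrable_norm_Cc integrable_continuous continuous_intros) auto
  then show ?thesis by (simp add: mult.commute)
qed

text \<open>Splitting h into the bump v and the constant k gives the bound 2 = 1 + 1 and reduces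
  both products to v, because k annihilates b. What remains are averages of translates of b:
  directly on one side, and on the other after the substitution s \<mapsto> t + s, where the density
  becomes u(-s), of integral one by unimodularity.\<close>

lemma approximate_unit_estimate:
  fixes u :: "'a \<Rightarrow> real"
  assumes u: "continuous_on UNIV u" "\<And>s. 0 \<le> u s" "(\<integral>s. u s \<partial>\<mu>) = 1" "\<And>s. s \<notin> V \<Longrightarrow> u s = 0"
    and b: "b \<in> Cc0 \<mu>"
    and V: "\<And>s t. s \<in> V \<Longrightarrow> cmod (b (- s + t) - b t) < e \<and> cmod (b (t + - s) - b t) < e"
  defines "h \<equiv> \<lambda>t. complex_of_real (u t - 1 / measure \<mu> UNIV)"
  shows "h \<in> Cc0 \<mu>" "L1_norm \<mu> h \<le> 2"
    "L1_norm \<mu> (\<lambda>t. convolution \<mu> h b t - b t) \<le> e * measure \<mu> UNIV"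
    "L1_norm \<mu> (\<lambda>t. convolution \<mu> b h t - b t) \<le> e * measure \<mu> UNIV"
proof -
  define m where "m = measure \<mu> UNIV"
  have m: "m > 0" using measure_UNIV_pos by (simp add: m_def)
  define v k where "v t = complex_of_real (u t)" and "k t = - complex_of_real (1 / m)" for t :: 'a
  have vc: "continuous_on UNIV v" and kc: "continuous_on UNIV k"
    unfolding v_def[abs_def] k_def[abs_def] by (auto intro!: continuous_intros u)
  have v: "v \<in> Cc" and k: "k \<in> Cc" using vc kc by (auto intro!: CcI[OF _ compact_UNIV])
  have h: "h = (\<lambda>t. v t + k t)" by (simp add: h_def v_def k_def m_def fun_eq_iff)
  have bc: "b \<in> Cc" "continuous_on UNIV b" and b0: "haar_integral \<mu> b = 0"
    using b CcD(1) by (auto simp: Cc0_def)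
  have hc: "h \<in> Cc" unfolding h by (rule Cc_add[OF v k])
  have int_v: "haar_integral \<mu> v = 1" "L1_norm \<mu> v = 1"
    using u(2,3) by (simp_all add: haar_integral_def L1_norm_def v_def)
  have int_k: "haar_integral \<mu> k = - 1" "L1_norm \<mu> k = 1"
    using m by (simp_all add: haar_integral_def L1_norm_def k_def m_def norm_divide scaleR_conv_of_real)
  have "haar_integral \<mu> h = haar_integral \<mu> v + haar_integral \<mu> k"
    unfolding h using linear_mapD(2)[OF linear_map_haar_integral] v k by simp
  then show "h \<in> Cc0 \<mu>" using hc int_v int_k by (simp add: Cc0_def)
  show "L1_norm \<mu> h \<le> 2" using L1_norm_add[OF v k] int_v int_k by (simp add: h)
  have "convolution \<mu> k b = (\<lambda>t. 0)" "convolution \<mu> b k = (\<lambda>t. 0)"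
    unfolding k_def[abs_def] convolution_const_left[OF bc(2)] convolution_const_right by (simp_all add: b0)
  then have hb: "convolution \<mu> h b = convolution \<mu> v b" and bh: "convolution \<mu> b h = convolution \<mu> b v"
    using convolution_add_left[OF v k bc(2)] convolution_add_right[OF bc(1) vc kc] by (simp_all add: h)
  have diff: "(\<lambda>t. f t - b t) \<in> Cc" if "f \<in> Cc" for f
    using Cc_add[OF that Cc_smult[OF bc(1), of "-1"]] by simp
  show "L1_norm \<mu> (\<lambda>t. convolution \<mu> h b t - b t) \<le> e * measure \<mu> UNIV"
    unfolding hb
  proof (rule L1_norm_le_sup[OF diff[OF convolution_Cc[OF v bc(1)]]])
    fix t
    have "continuous_on UNIV (\<lambda>s. b (- s + t))"
      by (rule continuous_on_compose2[OF bc(2)]) (auto intro!: continuous_intros)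
    moreover have "cmod (b (- s + t) - b t) \<le> e" if "u s \<noteq> 0" for s
      using V[of s t] u(4)[of s] that by force
    ultimately show "cmod (convolution \<mu> v b t - b t) \<le> e"
      unfolding convolution_def v_def by (intro norm_weighted_integral_le[OF u(1,2,3)])
  qed
  show "L1_norm \<mu> (\<lambda>t. convolution \<mu> b h t - b t) \<le> e * measure \<mu> UNIV"
    unfolding bh
  proof (rule L1_norm_le_sup[OF diff[OF convolution_Cc[OF bc(1) v]]])
    fix t
    have "continuous_on UNIV (\<lambda>s. b s * v (- s + t))"
      by (intro continuous_on_mult bc(2) continuous_on_compose2[OF vc] continuous_intros) auto
    from integral_left_translate[OF this, of t]
    have "convolution \<mu> b v t = (\<integral>s. complex_of_real (u (- s)) * b (t + s) \<partial>\<mu>)"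
      unfolding convolution_def minus_add add.assoc v_def by (simp add: mult.commute)
    moreover have "cmod ((\<integral>s. complex_of_real (u (- s)) * b (t + s) \<partial>\<mu>) - b t) \<le> e"
    proof (rule norm_weighted_integral_le)
      show "continuous_on UNIV (\<lambda>s. u (- s))"
        by (rule continuous_on_compose2[OF u(1)]) (auto intro!: continuous_intros)
      show "continuous_on UNIV (\<lambda>s. b (t + s))"
        by (rule continuous_on_compose2[OF bc(2)]) (auto intro!: continuous_intros)
      show "(\<integral>s. u (- s) \<partial>\<mu>) = 1" using integral_uminus[OF u(1)] u(3) by simp
      show "cmod (b (t + s) - b t) \<le> e" if "u (- s) \<noteq> 0" for s
        using V[of "- s" t] u(4)[of "- s"] that by force
    qed (rule u(2))
    ultimately show "cmod (convolution \<mu> b v t - b t) \<le> e" by simp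
  qed
qed

theorem compact_imp_L1_approximate_identity:
  "has_bounded_L1_approximate_identity_in_compact \<mu> TYPE(('a, 'i) net_index)"
proof -
  interpret L: locally_convex_algebra "Cc0_L1_algebra \<mu>" by (rule locally_convex_algebra_Cc0_L1)
  note N = complex_normed_space_L1[OF Cc_subspace_Cc0]
  \<comment> \<open>A neighbourhood is encoded in the prescribed index type by its indicator
    function, paired with the empty set.\<close>
  define code :: "'a set \<Rightarrow> ('a, 'i) net_index" where "code V = Inr (indicator V, {})" for V
  define decode :: "('a, 'i) net_index \<Rightarrow> 'a set" where "decode i = {t. fst (projr i) t \<noteq> 0}" for i
  have decode: "decode (code V) = V" for V by (auto simp: code_def decode_def indicator_def)
  define I where "I = code ` {V. open V \<and> 0 \<in> V}"
  \<comment> \<open>Later indices are smaller neighbourhoods.\<close>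
  define D where "D = {(i, j). decode j \<subseteq> decode i}"
  have "\<forall>V\<in>{V. open V \<and> (0::'a) \<in> V}. \<exists>u :: 'a \<Rightarrow> real. continuous_on UNIV u \<and> (\<forall>t. 0 \<le> u t) \<and> (\<forall>t. t \<notin> V \<longrightarrow> u t = 0) \<and>
     (\<integral>t. u t \<partial>\<mu>) = 1"
  proof
    fix V assume "V \<in> {V. open V \<and> (0::'a) \<in> V}"
    then have V: "open V" "0 \<in> V" by auto
    obtain u :: "'a \<Rightarrow> real" where "continuous_on UNIV u" "\<forall>t. 0 \<le> u t" "\<forall>t. t \<notin> V \<longrightarrow> u t = 0" "(\<integral>t. u t \<partial>\<mu>) = 1"
      using ex_bump[OF V] by (elim exE conjE)
    then show "\<exists>u :: 'a \<Rightarrow> real. continuous_on UNIV u \<and> (\<forall>t. 0 \<le> u t) \<and> (\<forall>t. t \<notin> V \<longrightarrow> u t = 0) \<and>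
     (\<integral>t. u t \<partial>\<mu>) = 1" by (intro exI[of _ u] conjI)
  qed
  from bchoice[OF this] obtain u :: "'a set \<Rightarrow> 'a \<Rightarrow> real" where
    "\<forall>V\<in>{V. open V \<and> 0 \<in> V}. continuous_on UNIV (u V) \<and> (\<forall>t. 0 \<le> u V t) \<and> (\<forall>t. t \<notin> V \<longrightarrow> u V t = 0) \<and>
     (\<integral>t. u V t \<partial>\<mu>) = 1" by (elim exE)
  then have u: "continuous_on UNIV (u V)" "\<And>t. 0 \<le> u V t" "(\<integral>t. u V t \<partial>\<mu>) = 1" "\<And>t. t \<notin> V \<Longrightarrow> u V t = 0"
    if "open V" "0 \<in> V" for V using that by auto
  define h where "h i = (\<lambda>t. complex_of_real (u (decode i) t - 1 / measure \<mu> UNIV))" for i :: "('a, 'i) net_index"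
  have I: "open (decode i) \<and> 0 \<in> decode i" if "i \<in> I" for i
    using that by (auto simp: I_def decode)
  have h: "h i \<in> Cc0 \<mu>" "L1_norm \<mu> (h i) \<le> 2" if "i \<in> I" for i
  proof -
    \<comment> \<open>Membership and norm bound of \<open>h i\<close> are read off with b = 0, for
      which the estimate on translates is trivial.\<close>
    have "(\<lambda>t. 0) \<in> Cc0 \<mu>" using Cc_subspace_Cc0 by (simp add: Cc_subspace_def)
    moreover have io: "open (decode i)" "0 \<in> decode i" using I[OF that] by auto
    ultimately show "h i \<in> Cc0 \<mu>" "L1_norm \<mu> (h i) \<le> 2"
      using approximate_unit_estimate(1,2)[OF u(1,2,3,4)[OF io], where e = 1 and b = "\<lambda>t. 0"] by (simp_all add: h_def)
  qed
  have D: "directed_set I D"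
    unfolding directed_set_def
  proof (intro conjI ballI impI)
    show "I \<noteq> {}" unfolding I_def by blast
    fix i j assume i: "i \<in> I" and j: "j \<in> I"
    have "code (decode i \<inter> decode j) \<in> I"
      unfolding I_def using I[OF i] I[OF j] by (intro imageI) auto
    then show "\<exists>k\<in>I. (i, k) \<in> D \<and> (j, k) \<in> D"
      by (intro bexI[of _ "code (decode i \<inter> decode j)"]) (auto simp: D_def decode)
  qed (auto simp: D_def)
  have lims: "limitin (norm_topology (L1_space \<mu> (Cc0 \<mu>))) (\<lambda>i. convolution \<mu> (h i) b) b (tails I D) \<and>
      limitin (norm_topology (L1_space \<mu> (Cc0 \<mu>))) (\<lambda>i. convolution \<mu> b (h i)) b (tails I D)"
    if b: "b \<in> Cc0 \<mu>" for b
  proof -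
    have bc: "b \<in> Cc" "continuous_on UNIV b" using b CcD(1) by (auto simp: Cc0_def)
    have mult: "convolution \<mu> (h i) b \<in> Cc0 \<mu>" "convolution \<mu> b (h i) \<in> Cc0 \<mu>" if "i \<in> I" for i
      using Cc0_convolution_left[OF h(1)[OF that] bc(1)] Cc0_convolution_left[OF b, of "h i"] h(1)[OF that] Cc0_subset_Cc
      by auto
    have "eventually (\<lambda>i. (convolution \<mu> (h i) b \<in> Cc0 \<mu> \<and>
          L1_norm \<mu> (convolution \<mu> (h i) b \<ominus>\<^bsub>L1_space \<mu> (Cc0 \<mu>)\<^esub> b) < e) \<and>
        (convolution \<mu> b (h i) \<in> Cc0 \<mu> \<and>
          L1_norm \<mu> (convolution \<mu> b (h i) \<ominus>\<^bsub>L1_space \<mu> (Cc0 \<mu>)\<^esub> b) < e)) (tails I D)" if e: "e > 0" for e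
    proof -
      \<comment> \<open>The factor 2 leaves room for the strict inequality in the definition of
        convergence.\<close>
      define d where "d = e / (2 * measure \<mu> UNIV)"
      have d: "d > 0" "d * measure \<mu> UNIV < e" using e measure_UNIV_pos by (auto simp: d_def)
      obtain V where V: "open V" "0 \<in> V"
        "\<forall>s\<in>V. \<forall>t. cmod (b (- s + t) - b t) < d \<and> cmod (b (t + - s) - b t) < d"
        using uniform_neighbourhood[OF bc(2) d(1)] by (elim exE conjE)
      have "code V \<in> I" unfolding I_def using V by blast
      moreover have "(convolution \<mu> (h i) b \<in> Cc0 \<mu> \<and>
          L1_norm \<mu> (convolution \<mu> (h i) b \<ominus>\<^bsub>L1_space \<mu> (Cc0 \<mu>)\<^esub> b) < e) \<and>
        (convolution \<mu> b (h i) \<in> Cc0 \<mu> \<and>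
          L1_norm \<mu> (convolution \<mu> b (h i) \<ominus>\<^bsub>L1_space \<mu> (Cc0 \<mu>)\<^esub> b) < e)"
        if i: "i \<in> I" "(code V, i) \<in> D" for i
      proof -
        have iV: "decode i \<subseteq> V" using i(2) by (simp add: D_def decode)
        have est: "cmod (b (- s + t) - b t) < d \<and> cmod (b (t + - s) - b t) < d" if "s \<in> decode i" for s t
          using V(3) iV that by blast
        have io: "open (decode i)" "0 \<in> decode i" using I[OF i(1)] by auto
        show ?thesis
          using approximate_unit_estimate(3,4)[where V = "decode i" and u = "u (decode i)" and b = b and e = d,
              OF u(1,2,3,4)[OF io] b est] mult[OF i(1)] d(2)
            L1_diff[OF Cc_subspace_Cc0 mult(1)[OF i(1)] b] L1_diff[OF Cc_subspace_Cc0 mult(2)[OF i(1)] b]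
          by (simp add: h_def)
      qed
      ultimately show ?thesis unfolding eventually_tails[OF D] by blast
    qed
    then show ?thesis
      unfolding complex_normed_space.limitin_norm_topology[OF N] using b by (simp add: eventually_conj_iff)
  qed
  have "L.approximate_identity I D h"
    unfolding L.approximate_identity_def using D h(1) lims by (simp add: Cc0_L1_algebra_def)
  then show ?thesis
    unfolding has_bounded_L1_approximate_identity_in_compact_def
    using h(2) by (intro exI[of _ UNIV] conjI compact_UNIV exI[of _ I] exI[of _ D] exI[of _ h] exI[of _ 2]) auto
qed

end

end


section \<open>Amenability of \<open>C\<^sub>c(G)\<close> forces compactness\<close>

context haar
begin

text \<open>The order of integration opposite to \<open>integral_convolution\<close>: f acts on h
  first, and g is integrated last. This is the order in which an anti-representation
  composes.\<close>

lemma integral_convolution':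
  assumes f: "f \<in> Cc" and g: "g \<in> Cc" and h: "continuous_on UNIV h"
  shows "(\<integral>t. convolution \<mu> f g t * h t \<partial>\<mu>) = (\<integral>t. g t * (\<integral>s. f s * h (s + t) \<partial>\<mu>) \<partial>\<mu>)"
proof -
  define F where "F p = f (fst p) * (g (snd p) * h (fst p + snd p))" for p
  note fc = CcD[OF f] and gc = CcD[OF g]
  have F: "continuous_on UNIV F"
    unfolding F_def by (intro continuous_on_mult continuous_on_compose2[OF fc(1)] continuous_on_compose2[OF gc(1)]
      continuous_on_compose2[OF h] continuous_intros) auto
  have 1: "F (s, t) = 0" if "s \<notin> supp f" for s t using that by (simp add: F_def supp_outside)
  have 2: "F (s, t) = 0" if "t \<notin> supp g" for s t using that by (simp add: F_def supp_outside)
  have "(\<integral>t. convolution \<mu> f g t * h t \<partial>\<mu>) = (\<integral>s. (\<integral>t. F (s, t) \<partial>\<mu>) \<partial>\<mu>)"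
    by (simp add: integral_convolution[OF f g h] F_def)
  also have "\<dots> = (\<integral>t. (\<integral>s. F (s, t) \<partial>\<mu>) \<partial>\<mu>)"
    by (rule integral_swap[OF F fc(2) 1 gc(2) 2, symmetric])
  also have "\<dots> = (\<integral>t. g t * (\<integral>s. f s * h (s + t) \<partial>\<mu>) \<partial>\<mu>)"
  proof (rule Bochner_Integration.integral_cong[OF refl])
    fix t
    have "F (s, t) = g t * (f s * h (s + t))" for s by (simp add: F_def)
    then show "(\<integral>s. F (s, t) \<partial>\<mu>) = g t * (\<integral>s. f s * h (s + t) \<partial>\<mu>)" by simp
  qed
  finally show ?thesis .
qed

text \<open>The bound on g is asked for only where a does not vanish; g itself may be unbounded, as
  functions in the weighted space are.\<close>

lemma norm_integral_Cc_le:
  assumes a: "a \<in> Cc" and g: "continuous_on UNIV g" and le: "\<And>s. a s \<noteq> 0 \<Longrightarrow> cmod (g s) \<le> C"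
  shows "cmod (\<integral>s. a s * g s \<partial>\<mu>) \<le> C * L1_norm \<mu> a"
proof -
  note ac = CcD[OF a]
  have i: "integrable \<mu> (\<lambda>s. a s * g s)"
    by (rule integrable_continuous_compact[OF continuous_on_mult[OF ac(1) g] ac(2)]) (simp add: supp_outside)
  have "cmod (\<integral>s. a s * g s \<partial>\<mu>) \<le> (\<integral>s. cmod (a s * g s) \<partial>\<mu>)" by (rule integral_norm_bound)
  also have "\<dots> \<le> (\<integral>s. C * cmod (a s) \<partial>\<mu>)"
  proof (rule integral_mono[OF integrable_norm[OF i]])
    show "integrable \<mu> (\<lambda>s. C * cmod (a s))" using integrable_norm_Cc[OF a] by simp
    show "cmod (a s * g s) \<le> C * cmod (a s)" for s
      using le[of s] by (cases "a s = 0") (auto simp: norm_mult mult.commute intro: mult_right_mono)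
  qed
  also have "\<dots> = C * L1_norm \<mu> a" by (simp add: L1_norm_def)
  finally show ?thesis .
qed

lemma ex_symmetric_neighbourhood:
  fixes C :: "'a set"
  assumes "compact C"
  shows "\<exists>V L. open V \<and> compact L \<and> C \<subseteq> V \<and> V \<subseteq> L \<and> (\<forall>x\<in>V. - x \<in> V)"
proof -
  obtain U L where UL: "open U" "compact L" "C \<subseteq> U" "U \<subseteq> L"
    using ex_compact_neighbourhood[OF assms] by (elim exE conjE)
  have "open (uminus -` U)"
    by (intro open_vimage UL continuous_intros)
  moreover have "uminus -` U \<subseteq> uminus ` L"
    using UL(4) by (auto simp: image_iff intro!: bexI[of _ "- x" for x])
  ultimately show ?thesis
    using UL compact_group_uminus[OF UL(2)]
    by (intro exI[of _ "U \<union> uminus -` U"] exI[of _ "L \<union> uminus ` L"] conjI open_Un compact_Un) auto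
qed

text \<open>Recursive choice: the next neighbourhood is taken around \<open>K n\<close> and all sums
  of two elements of \<open>L n\<close>. Absorbing sums from the compact hulls \<open>L n\<close>,
  and not just from \<open>U n\<close>, puts \<open>L n\<close> inside \<open>U (Suc n)\<close> and
  leaves room for a cutoff function between them.\<close>

lemma ex_exhaustion:
  fixes K :: "nat \<Rightarrow> 'a set"
  assumes K: "\<And>n. compact (K n)" "(\<Union>n. K n) = UNIV"
  shows "\<exists>U L :: nat \<Rightarrow> 'a set. (\<forall>n. open (U n) \<and> compact (L n) \<and> U n \<subseteq> L n \<and> 0 \<in> U n \<and> (\<forall>x\<in>U n. - x \<in> U n)) \<and>
    (\<forall>n. \<forall>x\<in>L n. \<forall>y\<in>L n. x + y \<in> U (Suc n)) \<and> (\<Union>n. U n) = UNIV"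
proof -
  \<comment> \<open>\<open>P\<close> is the invariant of a stage, \<open>Q\<close> the relation
    between consecutive stages, in the form that dependent choice requires.\<close>
  define P where "P = (\<lambda>(n::nat) (V, L). open V \<and> compact L \<and> V \<subseteq> L \<and> (0::'a) \<in> V \<and> (\<forall>x\<in>V. - x \<in> V))"
  define Q where "Q = (\<lambda>n (V :: 'a set, L) (V', L' :: 'a set). K n \<subseteq> V' \<and> (\<forall>x\<in>L. \<forall>y\<in>L. x + y \<in> V'))"
  have "\<exists>f. \<forall>n. P n (f n) \<and> Q n (f n) (f (Suc n))"
  proof (rule dependent_nat_choice)
    obtain V L where "open V" "compact L" "{0::'a} \<subseteq> V" "V \<subseteq> L" "\<forall>x\<in>V. - x \<in> V"
      using ex_symmetric_neighbourhood[OF compact_sing[of 0]] by (elim exE conjE)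
    then have "P 0 (V, L)" by (simp add: P_def)
    then show "\<exists>x. P 0 x" by blast
  next
    fix x n assume "P n x"
    obtain V L where x: "x = (V, L)" by (cases x)
    then have VL: "open V" "compact L" "V \<subseteq> L" "0 \<in> V" using \<open>P n x\<close> by (simp_all add: P_def)
    have "compact (K n \<union> {x + y | x y. x \<in> L \<and> y \<in> L})"
      by (intro compact_Un K compact_group_sums VL)
    from ex_symmetric_neighbourhood[OF this]
    obtain V' L' where V': "open V'" "compact L'" "K n \<union> {x + y | x y. x \<in> L \<and> y \<in> L} \<subseteq> V'" "V' \<subseteq> L'" "\<forall>x\<in>V'. - x \<in> V'"
      by (elim exE conjE)
    have sums: "x + y \<in> V'" if "x \<in> L" "y \<in> L" for x y using V'(3) that by blast
    have "0 + 0 \<in> V'" using VL(3,4) by (intro sums) auto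
    then have "P (Suc n) (V', L')" using V' by (simp add: P_def)
    moreover have "Q n x (V', L')" using V'(3) sums by (simp add: Q_def x)
    ultimately show "\<exists>y. P (Suc n) y \<and> Q n x y" by blast
  qed
  then obtain f where f: "\<forall>n. P n (f n)" "\<forall>n. Q n (f n) (f (Suc n))" by blast
  define U L where "U n = fst (f n)" and "L n = snd (f n)" for n
  have P: "open (U n) \<and> compact (L n) \<and> U n \<subseteq> L n \<and> 0 \<in> U n \<and> (\<forall>x\<in>U n. - x \<in> U n)" for n
    using f(1)[rule_format, of n] by (simp add: P_def U_def L_def case_prod_beta')
  have Q: "K n \<subseteq> U (Suc n)" "\<forall>x\<in>L n. \<forall>y\<in>L n. x + y \<in> U (Suc n)" for n
    using f(2)[rule_format, of n] by (simp_all add: Q_def U_def L_def case_prod_beta')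
  have "(\<Union>n. U n) = UNIV"
  proof
    show "UNIV \<subseteq> (\<Union>n. U n)" unfolding K(2)[symmetric] using Q(1) by (intro UN_least) blast
  qed simp
  then show ?thesis
    using allI[of "\<lambda>n. open (U n) \<and> compact (L n) \<and> U n \<subseteq> L n \<and> 0 \<in> U n \<and> (\<forall>x\<in>U n. - x \<in> U n)", OF P]
      allI[of "\<lambda>n. \<forall>x\<in>L n. \<forall>y\<in>L n. x + y \<in> U (Suc n)", OF Q(2)]
    by (rule_tac exI[of _ U], rule_tac exI[of _ L]) (intro conjI)
qed

end

locale haar_exhaustion = haar \<mu> for \<mu> :: "'a::{topological_group_add, t2_space} measure" +
  fixes U L :: "nat \<Rightarrow> 'a set"
  assumes open_U: "open (U n)" and compact_L: "compact (L n)" and U_subset_L: "U n \<subseteq> L n"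
    and zero_U: "0 \<in> U n" and uminus_U: "x \<in> U n \<Longrightarrow> - x \<in> U n"
    and add_L: "x \<in> L n \<Longrightarrow> y \<in> L n \<Longrightarrow> x + y \<in> U (Suc n)"
    and Union_U: "(\<Union>n. U n) = UNIV"
begin

lemma L_subset_U: "L n \<subseteq> U (Suc n)"
  using add_L[of _ n 0] zero_U U_subset_L by (auto simp: subset_iff)

lemma U_mono: "m \<le> n \<Longrightarrow> U m \<subseteq> U n"
  by (rule lift_Suc_mono_le[of U]) (use L_subset_U U_subset_L in blast)

section \<open>A weight built from the exhaustion\<close>

definition level :: "'a \<Rightarrow> nat" where
  "level t = (LEAST n. t \<in> U n)"

lemma level_le_iff: "level t \<le> n \<longleftrightarrow> t \<in> U n"
proof
  assume "level t \<le> n"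
  moreover have "\<exists>n. t \<in> U n" using Union_U by auto
  then have "t \<in> U (level t)" unfolding level_def by (rule LeastI_ex)
  ultimately show "t \<in> U n" using U_mono by blast
qed (simp add: level_def Least_le)

text \<open>\<open>level\<close> behaves like the logarithm of a length function: forming a sum
  costs one level beyond the larger of the two.\<close>

lemma level_add: "level (s + t) \<le> Suc (max (level s) (level t))"
proof -
  have "s \<in> U (max (level s) (level t))" "t \<in> U (max (level s) (level t))"
    by (simp_all flip: level_le_iff)
  then show ?thesis using add_L U_subset_L by (simp add: level_le_iff subset_iff)
qed

lemma compact_subset_U: "compact C \<Longrightarrow> \<exists>n. C \<subseteq> U n"
proof -
  assume C: "compact C"
  obtain I where I: "finite I" "C \<subseteq> (\<Union>n\<in>I. U n)"
    using compactE_image[OF C, of UNIV U] open_U Union_U by auto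
  have "C \<subseteq> U (Max I)"
  proof
    fix x assume "x \<in> C"
    then obtain n where "n \<in> I" "x \<in> U n" using I by blast
    then show "x \<in> U (Max I)" using U_mono[OF Max_ge[OF I(1)]] by blast
  qed
  then show ?thesis by blast
qed

text \<open>Linear in \<open>level\<close>, so that it is at least n + 2 off \<open>U n\<close> and
  yet changes by at most a bounded factor under translation by a compact set. The summand 1 makes
  division by it harmless.\<close>

definition weight :: "'a \<Rightarrow> real" where
  "weight t = 1 + real (level t)"

lemma weight_ge_1: "1 \<le> weight t"
  by (simp add: weight_def)

lemma weight_pos [simp]: "0 < weight t" "0 \<le> weight t" "weight t \<noteq> 0"
  using weight_ge_1[of t] by auto

lemma weight_le: "t \<in> U n \<Longrightarrow> weight t \<le> real n + 1"
  by (simp add: weight_def level_le_iff[symmetric])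

lemma weight_ge: "t \<notin> U n \<Longrightarrow> real n + 2 \<le> weight t"
  by (simp add: weight_def level_le_iff[symmetric])

text \<open>The maximum in \<open>level_add\<close> is replaced by the sum, giving 2 + n + level t,
  which (n + 2)(1 + level t) dominates.\<close>

lemma weight_add_le:
  assumes "s \<in> U n"
  shows "weight (s + t) \<le> (real n + 2) * weight t"
proof -
  have "level s \<le> n" using assms by (simp add: level_le_iff)
  then have "level (s + t) \<le> 1 + n + level t" using level_add[of s t] by linarith
  then have "weight (s + t) \<le> 2 + real n + real (level t)" by (simp add: weight_def)
  also have "\<dots> \<le> (real n + 2) * weight t" by (simp add: weight_def algebra_simps)
  finally show ?thesis .
qed

text \<open>The condition \<open>f 0 = 0\<close> selects one representative from each class modulo
  constants.\<close>

definition W :: "('a \<Rightarrow> complex) set" where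
  "W = {f. continuous_on UNIV f \<and> f 0 = 0 \<and> (\<exists>C. \<forall>t. cmod (f t) \<le> C * weight t)}"

definition W_norm :: "('a \<Rightarrow> complex) \<Rightarrow> real" where
  "W_norm f = (SUP t. cmod (f t) / weight t)"

lemma W_cont: "f \<in> W \<Longrightarrow> continuous_on UNIV f"
  by (simp add: W_def)

lemma WI: "continuous_on UNIV f \<Longrightarrow> f 0 = 0 \<Longrightarrow> (\<And>t. cmod (f t) \<le> C * weight t) \<Longrightarrow> f \<in> W"
  by (auto simp: W_def)

lemma W_norm_le: "(\<And>t. cmod (f t) \<le> C * weight t) \<Longrightarrow> W_norm f \<le> C"
  unfolding W_norm_def by (rule cSUP_least) (auto simp: divide_simps)

lemma W_bound:
  assumes "f \<in> W"
  shows "cmod (f t) \<le> W_norm f * weight t"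
proof -
  obtain C where C: "\<And>t. cmod (f t) \<le> C * weight t" using assms by (auto simp: W_def)
  have "bdd_above (range (\<lambda>t. cmod (f t) / weight t))"
    using C by (intro bdd_aboveI2[of _ _ C]) (simp add: divide_simps)
  then have "cmod (f t) / weight t \<le> W_norm f" unfolding W_norm_def by (intro cSUP_upper) auto
  then show ?thesis by (simp add: divide_simps)
qed

lemma W_norm_nonneg: "f \<in> W \<Longrightarrow> 0 \<le> W_norm f"
  using order_trans[OF norm_ge_zero W_bound, of f 0] weight_pos(1)[of 0] by (simp add: zero_le_mult_iff)

lemma W_zero: "(\<lambda>t. 0) \<in> W"
  by (rule WI[where C = 0]) auto

lemma W_smult: "f \<in> W \<Longrightarrow> (\<lambda>t. c * f t) \<in> W"
  using W_bound[of f] by (intro WI[where C = "cmod c * W_norm f"])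
    (auto simp: W_def norm_mult mult.assoc intro!: continuous_intros mult_left_mono)

lemma W_add_bound:
  assumes "f \<in> W" "g \<in> W"
  shows "cmod (f t + g t) \<le> (W_norm f + W_norm g) * weight t"
  using norm_triangle_ineq[of "f t" "g t"] W_bound[OF assms(1), of t] W_bound[OF assms(2), of t]
  by (simp add: algebra_simps)

lemma W_add: "f \<in> W \<Longrightarrow> g \<in> W \<Longrightarrow> (\<lambda>t. f t + g t) \<in> W"
  by (rule WI[OF _ _ W_add_bound]) (auto simp: W_def intro!: continuous_intros)

lemma W_norm_smult:
  assumes "f \<in> W"
  shows "W_norm (\<lambda>t. c * f t) = cmod c * W_norm f"
proof -
  have le: "W_norm (\<lambda>t. c * f t) \<le> cmod c * W_norm f" if "f \<in> W" for c f
    using W_bound[OF that] by (intro W_norm_le) (auto simp: norm_mult mult.assoc intro!: mult_left_mono)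
  show ?thesis
  proof (cases "c = 0")
    case True
    then show ?thesis using le[OF assms, of c] W_norm_nonneg[OF W_smult[OF assms], of c] by simp
  next
    case False
    then have "W_norm f \<le> cmod (inverse c) * W_norm (\<lambda>t. c * f t)"
      using le[OF W_smult[OF assms, of c], of "inverse c"] by (simp add: mult.assoc[symmetric])
    then show ?thesis using le[OF assms, of c] False by (simp add: norm_inverse norm_divide field_simps)
  qed
qed

text \<open>The Banach space has to live in the carrier type over which amenability quantifies,
  hence the functions are tagged with \<open>Inr\<close>.\<close>

definition WE :: "('u + ('a \<Rightarrow> complex)) normed_module" where
  "WE = \<lparr>carrier = Inr ` W, mult = undefined, one = undefined, zero = Inr (\<lambda>t. 0),
     add = (\<lambda>x y. Inr (\<lambda>t. projr x t + projr y t)), smult = (\<lambda>c x. Inr (\<lambda>t. c * projr x t)),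
     nrm = (\<lambda>x. W_norm (projr x))\<rparr>"

lemma WE_simps [simp]:
  "carrier WE = Inr ` W" "zero WE = Inr (\<lambda>t. 0)" "add WE x y = Inr (\<lambda>t. projr x t + projr y t)"
  "smult WE c x = Inr (\<lambda>t. c * projr x t)" "nrm WE x = W_norm (projr x)"
  by (simp_all add: WE_def)

lemma complex_normed_space_WE:
  "complex_normed_space (WE :: ('u + ('a \<Rightarrow> complex)) normed_module)" (is "complex_normed_space ?E")
proof (intro complex_normed_space.intro complex_normed_space_axioms.intro)
  show "module complex_field ?E"
    by (rule function_module[where j = Inr and S = W]) (auto simp: W_zero W_add W_smult)
  fix x assume "x \<in> carrier ?E"
  then obtain f where f: "f \<in> W" "x = Inr f" by auto
  show "0 \<le> nrm ?E x" using f W_norm_nonneg by simp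
  show "(nrm ?E x = 0) = (x = \<zero>\<^bsub>?E\<^esub>)"
  proof
    assume "nrm ?E x = 0"
    then have "f t = 0" for t using W_bound[OF f(1), of t] f by simp
    then show "x = \<zero>\<^bsub>?E\<^esub>" using f by auto
  next
    assume "x = \<zero>\<^bsub>?E\<^esub>"
    then show "nrm ?E x = 0" using W_norm_nonneg[OF W_zero] W_norm_le[of "\<lambda>t. 0" 0] by simp
  qed
  show "nrm ?E (c \<odot>\<^bsub>?E\<^esub> x) = cmod c * nrm ?E x" for c
    using f by (simp add: W_norm_smult)
  fix y assume "y \<in> carrier ?E"
  then obtain g where g: "g \<in> W" "y = Inr g" by auto
  show "nrm ?E (x \<oplus>\<^bsub>?E\<^esub> y) \<le> nrm ?E x + nrm ?E y"
    using f g by (auto intro!: W_norm_le W_add_bound)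
qed

lemma WE_diff:
  assumes "f \<in> W" "g \<in> W"
  shows "(Inr f :: 'u + ('a \<Rightarrow> complex)) \<ominus>\<^bsub>WE\<^esub> Inr g = Inr (\<lambda>t. f t - g t)"
  using complex_normed_space.diff_eq_smult[OF complex_normed_space_WE, of "Inr f" "Inr g"] assms by simp

text \<open>Weighted uniform convergence is uniform on each \<open>U k\<close>, where the weight is
  at most k + 1. The \<open>U k\<close> are open and cover the group, so the limit is
  continuous.\<close>

lemma W_complete:
  assumes f: "\<And>n. f n \<in> W"
    and Cauchy: "\<And>e. e > 0 \<Longrightarrow> \<exists>N::nat. \<forall>m\<ge>N. \<forall>n\<ge>N. \<forall>t. cmod (f m t - f n t) \<le> e * weight t"
  shows "\<exists>g\<in>W. \<forall>e>0. \<exists>N. \<forall>n\<ge>N. \<forall>t. cmod (f n t - g t) \<le> e * weight t"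
proof -
  have "convergent (\<lambda>n. f n t)" for t
  proof -
    have "Cauchy (\<lambda>n. f n t)"
    proof (rule metric_CauchyI)
      fix e :: real assume e: "e > 0"
      then have "e / (2 * weight t) > 0" by simp
      from Cauchy[OF this] obtain N where N: "\<forall>m\<ge>N. \<forall>n\<ge>N. \<forall>t'. cmod (f m t' - f n t') \<le> e / (2 * weight t) * weight t'"
        by (elim exE)
      have "dist (f m t) (f n t) < e" if "m \<ge> N" "n \<ge> N" for m n
        using N[rule_format, OF that, of t] e by (simp add: dist_norm)
      then show "\<exists>M. \<forall>m\<ge>M. \<forall>n\<ge>M. dist (f m t) (f n t) < e" by blast
    qed
    then show ?thesis by (rule Cauchy_convergent)
  qed
  then have g: "(\<lambda>n. f n t) \<longlonglongrightarrow> lim (\<lambda>n. f n t)" for t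
    by (simp add: convergent_LIMSEQ_iff)
  define g where "g t = lim (\<lambda>n. f n t)" for t
  have close: "\<exists>N. \<forall>n\<ge>N. \<forall>t. cmod (f n t - g t) \<le> e * weight t" if e: "e > 0" for e
  proof -
    obtain N where N: "\<forall>m\<ge>N. \<forall>n\<ge>N. \<forall>t. cmod (f m t - f n t) \<le> e * weight t"
      using Cauchy[OF e] by (elim exE)
    have "cmod (f n t - g t) \<le> e * weight t" if n: "n \<ge> N" for n t
    proof (rule LIMSEQ_le_const2)
      show "(\<lambda>m. cmod (f n t - f m t)) \<longlonglongrightarrow> cmod (f n t - g t)"
        unfolding g_def by (intro tendsto_intros g)
      show "\<exists>M. \<forall>m\<ge>M. cmod (f n t - f m t) \<le> e * weight t" using N n by blast
    qed
    then show ?thesis by blast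
  qed
  have "continuous_on (\<Union>k\<in>UNIV. U k) g"
  proof (rule continuous_on_open_UN)
    fix k
    have "uniform_limit (U k) f g sequentially"
    proof (rule uniform_limitI)
      fix e :: real assume e: "e > 0"
      then have "e / (2 * (real k + 1)) > 0" by simp
      from close[OF this] obtain N where N: "\<forall>n\<ge>N. \<forall>t. cmod (f n t - g t) \<le> e / (2 * (real k + 1)) * weight t"
        by (elim exE)
      have "dist (f n t) (g t) < e" if n: "n \<ge> N" and t: "t \<in> U k" for n t
      proof -
        have "cmod (f n t - g t) \<le> e / (2 * (real k + 1)) * weight t" using N n by blast
        also have "\<dots> \<le> e / (2 * (real k + 1)) * (real k + 1)"
          using weight_le[OF t] e by (intro mult_left_mono) auto
        also have "\<dots> < e" using e by (simp add: divide_simps)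
        finally show ?thesis by (simp add: dist_norm)
      qed
      then show "\<forall>\<^sub>F n in sequentially. \<forall>t\<in>U k. dist (f n t) (g t) < e"
        unfolding eventually_sequentially by blast
    qed
    from uniform_limit_theorem[OF _ this] show "continuous_on (U k) g"
      by (auto intro!: always_eventually continuous_on_subset[OF W_cont[OF f]])
  qed (rule open_U)
  then have "continuous_on UNIV g" by (simp add: Union_U)
  moreover have "g 0 = 0"
    using f by (simp add: g_def W_def)
  moreover obtain N where N: "\<forall>n\<ge>N. \<forall>t. cmod (f n t - g t) \<le> 1 * weight t"
    using close[OF zero_less_one] by (elim exE)
  have "cmod (g t) \<le> (W_norm (f N) + 1) * weight t" for t
  proof -
    have "cmod (g t) \<le> cmod (f N t) + cmod (f N t - g t)"
      using norm_triangle_ineq4[of "f N t" "f N t - g t"] by simp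
    then show ?thesis using W_bound[OF f, of N t] N[rule_format, of N t] by (simp add: algebra_simps)
  qed
  ultimately have "g \<in> W" by (rule WI)
  then show ?thesis using close by blast
qed

text \<open>Functions in \<open>W\<close> vanish at 0, so a second point is required for a nonzero
  one: on the trivial group the space would be zero.\<close>

lemma nonzero_banach_space_WE:
  assumes "(x :: 'a) \<noteq> 0"
  shows "nonzero_banach_space (WE :: ('u + ('a \<Rightarrow> complex)) normed_module)" (is "nonzero_banach_space ?E")
proof (intro nonzero_banach_space.intro nonzero_banach_space_axioms.intro complex_normed_space_WE)
  interpret E: complex_normed_space ?E by (rule complex_normed_space_WE)
  interpret M: Metric_space "carrier ?E" "norm_dist ?E" by (rule E.metric)
  show "M.mcomplete"
    unfolding M.mcomplete_def
  proof (intro allI impI)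
    fix \<sigma> assume \<sigma>: "M.MCauchy \<sigma>"
    define f where "f n = projr (\<sigma> n)" for n
    have \<sigma>f: "\<sigma> n = Inr (f n)" "f n \<in> W" for n
    proof -
      have "\<sigma> n \<in> carrier ?E" using \<sigma> unfolding M.MCauchy_def by blast
      then show "\<sigma> n = Inr (f n)" "f n \<in> W" by (auto simp: f_def)
    qed
    have diff: "(\<lambda>t. f m t - f n t) \<in> W" for m n
      using W_add[OF \<sigma>f(2) W_smult[OF \<sigma>f(2), of "-1"], of m n] by simp
    have cauchy: "\<exists>N. \<forall>m\<ge>N. \<forall>n\<ge>N. \<forall>t. cmod (f m t - f n t) \<le> e * weight t" if e: "e > 0" for e
    proof -
      obtain N where N: "\<forall>m n. N \<le> m \<longrightarrow> N \<le> n \<longrightarrow> norm_dist ?E (\<sigma> m) (\<sigma> n) < e"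
        using \<sigma> e unfolding M.MCauchy_def by (elim conjE allE[of _ e]) auto
      have "cmod (f m t - f n t) \<le> e * weight t" if "m \<ge> N" "n \<ge> N" for m n t
      proof -
        have "W_norm (\<lambda>t. f m t - f n t) < e"
          using N[rule_format, OF that] \<sigma>f by (simp add: norm_dist_def WE_diff)
        then have "W_norm (\<lambda>t. f m t - f n t) * weight t \<le> e * weight t" by (intro mult_right_mono) auto
        then show ?thesis using W_bound[OF diff[of m n], of t] by linarith
      qed
      then show ?thesis by blast
    qed
    have "\<exists>g\<in>W. \<forall>e>0. \<exists>N. \<forall>n\<ge>N. \<forall>t. cmod (f n t - g t) \<le> e * weight t"
      by (rule W_complete[OF \<sigma>f(2) cauchy])
    then obtain g where g: "g \<in> W"
      "\<forall>e>0. \<exists>N. \<forall>n\<ge>N. \<forall>t. cmod (f n t - g t) \<le> e * weight t" by (elim bexE)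
    have "limitin (norm_topology ?E) \<sigma> (Inr g) sequentially"
      unfolding E.limitin_norm_topology
    proof (intro conjI allI impI)
      fix e :: real assume e: "e > 0"
      then have "e / 2 > 0" by simp
      with g(2) obtain N where N: "\<forall>n\<ge>N. \<forall>t. cmod (f n t - g t) \<le> e / 2 * weight t" by blast
      have "\<sigma> n \<in> carrier ?E \<and> nrm ?E (\<sigma> n \<ominus>\<^bsub>?E\<^esub> Inr g) < e" if n: "n \<ge> N" for n
      proof -
        have "W_norm (\<lambda>t. f n t - g t) \<le> e / 2" using N n by (intro W_norm_le) blast
        then show ?thesis using e \<sigma>f g(1) by (simp add: WE_diff)
      qed
      then show "\<forall>\<^sub>F n in sequentially. \<sigma> n \<in> carrier ?E \<and> nrm ?E (\<sigma> n \<ominus>\<^bsub>?E\<^esub> Inr g) < e"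
        unfolding eventually_sequentially by blast
    qed (use g in simp)
    then show "\<exists>x. limitin M.mtopology \<sigma> x sequentially"
      unfolding norm_topology_def by blast
  qed
  have op: "open (- {0 :: 'a})" and sub: "{x} \<subseteq> - {0}" using assms by auto
  obtain f :: "'a \<Rightarrow> real" where f: "continuous_on UNIV f" "\<forall>t. 0 \<le> f t \<and> f t \<le> 1" "\<forall>t\<in>{x}. f t = 1"
    "\<forall>t. t \<notin> - {0} \<longrightarrow> f t = 0"
    using ex_cutoff[OF compact_sing op sub] by (elim exE conjE)
  have "(\<lambda>t. complex_of_real (f t)) \<in> W"
  proof (rule WI[where C = 1])
    show "cmod (complex_of_real (f t)) \<le> 1 * weight t" for t
      using f(2)[rule_format, of t] weight_ge_1[of t] by simp
  qed (use f in \<open>auto intro!: continuous_intros\<close>)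
  moreover have "(\<lambda>t. complex_of_real (f t)) \<noteq> (\<lambda>t. 0)"
    using f(3) by (metis of_real_eq_1_iff singletonI zero_neq_one)
  ultimately show "carrier ?E \<noteq> {\<zero>\<^bsub>?E\<^esub>}" by (auto simp: set_eq_iff image_iff)
qed

text \<open>The action of a by translations, followed by subtraction of the value at 0, which is the
  integral of a(s) f(s). The subtraction keeps the result in \<open>W\<close>.\<close>

definition shift :: "('a \<Rightarrow> complex) \<Rightarrow> ('a \<Rightarrow> complex) \<Rightarrow> 'a \<Rightarrow> complex" where
  "shift a f t = (\<integral>s. a s * (f (s + t) - f s) \<partial>\<mu>)"

lemma integrable_Cc_mult:
  assumes "a \<in> Cc" "continuous_on UNIV g"
  shows "integrable \<mu> (\<lambda>s. a s * g s)"
  using CcD[OF assms(1)] assms(2)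
  by (intro integrable_continuous_compact[of _ "supp a"] continuous_on_mult) (auto simp: supp_outside)

lemma continuous_on_increment:
  fixes f :: "'a \<Rightarrow> complex"
  assumes f: "continuous_on UNIV f"
  shows "continuous_on UNIV (\<lambda>s. f (s + t) - f s)"
  by (intro continuous_on_diff f continuous_on_compose2[OF f] continuous_intros) auto

text \<open>The terms f(s + t) and f(s) contribute (n + 2) w(t) each: the first by
  \<open>weight_add_le\<close>, the second because w(s) \<le> n + 1 on \<open>U n\<close> while w(t)
  \<ge> 1. The function a enters only through n and its \<open>L1_norm\<close>, which gives
  continuity on each \<open>CK K\<close>.\<close>

lemma norm_shift_le:
  assumes a: "a \<in> CK C" and C: "C \<subseteq> U n" and f: "f \<in> W"
  shows "cmod (shift a f t) \<le> (2 * (real n + 2) * L1_norm \<mu> a * W_norm f) * weight t"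
proof -
  have ac: "a \<in> Cc" using a CK_subset_Cc by blast
  have "cmod (shift a f t) \<le> (2 * (real n + 2) * W_norm f * weight t) * L1_norm \<mu> a"
    unfolding shift_def
  proof (rule norm_integral_Cc_le[OF ac continuous_on_increment[OF W_cont[OF f]]])
    fix s assume "a s \<noteq> 0"
    then have "s \<in> supp a" using supp_outside by blast
    then have s: "s \<in> U n" using a C by (auto simp: CK_def)
    have "cmod (f (s + t)) \<le> W_norm f * ((real n + 2) * weight t)"
      using W_bound[OF f, of "s + t"] mult_left_mono[OF weight_add_le[OF s, of t] W_norm_nonneg[OF f]] by linarith
    moreover have "weight s \<le> (real n + 2) * weight t"
    proof -
      have "weight s \<le> (real n + 2) * 1" using weight_le[OF s] by simp
      also have "\<dots> \<le> (real n + 2) * weight t" using weight_ge_1[of t] by (intro mult_left_mono) auto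
      finally show ?thesis .
    qed
    then have "cmod (f s) \<le> W_norm f * ((real n + 2) * weight t)"
      using W_bound[OF f, of s] mult_left_mono[OF _ W_norm_nonneg[OF f]] by (meson order_trans)
    ultimately show "cmod (f (s + t) - f s) \<le> 2 * (real n + 2) * W_norm f * weight t"
      using norm_triangle_ineq4[of "f (s + t)" "f s"] by (simp add: algebra_simps)
  qed
  then show ?thesis by (simp add: mult_ac)
qed

lemma shift_W:
  assumes a: "a \<in> Cc" and f: "f \<in> W"
  shows "shift a f \<in> W"
proof -
  obtain n where n: "supp a \<subseteq> U n" using compact_subset_U[OF CcD(2)[OF a]] by blast
  show ?thesis
  proof (rule WI[OF _ _ norm_shift_le[OF mem_CK_supp[OF a] n f]])
    define F where "F p = a (fst p) * (f (fst p + snd p) - f (fst p))" for p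
    have F: "continuous_on UNIV F"
      unfolding F_def by (intro continuous_on_mult continuous_on_diff continuous_on_compose2[OF CcD(1)[OF a]]
        continuous_on_compose2[OF W_cont[OF f]] continuous_intros) auto
    have "continuous_on UNIV (\<lambda>t. \<integral>s. F (s, t) \<partial>\<mu>)"
      by (rule continuous_on_integral[OF F CcD(2)[OF a]]) (simp add: F_def supp_outside)
    then show "continuous_on UNIV (shift a f)" by (simp add: F_def shift_def[abs_def])
    show "shift a f 0 = 0" by (simp add: shift_def)
  qed
qed

lemma shift_add_right:
  assumes a: "a \<in> Cc" and f: "f \<in> W" and g: "g \<in> W"
  shows "shift a (\<lambda>t. f t + g t) = (\<lambda>t. shift a f t + shift a g t)"
proof
  fix t
  note i = integrable_Cc_mult[OF a continuous_on_increment[OF W_cont[OF f]], of t]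
    integrable_Cc_mult[OF a continuous_on_increment[OF W_cont[OF g]], of t]
  show "shift a (\<lambda>t. f t + g t) t = shift a f t + shift a g t"
    unfolding shift_def by (subst Bochner_Integration.integral_add[OF i, symmetric]) (simp add: algebra_simps)
qed

lemma shift_smult_right: "shift a (\<lambda>t. c * f t) = (\<lambda>t. c * shift a f t)"
proof
  fix t
  have "a s * (c * f (s + t) - c * f s) = c * (a s * (f (s + t) - f s))" for s
    by (simp add: algebra_simps)
  then show "shift a (\<lambda>t. c * f t) t = c * shift a f t"
    by (simp only: shift_def integral_mult_right_zero)
qed

lemma shift_add_left:
  assumes a: "a \<in> Cc" and b: "b \<in> Cc" and f: "f \<in> W"
  shows "shift (\<lambda>t. a t + b t) f = (\<lambda>t. shift a f t + shift b f t)"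
proof
  fix t
  note i = integrable_Cc_mult[OF a continuous_on_increment[OF W_cont[OF f]], of t]
    integrable_Cc_mult[OF b continuous_on_increment[OF W_cont[OF f]], of t]
  show "shift (\<lambda>t. a t + b t) f t = shift a f t + shift b f t"
    unfolding shift_def by (subst Bochner_Integration.integral_add[OF i, symmetric]) (simp add: algebra_simps)
qed

lemma shift_smult_left: "shift (\<lambda>t. c * a t) f = (\<lambda>t. c * shift a f t)"
  by (simp add: shift_def fun_eq_iff mult.assoc)

text \<open>The constants subtracted by \<open>shift\<close> cancel in a difference. Hence
  \<open>shift\<close> composes as plain translations do, which is what
  \<open>shift_convolution\<close> uses.\<close>

lemma shift_diff:
  assumes a: "a \<in> Cc" and f: "f \<in> W"
  shows "shift a f (s + t) - shift a f s = (\<integral>r. a r * (f (r + (s + t)) - f (r + s)) \<partial>\<mu>)"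
proof -
  note i = integrable_Cc_mult[OF a continuous_on_increment[OF W_cont[OF f]]]
  show ?thesis
    unfolding shift_def by (subst Bochner_Integration.integral_diff[OF i i, symmetric]) (simp add: algebra_simps)
qed

lemma shift_convolution:
  assumes a: "a \<in> Cc" and b: "b \<in> Cc" and f: "f \<in> W"
  shows "shift (convolution \<mu> a b) f = shift b (shift a f)"
proof
  fix t
  have "shift (convolution \<mu> a b) f t = (\<integral>s. b s * (\<integral>r. a r * (f (r + s + t) - f (r + s)) \<partial>\<mu>) \<partial>\<mu>)"
    unfolding shift_def by (rule integral_convolution'[OF a b continuous_on_increment[OF W_cont[OF f]]])
  also have "\<dots> = shift b (shift a f) t"
    unfolding shift_def[of b] shift_diff[OF a f] by (simp add: add.assoc)
  finally show "shift (convolution \<mu> a b) f t = shift b (shift a f) t" .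
qed

section \<open>The anti-representation and the derivation\<close>

definition shift_rep :: "('a \<Rightarrow> complex) \<Rightarrow> 'u + ('a \<Rightarrow> complex) \<Rightarrow> 'u + ('a \<Rightarrow> complex)" where
  "shift_rep a = (\<lambda>x\<in>carrier WE. Inr (shift a (projr x)))"

definition pairing :: "('a \<Rightarrow> complex) \<Rightarrow> 'u + ('a \<Rightarrow> complex) \<Rightarrow> complex" where
  "pairing a = (\<lambda>x\<in>carrier WE. \<integral>s. a s * projr x s \<partial>\<mu>)"

lemma shift_rep_apply: "f \<in> W \<Longrightarrow> shift_rep a (Inr f) = Inr (shift a f)"
  by (simp add: shift_rep_def)

lemma pairing_apply: "f \<in> W \<Longrightarrow> pairing a (Inr f) = (\<integral>s. a s * f s \<partial>\<mu>)"
  by (simp add: pairing_def)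

lemma nrm_shift_rep_le:
  assumes "a \<in> CK C" "C \<subseteq> U n" "x \<in> carrier WE"
  shows "nrm WE (shift_rep a x) \<le> 2 * (real n + 2) * L1_norm \<mu> a * nrm WE x"
  using assms norm_shift_le[OF assms(1,2)] by (auto simp: shift_rep_apply intro!: W_norm_le)

lemma norm_pairing_le:
  assumes a: "a \<in> CK C" "C \<subseteq> U n" and x: "x \<in> carrier WE"
  shows "cmod (pairing a x) \<le> (real n + 1) * L1_norm \<mu> a * nrm WE x"
proof -
  obtain f where f: "f \<in> W" "x = Inr f" using x by auto
  have ac: "a \<in> Cc" using a CK_subset_Cc by blast
  have "cmod (\<integral>s. a s * f s \<partial>\<mu>) \<le> ((real n + 1) * W_norm f) * L1_norm \<mu> a"
  proof (rule norm_integral_Cc_le[OF ac W_cont[OF f(1)]])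
    fix s assume "a s \<noteq> 0"
    then have "s \<in> supp a" using supp_outside by blast
    then have s: "s \<in> U n" using a by (auto simp: CK_def)
    show "cmod (f s) \<le> (real n + 1) * W_norm f"
      using W_bound[OF f(1), of s] mult_left_mono[OF weight_le[OF s] W_norm_nonneg[OF f(1)]]
      by (simp add: mult.commute)
  qed
  then show ?thesis using f by (simp add: pairing_apply mult_ac)
qed

sublocale WE_pair: normed_space_pair WE WE
  by (simp add: normed_space_pair_def complex_normed_space_WE)

sublocale WE_dual: normed_space_pair WE complex_space
  by (rule normed_space_pair_dual[OF complex_normed_space_WE])

lemma shift_rep_closed:
  assumes a: "a \<in> Cc"
  shows "shift_rep a \<in> carrier (bounded_ops WE WE)"
proof -
  obtain n where n: "supp a \<subseteq> U n" using compact_subset_U[OF CcD(2)[OF a]] by blast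
  show ?thesis
  proof (rule WE_pair.bounded_opsI[OF _ _ nrm_shift_rep_le[OF mem_CK_supp[OF a] n]])
    show "shift_rep a \<in> extensional (carrier WE)" by (simp add: shift_rep_def)
    show "linear_map WE WE (shift_rep a)"
      by (rule linear_mapI) (auto simp: shift_rep_apply shift_W a W_add W_smult shift_add_right shift_smult_right)
  qed
qed

lemma pairing_closed:
  assumes a: "a \<in> Cc"
  shows "pairing a \<in> carrier (dual (WE :: ('u + ('a \<Rightarrow> complex)) normed_module))" (is "_ \<in> carrier (dual ?E)")
proof -
  obtain n where n: "supp a \<subseteq> U n" using compact_subset_U[OF CcD(2)[OF a]] by blast
  show ?thesis
    unfolding dual_def
  proof (rule WE_dual.bounded_opsI)
    show "pairing a \<in> extensional (carrier ?E)" by (simp add: pairing_def)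
    show "nrm complex_space (pairing a x) \<le> (real n + 1) * L1_norm \<mu> a * nrm ?E x" if "x \<in> carrier ?E" for x
      using norm_pairing_le[OF mem_CK_supp[OF a] n that] by simp
    show "linear_map ?E complex_space (pairing a)"
    proof (rule linear_mapI)
      fix x y assume "x \<in> carrier ?E" "y \<in> carrier ?E"
      then obtain f g where fg: "f \<in> W" "x = Inr f" "g \<in> W" "y = Inr g" by auto
      then show "pairing a (x \<oplus>\<^bsub>?E\<^esub> y) = pairing a x \<oplus>\<^bsub>complex_space\<^esub> pairing a y"
        using integrable_Cc_mult[OF a W_cont[OF fg(1)]] integrable_Cc_mult[OF a W_cont[OF fg(3)]]
        by (simp add: pairing_apply W_add distrib_left)
    next
      fix c x assume "x \<in> carrier ?E"
      then show "pairing a (c \<odot>\<^bsub>?E\<^esub> x) = c \<odot>\<^bsub>complex_space\<^esub> pairing a x"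
        by (auto simp: pairing_apply W_smult mult.left_commute)
    qed simp
  qed
qed

lemma continuous_anti_representation_shift:
  "locally_convex_algebra.continuous_anti_representation (Cc_algebra \<mu>)
     (WE :: ('u + ('a \<Rightarrow> complex)) normed_module) shift_rep"
  (is "locally_convex_algebra.continuous_anti_representation _ ?E ?rep")
proof -
  interpret A: locally_convex_algebra "Cc_algebra \<mu>" by (rule locally_convex_algebra_Cc)
  have lin: "linear_map (L1_space \<mu> Cc) (bounded_ops ?E ?E) ?rep"
  proof (rule linear_mapI)
    fix a b assume a: "a \<in> carrier (L1_space \<mu> Cc)" and b: "b \<in> carrier (L1_space \<mu> Cc)"
    show "?rep a \<in> carrier (bounded_ops ?E ?E)" using a shift_rep_closed by simp
    show "?rep (a \<oplus>\<^bsub>L1_space \<mu> Cc\<^esub> b) = ?rep a \<oplus>\<^bsub>bounded_ops ?E ?E\<^esub> ?rep b"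
      by (rule extensionalityI[of _ "carrier ?E"])
        (use a b in \<open>auto simp: shift_rep_def shift_add_left\<close>)
    show "?rep (c \<odot>\<^bsub>L1_space \<mu> Cc\<^esub> a) = c \<odot>\<^bsub>bounded_ops ?E ?E\<^esub> ?rep a" for c
      by (rule extensionalityI[of _ "carrier ?E"])
        (use a in \<open>auto simp: shift_rep_def shift_smult_left\<close>)
  qed
  have "continuous_map (Cc_topology \<mu>) (norm_topology (bounded_ops ?E ?E)) ?rep"
  proof (rule continuous_map_Cc_topology_norm_topology[OF WE_pair.complex_normed_space_bounded_ops lin])
    fix K :: "'a set" assume "compact K"
    then obtain n where n: "K \<subseteq> U n" using compact_subset_U by blast
    have "nrm (bounded_ops ?E ?E) (?rep a) \<le> 2 * (real n + 2) * L1_norm \<mu> a" if "a \<in> CK K" for a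
      using L1_norm_nonneg[of a] by (intro WE_pair.nrm_bounded_ops_le nrm_shift_rep_le[OF that n]) auto
    then show "\<exists>C. \<forall>a\<in>CK K. nrm (bounded_ops ?E ?E) (?rep a) \<le> C * L1_norm \<mu> a" by blast
  qed
  moreover have "?rep (convolution \<mu> a b) = compose (carrier ?E) (?rep b) (?rep a)"
    if a: "a \<in> Cc" and b: "b \<in> Cc" for a b
    by (rule extensionalityI[of _ "carrier ?E"])
      (use a b in \<open>auto simp: shift_rep_apply compose_def shift_convolution shift_W, auto simp: shift_rep_def\<close>)
  ultimately show ?thesis
    using lin unfolding A.continuous_anti_representation_def A.continuous_linear_def
    by (simp add: Cc_algebra_def linear_map_convolution_algebra)
qed

lemma continuous_linear_pairing:
  "locally_convex_algebra.continuous_linear (Cc_algebra \<mu>)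
     (dual (WE :: ('u + ('a \<Rightarrow> complex)) normed_module)) pairing"
  (is "locally_convex_algebra.continuous_linear _ (dual ?E) ?pairing")
proof -
  interpret A: locally_convex_algebra "Cc_algebra \<mu>" by (rule locally_convex_algebra_Cc)
  have lin: "linear_map (L1_space \<mu> Cc) (dual ?E) ?pairing"
  proof (rule linear_mapI)
    fix a b assume a: "a \<in> carrier (L1_space \<mu> Cc)" and b: "b \<in> carrier (L1_space \<mu> Cc)"
    show "?pairing a \<in> carrier (dual ?E)" using a pairing_closed by simp
    have i: "integrable \<mu> (\<lambda>s. a s * f s)" "integrable \<mu> (\<lambda>s. b s * f s)" if "f \<in> W" for f
      using integrable_Cc_mult W_cont[OF that] a b by auto
    show "?pairing (a \<oplus>\<^bsub>L1_space \<mu> Cc\<^esub> b) = ?pairing a \<oplus>\<^bsub>dual ?E\<^esub> ?pairing b"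
      unfolding dual_def
      by (rule extensionalityI[of _ "carrier ?E"]) (auto simp: pairing_def distrib_right i)
    show "?pairing (c \<odot>\<^bsub>L1_space \<mu> Cc\<^esub> a) = c \<odot>\<^bsub>dual ?E\<^esub> ?pairing a" for c
      unfolding dual_def
      by (rule extensionalityI[of _ "carrier ?E"]) (auto simp: pairing_def mult.assoc)
  qed
  have "continuous_map (Cc_topology \<mu>) (norm_topology (dual ?E)) ?pairing"
  proof (rule continuous_map_Cc_topology_norm_topology[OF complex_normed_space_dual[OF complex_normed_space_WE] lin])
    fix K :: "'a set" assume "compact K"
    then obtain n where n: "K \<subseteq> U n" using compact_subset_U by blast
    have "nrm (dual ?E) (?pairing a) \<le> (real n + 1) * L1_norm \<mu> a" if "a \<in> CK K" for a
      unfolding dual_def using L1_norm_nonneg[of a] norm_pairing_le[OF that n]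
      by (intro WE_dual.nrm_bounded_ops_le) auto
    then show "\<exists>C. \<forall>a\<in>CK K. nrm (dual ?E) (?pairing a) \<le> C * L1_norm \<mu> a" by blast
  qed
  then show ?thesis
    using lin unfolding A.continuous_linear_def
    by (simp add: Cc_algebra_def linear_map_convolution_algebra)
qed

text \<open>Translating f by a without normalisation gives \<open>shift a f\<close> plus the
  constant that \<open>pairing a\<close> assigns to f. Integrated against b, this constant produces
  the term with \<open>haar_integral \<mu> b\<close>.\<close>

lemma pairing_derivation:
  assumes a: "a \<in> Cc" and b: "b \<in> Cc"
  shows "pairing (convolution \<mu> a b) =
    adjoint WE (shift_rep a) (pairing b) \<oplus>\<^bsub>dual WE\<^esub> (haar_integral \<mu> b \<odot>\<^bsub>dual WE\<^esub> pairing a)"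
  unfolding dual_def
proof (rule extensionalityI[of _ "carrier WE"])
  fix x assume "x \<in> carrier WE"
  then obtain f where f: "f \<in> W" "x = Inr f" by auto
  note fc = W_cont[OF f(1)]
  have ft: "continuous_on UNIV (\<lambda>s. f (s + t))" for t
    by (rule continuous_on_compose2[OF fc]) (auto intro!: continuous_intros)
  define c where "c = (\<integral>s. a s * f s \<partial>\<mu>)"
  have shift: "shift a f t + c = (\<integral>s. a s * f (s + t) \<partial>\<mu>)" for t
    unfolding shift_def c_def
    by (subst Bochner_Integration.integral_add[OF integrable_Cc_mult[OF a continuous_on_increment[OF fc]]
          integrable_Cc_mult[OF a fc], symmetric]) (simp add: algebra_simps)
  have "(\<integral>t. convolution \<mu> a b t * f t \<partial>\<mu>) = (\<integral>t. b t * (shift a f t + c) \<partial>\<mu>)"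
    unfolding shift by (rule integral_convolution'[OF a b fc])
  also have "\<dots> = (\<integral>t. b t * shift a f t + b t * c \<partial>\<mu>)" by (simp add: distrib_left)
  also have "\<dots> = (\<integral>t. b t * shift a f t \<partial>\<mu>) + (\<integral>t. b t * c \<partial>\<mu>)"
    using integrable_Cc[OF b]
    by (intro Bochner_Integration.integral_add integrable_Cc_mult[OF b W_cont[OF shift_W[OF a f(1)]]]) auto
  finally show "pairing (convolution \<mu> a b) x = (adjoint WE (shift_rep a) (pairing b) \<oplus>\<^bsub>bounded_ops WE complex_space\<^esub>
      (haar_integral \<mu> b \<odot>\<^bsub>bounded_ops WE complex_space\<^esub> pairing a)) x"
    using f shift_W[OF a f(1)]
    by (simp add: pairing_apply adjoint_def compose_def shift_rep_apply haar_integral_def c_def)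
qed (simp_all add: pairing_def)

text \<open>
  If \<open>\<theta> = pairing\<close> were of the form \<open>\<theta>(a) = \<omega>(a) \<phi> - \<Phi>(a)\<^sup>* \<phi>\<close>, one could test it on functions \<open>f\<close>
  that vanish on \<open>U n\<close> and are \<open>1\<close> further out, and on \<open>a\<close> of integral one living very far out. Then
  \<open>\<theta>(a) f = 1\<close>, while both \<open>f\<close> and \<open>\<Phi>(a) f\<close> are bounded by one and vanish on \<open>U n\<close>, hence small
  in \<open>WE\<close>.
\<close>

theorem amenable_imp_compact:
  assumes amenable: "continuous_character.amenable (Cc_algebra \<mu>) (haar_integral \<mu>) TYPE('u + ('a \<Rightarrow> complex))"
  shows "compact (UNIV :: 'a set)"
proof (rule ccontr)
  assume nc: "\<not> compact (UNIV :: 'a set)"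
  \<comment> \<open>A noncompact group has an element other than 0, which makes the Banach space
    nonzero.\<close>
  have "\<exists>x0 :: 'a. x0 \<noteq> 0"
  proof (rule ccontr)
    assume "\<nexists>x0 :: 'a. x0 \<noteq> 0"
    then have "(UNIV :: 'a set) = {0}" by blast
    then have "compact (UNIV :: 'a set) = compact {0 :: 'a}" by (rule arg_cong)
    then show False using nc by (simp only: compact_sing)
  qed
  then obtain x0 :: 'a where "x0 \<noteq> 0" by (elim exE)
  then have banach: "nonzero_banach_space (WE :: ('u + ('a \<Rightarrow> complex)) normed_module)"
    by (rule nonzero_banach_space_WE)
  interpret C: continuous_character "Cc_algebra \<mu>" "haar_integral \<mu>" by (rule continuous_character_haar_integral)
  have der: "\<forall>a\<in>carrier (Cc_algebra \<mu>). \<forall>b\<in>carrier (Cc_algebra \<mu>).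
      (pairing (a \<otimes>\<^bsub>Cc_algebra \<mu>\<^esub> b) :: 'u + ('a \<Rightarrow> complex) \<Rightarrow> complex) =
      adjoint WE (shift_rep a) (pairing b) \<oplus>\<^bsub>dual WE\<^esub> (haar_integral \<mu> b \<odot>\<^bsub>dual WE\<^esub> pairing a)"
    by (simp add: Cc_algebra_def pairing_derivation)
  obtain \<phi> :: "'u + ('a \<Rightarrow> complex) \<Rightarrow> complex" where \<phi>: "\<phi> \<in> carrier (dual WE)"
    "\<forall>a\<in>carrier (Cc_algebra \<mu>). pairing a =
      (haar_integral \<mu> a \<odot>\<^bsub>dual WE\<^esub> \<phi>) \<ominus>\<^bsub>dual WE\<^esub> adjoint WE (shift_rep a) \<phi>"
    using amenable[unfolded C.amenable_def, THEN spec, THEN spec, THEN spec, THEN mp, OF banach,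
        THEN mp, OF continuous_anti_representation_shift, THEN mp, OF continuous_linear_pairing, THEN mp, OF der]
    by (elim bexE)
  interpret dual: complex_normed_space "dual WE" by (rule complex_normed_space_dual[OF complex_normed_space_WE])
  define N where "N = nrm (dual WE) \<phi>"
  \<comment> \<open>The test function and its image under \<open>shift_rep a\<close> both have norm
    at most 1 / (n + 2), whence the factor 2. The inequality fails once n > 2N.\<close>
  have bound: "1 \<le> 2 * N / (real n + 2)" for n
  proof -
    obtain c :: "'a \<Rightarrow> real" where c: "continuous_on UNIV c" "\<forall>t. 0 \<le> c t \<and> c t \<le> 1" "\<forall>t\<in>L n. c t = 1"
      "\<forall>t. t \<notin> U (Suc n) \<longrightarrow> c t = 0"
      using ex_cutoff[OF compact_L open_U L_subset_U[of n]] by (elim exE conjE)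
    define f where "f t = complex_of_real (1 - c t)" for t
    \<comment> \<open>Off \<open>U n\<close> the weight is at least n + 2, so a function bounded by
      one that vanishes on \<open>U n\<close> is small in norm.\<close>
    have small: "g \<in> W \<and> W_norm g \<le> 1 / (real n + 2)"
      if g: "continuous_on UNIV g" "\<And>t. cmod (g t) \<le> 1" "\<And>t. t \<in> U n \<Longrightarrow> g t = 0" for g
    proof -
      have le: "cmod (g t) \<le> 1 / (real n + 2) * weight t" for t
      proof (cases "t \<in> U n")
        case False
        then have "1 \<le> 1 / (real n + 2) * weight t" using weight_ge[of t n] by (simp add: divide_simps)
        with g(2)[of t] show ?thesis by (rule order_trans)
      qed (simp add: g(3))
      then show ?thesis using g(1) g(3)[OF zero_U] by (auto intro: WI[OF _ _ le] W_norm_le)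
    qed
    have f: "f \<in> W \<and> W_norm f \<le> 1 / (real n + 2)"
    proof (rule small)
      show "continuous_on UNIV f" unfolding f_def[abs_def] using c(1) by (intro continuous_intros)
      show "cmod (f t) \<le> 1" for t
        unfolding f_def norm_of_real using c(2)[rule_format, of t] by simp
      show "f t = 0" if "t \<in> U n" for t
        using c(3) U_subset_L that by (auto simp: f_def)
    qed
    \<comment> \<open>The margin of two levels: c vanishes off \<open>U (Suc n)\<close>, and
      cancelling an element t of \<open>U n\<close> from s + t costs one more level. If t is in
      \<open>U n\<close> and c(s + t) is nonzero, then s lies in \<open>U (n + 2)\<close>, where a
      vanishes.\<close>
    have "- L (n + 2) \<noteq> {}" using nc compact_L[of "n + 2"] by (metis Compl_empty_eq double_compl)
    then obtain p where p: "p \<in> - L (n + 2)" by blast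
    have op: "open (- L (n + 2))" using compact_imp_closed[OF compact_L] by blast
    obtain u :: "'a \<Rightarrow> real" where u: "\<forall>t. 0 \<le> u t" "\<forall>t. t \<notin> - L (n + 2) \<longrightarrow> u t = 0"
      "(\<lambda>t. complex_of_real (u t)) \<in> Cc" "(\<integral>t. u t \<partial>\<mu>) = 1"
      using ex_bump[OF op p] by (elim exE conjE)
    define a where "a t = complex_of_real (u t)" for t
    have a: "a \<in> Cc" using u(3) by (simp add: a_def[abs_def])
    have a_int: "haar_integral \<mu> a = 1" "L1_norm \<mu> a = 1"
      using u(1,4) by (simp_all add: haar_integral_def L1_norm_def a_def)
    have a0: "s \<notin> U (n + 2)" if "a s \<noteq> 0" for s
      using u(2) that U_subset_L by (auto simp: a_def)
    have af: "a s * f s = a s" for s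
    proof (cases "a s = 0")
      case False
      then have "s \<notin> U (Suc n)" using a0 U_mono[of "Suc n" "n + 2"] by auto
      then show ?thesis using c(4) by (simp add: f_def)
    qed simp
    \<comment> \<open>Where a does not vanish, f(s) = 1; subtracting it from f(s + t) = 1 - c(s + t)
      leaves -c(s + t).\<close>
    have shift_f: "shift a f t = (\<integral>s. a s * (- complex_of_real (c (s + t))) \<partial>\<mu>)" for t
    proof -
      have "a s * (f (s + t) - f s) = a s * (- complex_of_real (c (s + t)))" for s
        using af[of s] by (simp add: right_diff_distrib) (simp add: f_def algebra_simps)
      then show ?thesis by (simp add: shift_def)
    qed
    have g: "shift a f \<in> W \<and> W_norm (shift a f) \<le> 1 / (real n + 2)"
    proof (rule small)
      show "continuous_on UNIV (shift a f)" using W_cont[OF shift_W[OF a]] f by blast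
      have cc: "continuous_on UNIV (\<lambda>s. - complex_of_real (c (s + t)))" for t
        by (intro continuous_on_minus continuous_on_of_real continuous_on_compose2[OF c(1)] continuous_intros) auto
      show "cmod (shift a f t) \<le> 1" for t
      proof -
        have "cmod (- complex_of_real (c (s + t))) \<le> 1" for s
          using c(2)[rule_format, of "s + t"] by simp
        from norm_integral_Cc_le[OF a cc this] show ?thesis by (simp add: shift_f a_int)
      qed
      show "shift a f t = 0" if t: "t \<in> U n" for t
      proof -
        have "a s * (- complex_of_real (c (s + t))) = 0" for s
        proof (rule ccontr)
          assume nz: "a s * (- complex_of_real (c (s + t))) \<noteq> 0"
          then have "s + t \<in> U (Suc n)" using c(4) by auto
          then have "s + t \<in> L (Suc n)" using U_subset_L by blast
          moreover have "- t \<in> L (Suc n)"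
            using uminus_U[OF t] U_mono[of n "Suc n"] U_subset_L by auto
          ultimately have "(s + t) + - t \<in> U (Suc (Suc n))" by (rule add_L)
          then have "s \<in> U (n + 2)" by (simp add: add.assoc)
          then show False using a0 nz by auto
        qed
        then have "(\<lambda>s. a s * (- complex_of_real (c (s + t)))) = (\<lambda>s. 0)" by (rule ext)
        then show ?thesis by (simp only: shift_f) simp
      qed
    qed
    define X :: "'u + ('a \<Rightarrow> complex)" where "X = Inr f"
    have X: "X \<in> carrier WE" "shift_rep a X \<in> carrier WE"
      using f g by (auto simp: X_def shift_rep_apply)
    have le: "cmod (\<phi> y) \<le> N / (real n + 2)" if "y \<in> carrier WE" "nrm WE y \<le> 1 / (real n + 2)" for y
    proof -
      have "cmod (\<phi> y) \<le> N * nrm WE y"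
        using dual_bound[OF complex_normed_space_WE \<phi>(1) that(1)] by (simp add: N_def)
      also have "\<dots> \<le> N * (1 / (real n + 2))"
        using that(2) dual.nrm_nonneg[OF \<phi>(1)] by (intro mult_left_mono) (auto simp: N_def)
      finally show ?thesis by simp
    qed
    have "pairing a X = 1"
      using f a_int by (simp add: X_def pairing_apply af haar_integral_def)
    moreover have "pairing a X = \<phi> X - \<phi> (shift_rep a X)"
    proof -
      have "haar_integral \<mu> a \<odot>\<^bsub>dual WE\<^esub> \<phi> \<in> carrier (dual WE)" "adjoint WE (shift_rep a) \<phi> \<in> carrier (dual WE)"
        using \<phi>(1) adjoint_closed[OF complex_normed_space_WE shift_rep_closed[OF a] \<phi>(1)] by auto
      from dual_diff_apply[OF complex_normed_space_WE this X(1)]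
      show ?thesis
        using \<phi>(2) a X by (simp add: Cc_algebra_def a_int adjoint_def compose_def) (simp add: dual_def a_int)
    qed
    ultimately have "1 = cmod (\<phi> X - \<phi> (shift_rep a X))" by simp
    also have "\<dots> \<le> N / (real n + 2) + N / (real n + 2)"
      using le[OF X(1)] le[OF X(2)] f g norm_triangle_ineq4[of "\<phi> X" "\<phi> (shift_rep a X)"]
      by (simp add: X_def shift_rep_apply)
    finally show ?thesis by simp
  qed
  obtain n :: nat where n: "real n > 2 * N" using reals_Archimedean2 by blast
  then show False using bound[of n] by (simp add: divide_simps)
qed

end

theorem theorem5p3:
  fixes \<mu> :: "'a::{topological_group_add, t2_space} measure"
  assumes "locally_compact_space (euclidean :: 'a topology)"
    and "left_haar_measure \<mu>"
  shows
    "((compact (UNIV :: 'a set) \<longrightarrow>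
         has_bounded_L1_approximate_identity_in_compact \<mu> TYPE(('a, 'i) net_index)) \<and>
      (has_bounded_L1_approximate_identity_in_compact \<mu> TYPE(('a, 'i) net_index) \<longrightarrow>
         locally_convex_algebra.has_bounded_approximate_identity (Cc0_algebra \<mu>)
           TYPE(('a, 'i) net_index)) \<and>
      (locally_convex_algebra.has_bounded_approximate_identity (Cc0_algebra \<mu>)
           TYPE(('a, 'i) net_index) \<longrightarrow>
         locally_convex_algebra.property_CB (Cc0_algebra \<mu>) TYPE(('a, 'u) banach_carrier)) \<and>
      (locally_convex_algebra.property_CB (Cc0_algebra \<mu>) TYPE(('a, 'u) banach_carrier) \<longrightarrow>
         continuous_character.amenable (Cc_algebra \<mu>) (haar_integral \<mu>)
           TYPE(('a, 'u) banach_carrier))) \<and>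
     ((\<exists>K :: nat \<Rightarrow> 'a set. (\<forall>n. compact (K n)) \<and> (\<Union>n. K n) = UNIV) \<longrightarrow>
      continuous_character.amenable (Cc_algebra \<mu>) (haar_integral \<mu>)
        TYPE(('a, 'u) banach_carrier) \<longrightarrow>
      compact (UNIV :: 'a set))"
proof -
  interpret haar \<mu> by (rule haar.intro) (use assms in auto)
  have "compact (UNIV :: 'a set)"
    if K: "\<exists>K :: nat \<Rightarrow> 'a set. (\<forall>n. compact (K n)) \<and> (\<Union>n. K n) = UNIV"
      and amenable: "continuous_character.amenable (Cc_algebra \<mu>) (haar_integral \<mu>) TYPE(('a, 'u) banach_carrier)"
  proof -
    obtain K :: "nat \<Rightarrow> 'a set" where K: "\<forall>n. compact (K n)" "(\<Union>n. K n) = UNIV"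
      using K by (elim exE conjE)
    obtain U L :: "nat \<Rightarrow> 'a set"
      where UL: "\<forall>n. open (U n) \<and> compact (L n) \<and> U n \<subseteq> L n \<and> 0 \<in> U n \<and> (\<forall>x\<in>U n. - x \<in> U n)"
        "\<forall>n. \<forall>x\<in>L n. \<forall>y\<in>L n. x + y \<in> U (Suc n)" "(\<Union>n. U n) = UNIV"
      using ex_exhaustion[OF K(1)[rule_format] K(2)] by (elim exE conjE)
    interpret haar_exhaustion \<mu> U L
      by unfold_locales (use UL in simp_all)
    show ?thesis by (rule amenable_imp_compact[OF amenable])
  qed
  note amenable_imp_compact = this
  show ?thesis
    by (intro conjI impI;
        (erule compact_imp_L1_approximate_identity L1_approximate_identity_imp_approximate_identity
          locally_convex_algebra.bounded_approximate_identity_imp_CB[OF locally_convex_algebra_Cc0] CB_imp_amenable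
        | rule amenable_imp_compact; assumption))
qed

end
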